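(* Let $(F,\nu)$ be a measure space, $g:F\times F\to\mathbb{C}$ a measurable function, and $(S_x)_{x\in F}$ a measurable family of operators on a separable Hilbert space $\mathcal{H}$. The formula $$(T(f_1\otimes f_2))(\sigma):=\int_F g(x,\sigma)\,f_1(x)\,S_xf_2\,d\nu(x)$$ defines a Hilbert-Schmidt operator $T:L^2(F,d\nu)\hat\otimes\mathcal{H}\to L^2(F,d\nu)\hat\otimes\mathcal{H}$ if and only if $$\int_F\int_F|g(x,\sigma)|^2\,d\nu(\sigma)\,\|S_x\|^2_{\mathcal{S}_2(\mathcal{H})}\,d\nu(x)<\infty .$$ In this case $T$ satisfies $$\|T\|^2_{\mathcal{S}_2(L^2(F,d\nu)\hat\otimes\mathcal{H})}=\int_F\int_F|g(x,\sigma)|^2\,d\nu(\sigma)\,\|S_x\|^2_{\mathcal{S}_2(\mathcal{H})}\,d\nu(x)$$ and $$\mathrm{trace}\,T^n=\int_{F^n}\Big(\prod_{j=1}^{n-1}g(x_j,x_{j+1})\Big)\,g(x_n,x_1)\,\mathrm{trace}(S_{x_n}\circ\cdots\circ S_{x_1})\,d\nu^n(x_1,\ldots,x_n)$$ for all $n\ge2$. Moreover, for these $n$, $$\|T^n\|^2_{\mathcal{S}_2(L^2(F,d\nu)\hat\otimes\mathcal{H})}=\int_F\int_{F^n}\Big|\Big(\prod_{j=1}^{n-1}g(x_j,x_{j+1})\Big)\,g(x_n,\sigma)\Big|^2\,\|S_{x_n}\circ\cdots\circ S_{x_1}\|^2_{\mathcal{S}_2(\mathcal{H})}\,d\nu^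n(x_1,\ldots,x_n)\,d\nu(\sigma).$$
   Context: $\mathcal{S}_2(\mathcal{H})$ denotes the Hilbert-Schmidt operators on $\mathcal{H}$ with the Hilbert-Schmidt norm. $L^2(F,d\nu)\hat\otimes\mathcal{H}$ is the Hilbert space tensor product, whose elements are viewed as square-integrable $\mathcal{H}$-valued functions on $F$. $\nu^n$ is the $n$-fold product measure on $F^n$.
   Formalization: The measure ν is assumed σ-finite, and the last formula, false as printed, is corrected: ‖T^n‖² is the integral over x_1 and σ of the squared Hilbert-Schmidt norm of the integral over x_2,…,x_n of the product of the g's times S_{x_n}∘⋯∘S_{x_1}. *)

theory Defs
  imports "HOL-Analysis.Analysis"
begin

text \<open>
  Complex Hilbert spaces as a type class. The inner product is linear in the first argument.
  Separability is expressed by adding the class \<open>second_countable_topology\<close>, which is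
  equivalent for metric spaces.
\<close>

class chilbert_space = banach +
  fixes scaleC :: "complex \<Rightarrow> 'a \<Rightarrow> 'a" (infixr \<open>*\<^sub>C\<close> 75)
    and cinner :: "'a \<Rightarrow> 'a \<Rightarrow> complex"
  assumes scaleC_add_right: "c *\<^sub>C (u + v) = c *\<^sub>C u + c *\<^sub>C v"
    and scaleC_add_left: "(c + d) *\<^sub>C u = c *\<^sub>C u + d *\<^sub>C u"
    and scaleC_scaleC: "c *\<^sub>C d *\<^sub>C u = (c * d) *\<^sub>C u"
    and scaleC_of_real: "complex_of_real r *\<^sub>C u = r *\<^sub>R u"
    and cinner_commute: "cinner u v = cnj (cinner v u)"
    and cinner_add_left: "cinner (u + v) w = cinner u w + cinner v w"
    and cinner_scaleC_left: "cinner (c *\<^sub>C u) v = c * cinner u v"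
    and cinner_self: "cinner u u = complex_of_real ((norm u)\<^sup>2)"

instantiation complex :: chilbert_space
begin
definition scaleC_complex :: "complex \<Rightarrow> complex \<Rightarrow> complex" where "scaleC_complex c z = c * z"
definition cinner_complex :: "complex \<Rightarrow> complex \<Rightarrow> complex" where "cinner_complex z w = z * cnj w"
instance
  by standard
    (simp_all add: scaleC_complex_def cinner_complex_def algebra_simps scaleR_conv_of_real
      complex_mult_cnj cmod_def)
end

definition bounded_clinear :: "('h::chilbert_space \<Rightarrow> 'h) \<Rightarrow> bool" where
  "bounded_clinear A \<longleftrightarrow> bounded_linear A \<and> (\<forall>c v. A (c *\<^sub>C v) = c *\<^sub>C A v)"

text \<open>
  The Hilbert-Schmidt norm and the trace are needed for two kinds of Hilbert spaces: a type
  \<open>'h\<close> of class \<open>chilbert_space\<close>, and the space \<open>L\<^sup>2(M; 'h)\<close>, whose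
  elements are represented by square-integrable functions. They are therefore defined for a set
  \<open>V\<close> of vectors with a form \<open>ip\<close> that may be only positive semidefinite, vectors
  at distance \<open>0\<close> representing the same element of the Hilbert space. An orthonormal basis
  is a maximal orthonormal set, with one representative for each of its members.
\<close>

definition is_onb :: "'v set \<Rightarrow> ('v \<Rightarrow> 'v \<Rightarrow> complex) \<Rightarrow> 'v set \<Rightarrow> bool" where
  "is_onb V ip B \<longleftrightarrow>
     B \<subseteq> V \<and>
     (\<forall>b\<in>B. \<forall>b'\<in>B. ip b b' = (if b = b' then 1 else 0)) \<and>
     (\<forall>v\<in>V. (\<forall>b\<in>B. ip v b = 0) \<longrightarrow> ip v v = 0)"

definition some_onb :: "'v set \<Rightarrow> ('v \<Rightarrow> 'v \<Rightarrow> complex) \<Rightarrow> 'v set" where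
  "some_onb V ip = (SOME B. is_onb V ip B)"

text \<open>The squared Hilbert-Schmidt norm, equal to \<open>\<infinity>\<close> if the operator is not Hilbert-Schmidt.\<close>

definition hs_norm_sq :: "'v set \<Rightarrow> ('v \<Rightarrow> 'v \<Rightarrow> complex) \<Rightarrow> ('v \<Rightarrow> 'v) \<Rightarrow> ennreal" where
  "hs_norm_sq V ip A = (\<Sum>\<^sub>\<infinity>b\<in>some_onb V ip. ennreal (Re (ip (A b) (A b))))"

text \<open>
  A bounded operator is of trace class iff its trace series converges unconditionally in every
  orthonormal basis, the value then being independent of the basis.
\<close>

definition trace_class :: "'v set \<Rightarrow> ('v \<Rightarrow> 'v \<Rightarrow> complex) \<Rightarrow> ('v \<Rightarrow> 'v) \<Rightarrow> bool" where
  "trace_class V ip A \<longleftrightarrow>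
     (\<exists>t. \<forall>B. is_onb V ip B \<longrightarrow> ((\<lambda>b. ip (A b) b) has_sum t) B)"

definition op_trace :: "'v set \<Rightarrow> ('v \<Rightarrow> 'v \<Rightarrow> complex) \<Rightarrow> ('v \<Rightarrow> 'v) \<Rightarrow> complex" where
  "op_trace V ip A = (\<Sum>\<^sub>\<infinity>b\<in>some_onb V ip. ip (A b) b)"

abbreviation hs_norm_sq_H :: "('h::chilbert_space \<Rightarrow> 'h) \<Rightarrow> ennreal" where
  "hs_norm_sq_H \<equiv> hs_norm_sq UNIV cinner"

abbreviation op_trace_H :: "('h::chilbert_space \<Rightarrow> 'h) \<Rightarrow> complex" where
  "op_trace_H \<equiv> op_trace UNIV cinner"

text \<open>
  \<open>L\<^sup>2(M; 'h)\<close>, which is the Hilbert space tensor product of \<open>L\<^sup>2(M)\<close> and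
  \<open>'h\<close>; for \<open>'h = complex\<close> it is \<open>L\<^sup>2(M)\<close> itself.
\<close>

definition L2 :: "'f measure \<Rightarrow> ('f \<Rightarrow> 'h::chilbert_space) set" where
  "L2 M = {f \<in> borel_measurable M. integrable M (\<lambda>x. (norm (f x))\<^sup>2)}"

definition L2_inner :: "'f measure \<Rightarrow> ('f \<Rightarrow> 'h) \<Rightarrow> ('f \<Rightarrow> 'h::{chilbert_space, second_countable_topology}) \<Rightarrow> complex" where
  "L2_inner M f h = (LINT x|M. cinner (f x) (h x))"

definition tensor :: "('f \<Rightarrow> complex) \<Rightarrow> 'h::chilbert_space \<Rightarrow> 'f \<Rightarrow> 'h" where
  "tensor f v = (\<lambda>x. f x *\<^sub>C v)"

text \<open>
  Bounded operators on \<open>L\<^sup>2(M; 'h)\<close>, acting on representatives. Linearity and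
  boundedness imply that functions that agree almost everywhere have images that agree almost
  everywhere.
\<close>

definition L2_operator ::
  "'f measure \<Rightarrow> (('f \<Rightarrow> 'h) \<Rightarrow> ('f \<Rightarrow> 'h::{chilbert_space, second_countable_topology})) \<Rightarrow> bool" where
  "L2_operator M T \<longleftrightarrow>
     (\<forall>f\<in>L2 M. T f \<in> L2 M) \<and>
     (\<forall>f\<in>L2 M. \<forall>h\<in>L2 M. AE x in M. T (\<lambda>y. f y + h y) x = T f x + T h x) \<and>
     (\<forall>c. \<forall>f\<in>L2 M. AE x in M. T (\<lambda>y. c *\<^sub>C f y) x = c *\<^sub>C T f x) \<and>
     (\<exists>C. \<forall>f\<in>L2 M. Re (L2_inner M (T f) (T f)) \<le> C * Re (L2_inner M f f))"

definition L2_hilbert_schmidt ::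
  "'f measure \<Rightarrow> (('f \<Rightarrow> 'h) \<Rightarrow> ('f \<Rightarrow> 'h::{chilbert_space, second_countable_topology})) \<Rightarrow> bool" where
  "L2_hilbert_schmidt M T \<longleftrightarrow> L2_operator M T \<and> hs_norm_sq (L2 M) (L2_inner M) T < \<infinity>"

text \<open>
  \<open>T\<close> is given on elementary tensors by integration against \<open>g x \<sigma> *\<^sub>C S x\<close>.
  Since elementary tensors span a dense subspace, this determines a bounded \<open>T\<close> up to
  equality almost everywhere.
\<close>

definition given_by_kernel ::
  "'f measure \<Rightarrow> ('f \<Rightarrow> 'f \<Rightarrow> complex) \<Rightarrow> ('f \<Rightarrow> 'h \<Rightarrow> 'h) \<Rightarrow>
   (('f \<Rightarrow> 'h) \<Rightarrow> ('f \<Rightarrow> 'h::{chilbert_space, second_countable_topology})) \<Rightarrow> bool" where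
  "given_by_kernel M g S T \<longleftrightarrow>
     (\<forall>f1\<in>L2 M. \<forall>f2. AE \<sigma> in M.
        integrable M (\<lambda>x. (g x \<sigma> * f1 x) *\<^sub>C S x f2) \<and>
        T (tensor f1 f2) \<sigma> = (LINT x|M. (g x \<sigma> * f1 x) *\<^sub>C S x f2))"

text \<open>\<open>chain S n x\<close> is the composition of \<open>S (x n), \<dots>, S (x 1)\<close>, with \<open>S (x 1)\<close> applied first.\<close>

fun chain :: "('f \<Rightarrow> 'h \<Rightarrow> 'h) \<Rightarrow> nat \<Rightarrow> (nat \<Rightarrow> 'f) \<Rightarrow> 'h \<Rightarrow> 'h" where
  "chain S 0 x = id"
| "chain S (Suc k) x = S (x (Suc k)) \<circ> chain S k x"

end

theory Submission
  imports Defs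
begin

text \<open>
  With \<open>K x s = g x s *\<^sub>C S x\<close>, the operator \<open>T\<close> is the integral operator on
  \<open>L\<^sup>2(M; 'h)\<close> with the operator-valued kernel \<open>K\<close>, so the formulas are those
  for Hilbert-Schmidt integral operators. They come from three facts.

  \<^item> Coefficients. Let \<open>E\<close> be an orthonormal basis of \<open>'h\<close>, which is countable, and
    \<open>A\<close> one of \<open>L\<^sup>2(M)\<close>, which need not be. The tensors of \<open>a\<in>A\<close> and
    \<open>e\<in>E\<close> form an orthonormal basis of \<open>L\<^sup>2(M; 'h)\<close>, the functions
    \<open>cnj (a x) * b s\<close> one of \<open>L\<^sup>2(M \<times> M)\<close>, and the matrix coefficient of \<open>T\<close>
    at the tensors of \<open>(a, e)\<close> and \<open>(b, e')\<close> is the coefficient of the scalar kernel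
    \<open>cinner (K x s e) e'\<close> at \<open>cnj (a x) * b s\<close> (\<open>kernel_op_coefficient\<close>).
    Parseval's identity on \<open>M \<times> M\<close> then turns the sum of the squared coefficients into
    \<open>\<integral>\<integral> \<parallel>K x s\<parallel>\<^sup>2\<close> in the Hilbert-Schmidt norm (\<open>hs_norm_sq_kernel_op\<close>), and the
    double series for the trace of a product into an integral over \<open>M \<times> M\<close> of a trace on
    \<open>'h\<close> (\<open>op_trace_kernel_ops\<close>).

  \<^item> Uniqueness. If \<open>T\<close> is Hilbert-Schmidt, its coefficients are square summable, so by the
    Riesz-Fischer theorem they belong to some square-integrable kernel. An integral operator determines
    its kernel almost everywhere (\<open>AE_zero_kernel_if_integrals_zero\<close>), so this is the given
    kernel, which is therefore square integrable. This gives the necessity of the condition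
    (\<open>kernel_L2_if_coefficients_square_summable\<close>); as \<open>L\<^sup>2(M)\<close> may be inseparable, the
    uniqueness is proved with rectangles and not with a countable family of test functions.

  \<^item> Powers. All integrands are dominated by products along paths of the scalar kernel
    \<open>cmod (g x s) * \<parallel>S x\<parallel>\<close>, with the Hilbert-Schmidt norm of \<open>S x\<close>, which is square integrable
    exactly under the stated condition. By the Cauchy-Schwarz inequality these products can be integrated
    along paths and around cycles (\<open>nn_integral_path_bound_sq_le\<close>,
    \<open>cycle_bound_finite\<close>). Fubini's theorem therefore shows that \<open>T ^^ n\<close> is an integral
    operator whose kernel is the integral over paths with fixed end points (\<open>kernel_op_funpow\<close>).
    The norm formula for \<open>T ^^ n\<close> is the first fact for this kernel, and the trace formula is
    the first fact for the product of \<open>T\<close> and \<open>T ^^ (n - 1)\<close>.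

  The Hilbert-Schmidt norm and the trace of a product of two Hilbert-Schmidt operators do not depend on
  the orthonormal basis. This, Parseval's identity and the Riesz-Fischer theorem are proved once, for
  complete spaces with a positive semidefinite form, and used for \<open>'h\<close>, for
  \<open>L\<^sup>2(M; 'h)\<close> and for \<open>L\<^sup>2(M \<times> M)\<close>.
\<close>

section \<open>Infinite sums as integrals over counting measures\<close>

lemma mult_cnj_eq_cmod: "z * cnj z = (complex_of_real (cmod z))\<^sup>2"
  using complex_norm_square[of z] by simp

text \<open>
  The theorem of Tonelli for sigma-finite measures covers only countable index sets, but the
  orthonormal bases of \<open>L\<^sup>2(M)\<close> can be uncountable.
\<close>

lemma nn_integral_count_space_swap:
  fixes f :: "'a \<Rightarrow> 'b \<Rightarrow> ennreal"
  shows "(\<integral>\<^sup>+x. \<integral>\<^sup>+y. f x y \<partial>count_space B \<partial>count_space A) =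
         (\<integral>\<^sup>+y. \<integral>\<^sup>+x. f x y \<partial>count_space A \<partial>count_space B)"
    and nn_integral_count_space_Times:
      "(\<integral>\<^sup>+x. \<integral>\<^sup>+y. f x y \<partial>count_space B \<partial>count_space A) =
       (\<integral>\<^sup>+z. f (fst z) (snd z) \<partial>count_space (A \<times> B))"
proof -
  let ?F = "\<lambda>z. f (fst z) (snd z) * indicator A (fst z) * indicator B (snd z)"
  have ind: "indicator (A \<times> B) z = indicator A (fst z) * (indicator B (snd z) :: ennreal)" for z
    by (cases z) (auto simp: indicator_def)
  have 1: "(\<integral>\<^sup>+x. \<integral>\<^sup>+y. f x y \<partial>count_space B \<partial>count_space A) = (\<integral>\<^sup>+z. ?F z \<partial>count_space UNIV)"
    by (subst nn_integral_fst_count_space[symmetric])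
      (auto simp: nn_integral_count_space_indicator nn_integral_cmult[symmetric] mult_ac
        intro!: nn_integral_cong)
  have 2: "(\<integral>\<^sup>+y. \<integral>\<^sup>+x. f x y \<partial>count_space A \<partial>count_space B) = (\<integral>\<^sup>+z. ?F z \<partial>count_space UNIV)"
    by (subst nn_integral_snd_count_space[symmetric])
      (auto simp: nn_integral_count_space_indicator nn_integral_cmult[symmetric] mult_ac
        intro!: nn_integral_cong)
  show "(\<integral>\<^sup>+x. \<integral>\<^sup>+y. f x y \<partial>count_space B \<partial>count_space A) =
         (\<integral>\<^sup>+y. \<integral>\<^sup>+x. f x y \<partial>count_space A \<partial>count_space B)"
    using 1 2 by simp
  show "(\<integral>\<^sup>+x. \<integral>\<^sup>+y. f x y \<partial>count_space B \<partial>count_space A) =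
       (\<integral>\<^sup>+z. f (fst z) (snd z) \<partial>count_space (A \<times> B))"
    unfolding 1 by (simp add: nn_integral_count_space_indicator ind mult_ac)
qed

lemma abs_summable_iff_nn_integral:
  fixes f :: "'a \<Rightarrow> 'b::{banach, second_countable_topology}"
  shows "Infinite_Sum.abs_summable_on f A \<longleftrightarrow> (\<integral>\<^sup>+x. ennreal (norm (f x)) \<partial>count_space A) < \<infinity>"
  unfolding abs_summable_equivalent abs_summable_on_def integrable_iff_bounded by simp

text \<open>
  If the sum is finite, then all terms are finite and the real series is summable, hence integrable
  for the counting measure; otherwise only the comparison with finite partial sums is needed.
\<close>

lemma infsum_ennreal_eq_nn_integral:
  fixes f :: "'a \<Rightarrow> ennreal"
  shows "(\<Sum>\<^sub>\<infinity>x\<in>A. f x) = (\<integral>\<^sup>+x. f x \<partial>count_space A)"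
proof (rule antisym)
  have sup: "(\<Sum>\<^sub>\<infinity>x\<in>A. f x) = (SUP F\<in>{F. finite F \<and> F\<subseteq>A}. sum f F)"
    by (rule nonneg_infsum_complete) simp
  show "(\<Sum>\<^sub>\<infinity>x\<in>A. f x) \<le> (\<integral>\<^sup>+x. f x \<partial>count_space A)"
    unfolding sup
  proof (rule SUP_least)
    fix F assume "F \<in> {F. finite F \<and> F \<subseteq> A}"
    then have F: "finite F" "F \<subseteq> A" by auto
    have "sum f F = (\<integral>\<^sup>+x. f x * indicator F x \<partial>count_space A)"
      using F by (subst nn_integral_count_space'[of F]) auto
    also have "\<dots> \<le> (\<integral>\<^sup>+x. f x \<partial>count_space A)"
      by (intro nn_integral_mono) (auto simp: indicator_def)
    finally show "sum f F \<le> (\<integral>\<^sup>+x. f x \<partial>count_space A)" .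
  qed
  show "(\<integral>\<^sup>+x. f x \<partial>count_space A) \<le> (\<Sum>\<^sub>\<infinity>x\<in>A. f x)"
  proof (cases "(\<Sum>\<^sub>\<infinity>x\<in>A. f x) = \<infinity>")
    case False
    define s where "s = enn2real (\<Sum>\<^sub>\<infinity>x\<in>A. f x)"
    have s: "ennreal s = (\<Sum>\<^sub>\<infinity>x\<in>A. f x)" "0 \<le> s"
      unfolding s_def using False by (auto simp: top.not_eq_extremum)
    define r where "r x = enn2real (f x)" for x
    have fin: "sum f F \<le> ennreal s" if "finite F" "F \<subseteq> A" for F
      unfolding s sup using that by (intro SUP_upper) auto
    have r: "ennreal (r x) = f x" if "x \<in> A" for x
      using fin[of "{x}"] that unfolding r_def
      by (intro ennreal_enn2real) (auto intro: le_less_trans)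
    have r0: "0 \<le> r x" for x by (simp add: r_def)
    have finr: "sum r F \<le> s" if F: "finite F" "F \<subseteq> A" for F
    proof -
      have "ennreal (sum r F) = (\<Sum>x\<in>F. ennreal (r x))" by (simp add: r0 sum_ennreal)
      also have "\<dots> = sum f F" using F r by (intro sum.cong) auto
      also have "\<dots> \<le> ennreal s" using fin[OF F] .
      finally show ?thesis using s(2) by simp
    qed
    have "r summable_on A"
      by (rule nonneg_bdd_above_summable_on) (auto intro!: bdd_aboveI[of _ s] finr r0)
    then have abs': "Infinite_Set_Sum.abs_summable_on r A"
      using abs_summable_equivalent summable_on_iff_abs_summable_on_real by blast
    have le: "infsum r A \<le> s"
      using \<open>r summable_on A\<close> by (intro infsum_le_finite_sums finr) auto
    have "(\<integral>\<^sup>+x. f x \<partial>count_space A) = (\<integral>\<^sup>+x. ennreal (r x) \<partial>count_space A)"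
      by (intro nn_integral_cong) (simp add: r)
    also have "\<dots> = ennreal (infsetsum r A)"
      unfolding infsetsum_def using abs' r0 unfolding abs_summable_on_def
      by (intro nn_integral_eq_integral) auto
    also have "\<dots> \<le> ennreal s"
      using infsetsum_infsum[OF abs'] le by (simp add: ennreal_leI)
    finally show ?thesis using s by simp
  qed simp
qed

text \<open>
  For complex series unconditional and absolute convergence agree, and both sides are \<open>0\<close> by
  convention if the series diverges. Hence sums over a countable basis inherit measurability and the
  theorem of Fubini from integrals.
\<close>

lemma infsum_complex_eq_integral:
  fixes f :: "'a \<Rightarrow> complex"
  shows "(\<Sum>\<^sub>\<infinity>x\<in>A. f x) = (LINT x|count_space A. f x)"
proof (cases "f summable_on A")
  case True
  then have "Infinite_Set_Sum.abs_summable_on f A"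
    using abs_summable_equivalent summable_on_iff_abs_summable_on_complex by blast
  then show ?thesis using infsetsum_infsum unfolding infsetsum_def by metis
next
  case False
  then have "\<not> Infinite_Set_Sum.abs_summable_on f A"
    using abs_summable_equivalent summable_on_iff_abs_summable_on_complex by blast
  then show ?thesis using False
    by (simp add: abs_summable_on_def not_integrable_integral_eq infsum_not_exists)
qed

lemma has_sum_complex_iff_integral:
  fixes f :: "'a \<Rightarrow> complex"
  shows "(f has_sum s) A \<longleftrightarrow> integrable (count_space A) f \<and> (LINT x|count_space A. f x) = s"
  by (metis abs_summable_equivalent abs_summable_on_def has_sum_infsum infsumI
      infsum_complex_eq_integral summable_on_def summable_on_iff_abs_summable_on_complex)

lemma summable_on_complex_iff_nn_integral:
  fixes f :: "'a \<Rightarrow> complex"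
  shows "f summable_on A \<longleftrightarrow> (\<integral>\<^sup>+x. ennreal (cmod (f x)) \<partial>count_space A) < \<infinity>"
  using abs_summable_iff_nn_integral summable_on_iff_abs_summable_on_complex by blast

lemma summable_on_complex_mult:
  fixes f g :: "'a \<Rightarrow> complex"
  assumes "(\<integral>\<^sup>+x. ennreal ((cmod (f x))\<^sup>2) \<partial>count_space A) < \<infinity>"
    and "(\<integral>\<^sup>+x. ennreal ((cmod (g x))\<^sup>2) \<partial>count_space A) < \<infinity>"
  shows "(\<lambda>x. f x * g x) summable_on A"
proof -
  have "(\<integral>\<^sup>+x. ennreal (cmod (f x * g x)) \<partial>count_space A)
      \<le> (\<integral>\<^sup>+x. ennreal ((cmod (f x))\<^sup>2) + ennreal ((cmod (g x))\<^sup>2) \<partial>count_space A)"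
  proof (intro nn_integral_mono)
    fix x
    have "2 * (cmod (f x) * cmod (g x)) \<le> (cmod (f x))\<^sup>2 + (cmod (g x))\<^sup>2"
      using sum_squares_bound[of "cmod (f x)" "cmod (g x)"] by simp
    moreover have "0 \<le> cmod (f x) * cmod (g x)" by (rule mult_nonneg_nonneg) auto
    ultimately have "cmod (f x * g x) \<le> (cmod (f x))\<^sup>2 + (cmod (g x))\<^sup>2"
      unfolding norm_mult by linarith
    then show "ennreal (cmod (f x * g x)) \<le> ennreal ((cmod (f x))\<^sup>2) + ennreal ((cmod (g x))\<^sup>2)"
      by (simp flip: ennreal_plus)
  qed
  also have "\<dots> < \<infinity>" using assms by (subst nn_integral_add) auto
  finally show ?thesis unfolding summable_on_complex_iff_nn_integral .
qed

section \<open>Spaces with a complete semidefinite form\<close>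

text \<open>
  Functions that agree almost everywhere represent the same element of \<open>L\<^sup>2(M; 'h)\<close>, so
  the form is only semidefinite, and the algebraic laws are stated through it: two vectors with the same
  products with all other vectors count as equal. Completeness is stated for sequences whose increments
  decrease geometrically, since square-integrable functions that form such a sequence converge almost
  everywhere.
\<close>

locale semi_hilbert =
  fixes V :: "'v set" and add :: "'v \<Rightarrow> 'v \<Rightarrow> 'v" and scale :: "complex \<Rightarrow> 'v \<Rightarrow> 'v"
    and ip :: "'v \<Rightarrow> 'v \<Rightarrow> complex"
  assumes nonempty: "V \<noteq> {}"
    and add_closed [simp]: "u \<in> V \<Longrightarrow> v \<in> V \<Longrightarrow> add u v \<in> V"
    and scale_closed [simp]: "u \<in> V \<Longrightarrow> scale c u \<in> V"
    and ip_add: "u \<in> V \<Longrightarrow> v \<in> V \<Longrightarrow> w \<in> V \<Longrightarrow> ip (add u v) w = ip u w + ip v w"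
    and ip_scale: "u \<in> V \<Longrightarrow> w \<in> V \<Longrightarrow> ip (scale c u) w = c * ip u w"
    and ip_commute: "u \<in> V \<Longrightarrow> v \<in> V \<Longrightarrow> ip u v = cnj (ip v u)"
    and ip_nonneg: "u \<in> V \<Longrightarrow> 0 \<le> Re (ip u u)"
    and fast_complete: "(\<And>n. seq n \<in> V) \<Longrightarrow>
       (\<And>n::nat. Re (ip (add (seq (Suc n)) (scale (-1) (seq n))) (add (seq (Suc n)) (scale (-1) (seq n)))) \<le> (1/4)^n) \<Longrightarrow>
       \<exists>l\<in>V. (\<lambda>n. Re (ip (add (seq n) (scale (-1) l)) (add (seq n) (scale (-1) l)))) \<longlonglongrightarrow> 0"
begin

definition sq :: "'v \<Rightarrow> real" where "sq v = Re (ip v v)"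
definition nrm :: "'v \<Rightarrow> real" where "nrm v = sqrt (sq v)"
definition diff :: "'v \<Rightarrow> 'v \<Rightarrow> 'v" where "diff u v = add u (scale (-1) v)"

lemma diff_closed [simp]: "u \<in> V \<Longrightarrow> v \<in> V \<Longrightarrow> diff u v \<in> V" by (simp add: diff_def)
lemma ip_diff: "u \<in> V \<Longrightarrow> v \<in> V \<Longrightarrow> w \<in> V \<Longrightarrow> ip (diff u v) w = ip u w - ip v w"
  by (simp add: diff_def ip_add ip_scale)
lemma ip_add_right: "u \<in> V \<Longrightarrow> v \<in> V \<Longrightarrow> w \<in> V \<Longrightarrow> ip w (add u v) = ip w u + ip w v"
  using ip_commute[of w "add u v"] ip_commute[of w u] ip_commute[of w v] by (simp add: ip_add)
lemma ip_diff_right: "u \<in> V \<Longrightarrow> v \<in> V \<Longrightarrow> w \<in> V \<Longrightarrow> ip w (diff u v) = ip w u - ip w v"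
  using ip_commute[of w "diff u v"] ip_commute[of w u] ip_commute[of w v] by (simp add: ip_diff)
lemma ip_scale_right: "u \<in> V \<Longrightarrow> w \<in> V \<Longrightarrow> ip w (scale c u) = cnj c * ip w u"
  using ip_commute[of w "scale c u"] ip_commute[of w u] by (simp add: ip_scale)
lemma sq_nonneg [simp]: "v \<in> V \<Longrightarrow> 0 \<le> sq v" using ip_nonneg by (simp add: sq_def)
lemma nrm_nonneg [simp]: "v \<in> V \<Longrightarrow> 0 \<le> nrm v" by (simp add: nrm_def)
lemma nrm_sq: "v \<in> V \<Longrightarrow> (nrm v)\<^sup>2 = sq v" by (simp add: nrm_def)
lemma ip_self: "v \<in> V \<Longrightarrow> ip v v = complex_of_real (sq v)"
  using ip_commute[of v v] by (simp add: complex_eq_iff sq_def)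

lemma sq_combination:
  assumes "u \<in> V" "v \<in> V"
  shows "sq (add (scale (complex_of_real (sq v)) u) (scale (- ip u v) v)) =
         sq v * (sq u * sq v - (cmod (ip u v))\<^sup>2)"
proof -
  have "ip (add (scale (complex_of_real (sq v)) u) (scale (- ip u v) v))
           (add (scale (complex_of_real (sq v)) u) (scale (- ip u v) v)) =
        complex_of_real (sq v) * (complex_of_real (sq u) * complex_of_real (sq v) - ip u v * cnj (ip u v))"
    using assms ip_commute[of v u]
    by (simp add: ip_add ip_add_right ip_scale ip_scale_right ip_self[OF assms(1)] ip_self[OF assms(2)] algebra_simps)
  also have "\<dots> = complex_of_real (sq v * (sq u * sq v - (cmod (ip u v))\<^sup>2))"
    by (simp only: complex_norm_square of_real_mult of_real_diff)
  finally show ?thesis unfolding sq_def by simp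
qed

lemma cauchy_schwarz_sq:
  assumes u: "u \<in> V" and v: "v \<in> V"
  shows "(cmod (ip u v))\<^sup>2 \<le> sq u * sq v"
proof -
  have pos: "(cmod (ip u v))\<^sup>2 \<le> sq u * sq v" if "u \<in> V" "v \<in> V" "sq v > 0" for u v
  proof -
    have "0 \<le> sq v * (sq u * sq v - (cmod (ip u v))\<^sup>2)"
      unfolding sq_combination[OF that(1,2), symmetric] using that by simp
    then show ?thesis using that(3) by (simp add: zero_le_mult_iff)
  qed
  have sym: "cmod (ip u v) = cmod (ip v u)" using ip_commute[OF u v] by simp
  consider "sq v > 0" | "sq u > 0" | "sq u = 0" "sq v = 0"
    using sq_nonneg[OF u] sq_nonneg[OF v] by linarith
  then show ?thesis
  proof cases
    case 3
    \<comment> \<open>both norms vanish, so the squared norm of \<open>w\<close> is \<open>- 2 * (cmod (ip u v))\<^sup>2\<close>\<close>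
    define w where "w = add u (scale (- ip u v) v)"
    have "ip w w = complex_of_real (- 2 * (cmod (ip u v))\<^sup>2)"
      unfolding w_def using u v 3 ip_commute[of v u] complex_norm_square[of "ip u v"]
      by (simp add: ip_add ip_add_right ip_scale ip_scale_right ip_self[OF u] ip_self[OF v] algebra_simps)
    then have "sq w = - 2 * (cmod (ip u v))\<^sup>2" by (simp add: sq_def)
    moreover have "0 \<le> sq w" unfolding w_def using u v by simp
    ultimately show ?thesis using 3 by simp
  next
    case 1
    then show ?thesis using pos[OF u v] by simp
  next
    case 2
    then show ?thesis using pos[OF v u] sym by (simp add: mult.commute)
  qed
qed

lemma cauchy_schwarz: "u \<in> V \<Longrightarrow> v \<in> V \<Longrightarrow> cmod (ip u v) \<le> nrm u * nrm v"
  by (rule power2_le_imp_le) (auto simp: power_mult_distrib nrm_sq cauchy_schwarz_sq)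

lemma ip_zero_if_sq_zero: "u \<in> V \<Longrightarrow> v \<in> V \<Longrightarrow> sq u = 0 \<Longrightarrow> ip u v = 0"
  using cauchy_schwarz_sq[of u v] by simp

text \<open>
  The vector \<open>r\<close> is the sum of \<open>p\<close> and \<open>q\<close> only in the weak sense of the form.
\<close>

lemma triangle_weak:
  assumes V: "p \<in> V" "q \<in> V" "r \<in> V" and sum: "\<And>z. z \<in> V \<Longrightarrow> ip r z = ip p z + ip q z"
  shows "nrm r \<le> nrm p + nrm q"
proof (cases "nrm r = 0")
  case False
  have "(nrm r)\<^sup>2 = Re (ip p r) + Re (ip q r)"
    using sum[OF V(3)] nrm_sq[OF V(3)] unfolding sq_def by simp
  also have "\<dots> \<le> nrm p * nrm r + nrm q * nrm r"
    using complex_Re_le_cmod[of "ip p r"] complex_Re_le_cmod[of "ip q r"]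
      cauchy_schwarz[of p r] cauchy_schwarz[of q r] V by linarith
  finally have "nrm r * nrm r \<le> (nrm p + nrm q) * nrm r"
    by (simp add: algebra_simps power2_eq_square)
  moreover have "nrm r > 0" using False nrm_nonneg[OF V(3)] by linarith
  ultimately show ?thesis by simp
qed (use V in simp)

lemma triangle_diff:
  "u \<in> V \<Longrightarrow> v \<in> V \<Longrightarrow> w \<in> V \<Longrightarrow> nrm (diff u w) \<le> nrm (diff u v) + nrm (diff v w)"
  by (rule triangle_weak) (auto simp: ip_diff)

definition functional :: "('v \<Rightarrow> complex) \<Rightarrow> bool" where
  "functional l \<longleftrightarrow> (\<forall>u\<in>V. \<forall>v\<in>V. l (add u v) = l u + l v) \<and>
     (\<forall>c. \<forall>u\<in>V. l (scale c u) = c * l u) \<and> (\<exists>C. \<forall>u\<in>V. cmod (l u) \<le> C * nrm u)"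

lemma functional_ip: "w \<in> V \<Longrightarrow> functional (\<lambda>v. ip v w)"
  unfolding functional_def
  by (auto simp: ip_add ip_scale mult.commute intro!: exI[of _ "nrm w"] dest: cauchy_schwarz[of _ w])

lemma functional_diff:
  "functional l \<Longrightarrow> u \<in> V \<Longrightarrow> v \<in> V \<Longrightarrow> l (diff u v) = l u - l v"
  unfolding functional_def diff_def by simp

text \<open>
  The difference of the two vectors has norm \<open>0\<close>, and a bounded functional vanishes on it.
\<close>

lemma functional_cong:
  assumes l: "functional l" and V: "u \<in> V" "v \<in> V" and eq: "\<And>z. z \<in> V \<Longrightarrow> ip u z = ip v z"
  shows "l u = l v"
proof -
  obtain C where C: "\<And>u. u \<in> V \<Longrightarrow> cmod (l u) \<le> C * nrm u" using l unfolding functional_def by blast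
  have "nrm (diff u v) = 0" using V eq by (simp add: nrm_def sq_def ip_diff)
  then have "l (diff u v) = 0" using C[of "diff u v"] V by simp
  then show ?thesis using functional_diff[OF l V] by simp
qed

lemma finite_combination:
  assumes "finite F" "F \<subseteq> V"
  shows "\<exists>s\<in>V. \<forall>l. functional l \<longrightarrow> l s = (\<Sum>b\<in>F. c b * l b)"
  using assms
proof (induction F rule: finite_induct)
  case empty
  obtain u where u: "u \<in> V" using nonempty by auto
  have "l (scale 0 u) = 0" if "functional l" for l
    using that u unfolding functional_def by simp
  then show ?case using u by (intro bexI[of _ "scale 0 u"]) auto
next
  case (insert x F)
  then obtain s where s: "s \<in> V" "\<And>l. functional l \<Longrightarrow> l s = (\<Sum>b\<in>F. c b * l b)" by auto
  show ?case
  proof (intro bexI[of _ "add (scale (c x) x) s"] allI impI)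
    fix l assume l: "functional l"
    then show "l (add (scale (c x) x) s) = (\<Sum>b\<in>insert x F. c b * l b)"
      using insert s(1) unfolding functional_def by (simp add: s(2)[OF l])
  qed (use insert s in simp)
qed

text \<open>
  A representative of the finite linear combination with coefficients \<open>c\<close>. It is chosen through
  its values under functionals, because \<open>add\<close> is not assumed to be associative.
\<close>

definition comb :: "('v \<Rightarrow> complex) \<Rightarrow> 'v set \<Rightarrow> 'v" where
  "comb c F = (SOME s. s \<in> V \<and> (\<forall>l. functional l \<longrightarrow> l s = (\<Sum>b\<in>F. c b * l b)))"

lemma comb:
  assumes "finite F" "F \<subseteq> V"
  shows comb_closed: "comb c F \<in> V"
    and functional_comb: "functional l \<Longrightarrow> l (comb c F) = (\<Sum>b\<in>F. c b * l b)"
  using someI_ex[of "\<lambda>s. s \<in> V \<and> (\<forall>l. functional l \<longrightarrow> l s = (\<Sum>b\<in>F. c b * l b))"]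
    finite_combination[OF assms, of c] unfolding comb_def[symmetric] by blast+

lemma ip_comb: "finite F \<Longrightarrow> F \<subseteq> V \<Longrightarrow> w \<in> V \<Longrightarrow> ip (comb c F) w = (\<Sum>b\<in>F. c b * ip b w)"
  using functional_comb[OF _ _ functional_ip] by simp

definition orthonormal :: "'v set \<Rightarrow> bool" where
  "orthonormal B \<longleftrightarrow> B \<subseteq> V \<and> (\<forall>b\<in>B. \<forall>b'\<in>B. ip b b' = (if b = b' then 1 else 0))"

lemma is_onb_iff:
  "is_onb V ip B \<longleftrightarrow> orthonormal B \<and> (\<forall>v\<in>V. (\<forall>b\<in>B. ip v b = 0) \<longrightarrow> sq v = 0)"
proof -
  have "ip v v = 0 \<longleftrightarrow> sq v = 0" if "v \<in> V" for v using ip_self[OF that] by simp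
  then show ?thesis unfolding is_onb_def orthonormal_def by auto
qed

lemma sq_orthonormal_combination:
  assumes B: "orthonormal B" and F: "finite F" "F \<subseteq> B" and r: "r \<in> V"
    and eq: "\<And>z. z \<in> V \<Longrightarrow> ip r z = (\<Sum>b\<in>F. d b * ip b z)"
  shows "sq r = (\<Sum>b\<in>F. (cmod (d b))\<^sup>2)"
proof -
  have FV: "F \<subseteq> V" using B F unfolding orthonormal_def by auto
  have rb: "ip r b = d b" if "b \<in> F" for b
  proof -
    have "ip r b = (\<Sum>b'\<in>F. if b' = b then d b' else 0)"
      unfolding eq[OF subsetD[OF FV that]]
      using B F that unfolding orthonormal_def by (intro sum.cong refl) (auto simp: subset_iff)
    then show ?thesis using F that by simp
  qed
  have "ip r r = (\<Sum>b\<in>F. d b * cnj (d b))"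
    unfolding eq[OF r] using rb ip_commute r FV by (intro sum.cong refl) (metis subsetD)
  also have "\<dots> = complex_of_real (\<Sum>b\<in>F. (cmod (d b))\<^sup>2)"
    by (simp add: mult_cnj_eq_cmod)
  finally show ?thesis by (simp add: sq_def)
qed

lemma sq_comb:
  assumes "orthonormal B" "finite F" "F \<subseteq> B"
  shows "sq (comb c F) = (\<Sum>b\<in>F. (cmod (c b))\<^sup>2)"
  using assms by (intro sq_orthonormal_combination[OF assms])
    (auto simp: ip_comb comb_closed orthonormal_def)

text \<open>
  The distance from \<open>v\<close> to its projection is nonnegative.
\<close>

lemma bessel:
  assumes B: "orthonormal B" and F: "finite F" "F \<subseteq> B" and v: "v \<in> V"
  shows "(\<Sum>b\<in>F. (cmod (ip v b))\<^sup>2) \<le> sq v"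
proof -
  define s where "s = comb (\<lambda>b. ip v b) F"
  have FV: "F \<subseteq> V" using B F unfolding orthonormal_def by auto
  have s: "s \<in> V" unfolding s_def using F FV by (simp add: comb_closed)
  have sv: "ip s v = complex_of_real (\<Sum>b\<in>F. (cmod (ip v b))\<^sup>2)"
  proof -
    have "ip s v = (\<Sum>b\<in>F. ip v b * cnj (ip v b))"
      unfolding s_def ip_comb[OF F(1) FV v]
    proof (intro sum.cong refl)
      fix b assume "b \<in> F"
      then show "ip v b * ip b v = ip v b * cnj (ip v b)" using ip_commute[of b v] FV v by auto
    qed
    then show ?thesis by (simp add: mult_cnj_eq_cmod)
  qed
  have "0 \<le> sq (diff v s)" using v s by simp
  also have "sq (diff v s) = sq v - 2 * Re (ip s v) + sq s"
    using v s ip_commute[of v s] by (simp add: sq_def ip_diff ip_diff_right)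
  also have "\<dots> = sq v - (\<Sum>b\<in>F. (cmod (ip v b))\<^sup>2)"
    using sv sq_comb[OF B F, of "\<lambda>b. ip v b"] by (simp add: s_def)
  finally show ?thesis by simp
qed

text \<open>
  The coefficients of the difference vanish on \<open>F \<inter> G\<close>; those on \<open>G - F\<close> are controlled by
  \<open>e\<close>, those on \<open>F - G\<close> by \<open>e'\<close>.
\<close>

lemma sq_diff_comb_le:
  assumes B: "orthonormal B" and F: "finite F" "F \<subseteq> B" and G: "finite G" "G \<subseteq> B"
    and tF: "\<And>H. finite H \<Longrightarrow> H \<subseteq> B \<Longrightarrow> F \<inter> H = {} \<Longrightarrow> (\<Sum>b\<in>H. (cmod (c b))\<^sup>2) \<le> e"
    and tG: "\<And>H. finite H \<Longrightarrow> H \<subseteq> B \<Longrightarrow> G \<inter> H = {} \<Longrightarrow> (\<Sum>b\<in>H. (cmod (c b))\<^sup>2) \<le> e'"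
  shows "sq (diff (comb c F) (comb c G)) \<le> e + e'"
proof -
  have V: "F \<subseteq> V" "G \<subseteq> V" using B F G unfolding orthonormal_def by auto
  define d where "d b = (if b \<in> F then c b else 0) - (if b \<in> G then c b else 0)" for b
  have "sq (diff (comb c F) (comb c G)) = (\<Sum>b\<in>F \<union> G. (cmod (d b))\<^sup>2)"
  proof (rule sq_orthonormal_combination[OF B])
    fix z assume z: "z \<in> V"
    have 1: "(\<Sum>b\<in>F. c b * ip b z) = (\<Sum>b\<in>F \<union> G. (if b \<in> F then c b else 0) * ip b z)"
      using F G by (intro sum.mono_neutral_cong_left) auto
    have 2: "(\<Sum>b\<in>G. c b * ip b z) = (\<Sum>b\<in>F \<union> G. (if b \<in> G then c b else 0) * ip b z)"
      using F G by (intro sum.mono_neutral_cong_left) auto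
    show "ip (diff (comb c F) (comb c G)) z = (\<Sum>b\<in>F \<union> G. d b * ip b z)"
      using z F G V by (simp add: ip_diff comb_closed ip_comb 1 2 d_def left_diff_distrib sum_subtractf)
  qed (use F G V in \<open>auto simp: comb_closed\<close>)
  also have "\<dots> = (\<Sum>b\<in>(G - F) \<union> (F - G). (cmod (d b))\<^sup>2)"
    using F G by (intro sum.mono_neutral_right) (auto simp: d_def)
  also have "\<dots> = (\<Sum>b\<in>G - F. (cmod (d b))\<^sup>2) + (\<Sum>b\<in>F - G. (cmod (d b))\<^sup>2)"
    using F G by (intro sum.union_disjoint) auto
  also have "\<dots> = (\<Sum>b\<in>G - F. (cmod (c b))\<^sup>2) + (\<Sum>b\<in>F - G. (cmod (c b))\<^sup>2)"
    by (intro arg_cong2[where f="(+)"] sum.cong) (auto simp: d_def)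
  also have "\<dots> \<le> e + e'"
    using F G by (intro add_mono tF tG) auto
  finally show ?thesis .
qed

text \<open>
  The partial combinations converge in norm along the net of finite subsets of \<open>B\<close>.
\<close>

definition comb_limit :: "('v \<Rightarrow> complex) \<Rightarrow> 'v set \<Rightarrow> 'v \<Rightarrow> bool" where
  "comb_limit c B w \<longleftrightarrow> (\<forall>e>0. \<exists>F. finite F \<and> F \<subseteq> B \<and>
     (\<forall>G. finite G \<longrightarrow> F \<subseteq> G \<longrightarrow> G \<subseteq> B \<longrightarrow> nrm (diff (comb c G) w) < e))"

text \<open>
  Choose finite sets outside of which the tails of the series are at most \<open>(1/4)^n / 2\<close>. The
  combinations over these sets form a sequence with geometrically decreasing increments, and every larger
  finite set gives a combination close to one of them.
\<close>

lemma riesz_fischer: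
  assumes B: "orthonormal B" and c: "(\<lambda>b. (cmod (c b))\<^sup>2) summable_on B"
  obtains w where "w \<in> V" "comb_limit c B w"
proof -
  have BV: "B \<subseteq> V" using B unfolding orthonormal_def by auto
  have tail: "\<exists>F. finite F \<and> F \<subseteq> B \<and> (\<forall>H. finite H \<longrightarrow> H \<subseteq> B \<longrightarrow> F \<inter> H = {} \<longrightarrow> (\<Sum>b\<in>H. (cmod (c b))\<^sup>2) \<le> e)"
    if "e > 0" for e
  proof -
    obtain F where F: "finite F" "F \<subseteq> B"
      and Fe: "dist (\<Sum>b\<in>F. (cmod (c b))\<^sup>2) (\<Sum>\<^sub>\<infinity>b\<in>B. (cmod (c b))\<^sup>2) \<le> e"
      using infsum_finite_approximation[OF c \<open>e > 0\<close>] by auto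
    have "(\<Sum>b\<in>H. (cmod (c b))\<^sup>2) \<le> e" if H: "finite H" "H \<subseteq> B" "F \<inter> H = {}" for H
    proof -
      have "(\<Sum>b\<in>F. (cmod (c b))\<^sup>2) + (\<Sum>b\<in>H. (cmod (c b))\<^sup>2) = (\<Sum>b\<in>F \<union> H. (cmod (c b))\<^sup>2)"
        using F H by (subst sum.union_disjoint) auto
      also have "\<dots> \<le> (\<Sum>\<^sub>\<infinity>b\<in>B. (cmod (c b))\<^sup>2)"
        using F H by (intro finite_sum_le_infsum c) auto
      finally show ?thesis using Fe unfolding dist_real_def by linarith
    qed
    then show ?thesis using F by blast
  qed
  define eps :: "nat \<Rightarrow> real" where "eps n = (1/4)^n / 2" for n
  have eps: "eps n > 0" for n by (simp add: eps_def)
  obtain F where F: "\<And>n. finite (F n)" "\<And>n. F n \<subseteq> B"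
    and Ft: "\<And>n H. finite H \<Longrightarrow> H \<subseteq> B \<Longrightarrow> F n \<inter> H = {} \<Longrightarrow> (\<Sum>b\<in>H. (cmod (c b))\<^sup>2) \<le> eps n"
    using tail[OF eps] by metis
  have FV: "F n \<subseteq> V" for n using F BV by blast
  have close: "sq (diff (comb c G) (comb c (F n))) \<le> (1/4)^n" if "finite G" "F n \<subseteq> G" "G \<subseteq> B" for G n
  proof -
    have "sq (diff (comb c G) (comb c (F n))) \<le> eps n + eps n"
      using that F by (intro sq_diff_comb_le[OF B] Ft[of _ n]) auto
    then show ?thesis by (simp add: eps_def)
  qed
  have "sq (diff (comb c (F (Suc n))) (comb c (F n))) \<le> (1/4)^n" for n
  proof -
    have "sq (diff (comb c (F (Suc n))) (comb c (F n))) \<le> eps (Suc n) + eps n"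
      using F by (intro sq_diff_comb_le[OF B] Ft) auto
    moreover have "(0::real) \<le> (1/4)^n" by simp
    ultimately show ?thesis unfolding eps_def power_Suc by linarith
  qed
  then have "\<exists>w\<in>V. (\<lambda>n. sq (diff (comb c (F n)) w)) \<longlonglongrightarrow> 0"
    using fast_complete[where seq="\<lambda>n. comb c (F n)", OF comb_closed[OF F(1) FV]]
    unfolding sq_def diff_def by simp
  then obtain w where w: "w \<in> V" and lim: "(\<lambda>n. sq (diff (comb c (F n)) w)) \<longlonglongrightarrow> 0"
    by blast
  have lim': "(\<lambda>n. nrm (diff (comb c (F n)) w)) \<longlonglongrightarrow> 0"
    using tendsto_real_sqrt[OF lim] unfolding nrm_def by simp
  have "comb_limit c B w"
    unfolding comb_limit_def
  proof (intro allI impI)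
    fix e :: real assume e: "e > 0"
    have "(\<lambda>n. sqrt ((1/4)^n)) \<longlonglongrightarrow> sqrt 0"
      by (intro tendsto_real_sqrt LIMSEQ_realpow_zero) auto
    then have "(\<lambda>n. sqrt ((1/4)^n) + nrm (diff (comb c (F n)) w)) \<longlonglongrightarrow> 0 + 0"
      using lim' by (intro tendsto_add) auto
    then have "eventually (\<lambda>n. sqrt ((1/4)^n) + nrm (diff (comb c (F n)) w) < e) sequentially"
      using e by (auto dest: order_tendstoD(2))
    then obtain n where n: "sqrt ((1/4)^n) + nrm (diff (comb c (F n)) w) < e"
      by (auto simp: eventually_sequentially)
    have "nrm (diff (comb c G) w) < e" if G: "finite G" "F n \<subseteq> G" "G \<subseteq> B" for G
    proof -
      have "comb c G \<in> V" using G BV by (simp add: comb_closed)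
      moreover have "comb c (F n) \<in> V" using F FV by (simp add: comb_closed)
      ultimately have "nrm (diff (comb c G) w) \<le> nrm (diff (comb c G) (comb c (F n))) + nrm (diff (comb c (F n)) w)"
        using w by (intro triangle_diff)
      moreover have "nrm (diff (comb c G) (comb c (F n))) \<le> sqrt ((1/4)^n)"
        unfolding nrm_def using close[OF G] by (intro real_sqrt_le_mono)
      ultimately show ?thesis using n by linarith
    qed
    then show "\<exists>F. finite F \<and> F \<subseteq> B \<and> (\<forall>G. finite G \<longrightarrow> F \<subseteq> G \<longrightarrow> G \<subseteq> B \<longrightarrow> nrm (diff (comb c G) w) < e)"
      using F by (intro exI[of _ "F n"]) simp
  qed
  then show ?thesis using that w by blast
qed

lemma functional_has_sum:
  assumes B: "B \<subseteq> V" and w: "w \<in> V" and l: "functional l"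
    and lim: "comb_limit c B w"
  shows "((\<lambda>b. c b * l b) has_sum l w) B"
  unfolding has_sum_def tendsto_iff eventually_finite_subsets_at_top
proof (intro allI impI)
  fix e :: real assume e: "e > 0"
  obtain C0 where C0: "\<And>u. u \<in> V \<Longrightarrow> cmod (l u) \<le> C0 * nrm u" using l unfolding functional_def by blast
  define C where "C = \<bar>C0\<bar> + 1"
  have C: "C > 0" "cmod (l u) \<le> C * nrm u" if "u \<in> V" for u
    using order_trans[OF C0[OF that] mult_right_mono[of C0 "\<bar>C0\<bar> + 1" "nrm u", OF _ nrm_nonneg[OF that]]]
    unfolding C_def by simp_all
  have C0: "C > 0" by (simp add: C_def)
  obtain F where F: "finite F" "F \<subseteq> B"
    and G: "\<And>G. finite G \<Longrightarrow> F \<subseteq> G \<Longrightarrow> G \<subseteq> B \<Longrightarrow> nrm (diff (comb c G) w) < e / C"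
    using lim e C0 unfolding comb_limit_def by (meson divide_pos_pos)
  have "dist (\<Sum>b\<in>G. c b * l b) (l w) < e" if H: "finite G" "F \<subseteq> G" "G \<subseteq> B" for G
  proof -
    have GV: "G \<subseteq> V" using H B by auto
    have "dist (\<Sum>b\<in>G. c b * l b) (l w) = cmod (l (diff (comb c G) w))"
      unfolding functional_diff[OF l comb_closed[OF H(1) GV] w] functional_comb[OF H(1) GV l] dist_norm ..
    also have "\<dots> \<le> C * nrm (diff (comb c G) w)"
      using C(2) comb_closed[OF H(1) GV] w by simp
    also have "\<dots> < e" using G[OF H] C0 by (simp add: field_simps)
    finally show ?thesis .
  qed
  then show "\<exists>X. finite X \<and> X \<subseteq> B \<and> (\<forall>Y. finite Y \<and> X \<subseteq> Y \<and> Y \<subseteq> B \<longrightarrow> dist (\<Sum>b\<in>Y. c b * l b) (l w) < e)"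
    using F by blast
qed

lemma square_summable_has_vector:
  assumes B: "orthonormal B" and c: "(\<lambda>b. (cmod (c b))\<^sup>2) summable_on B"
  obtains w where "w \<in> V" "\<And>l. functional l \<Longrightarrow> ((\<lambda>b. c b * l b) has_sum l w) B"
    "\<And>b. b \<in> B \<Longrightarrow> ip w b = c b"
proof -
  have BV: "B \<subseteq> V" using B unfolding orthonormal_def by auto
  obtain w where w: "w \<in> V" and lim: "comb_limit c B w"
    using riesz_fischer[OF B c] by blast
  have sum: "((\<lambda>b. c b * l b) has_sum l w) B" if "functional l" for l
    by (rule functional_has_sum[OF BV w that lim])
  have "ip w b = c b" if b: "b \<in> B" for b
  proof -
    have "((\<lambda>b'. c b' * ip b' b) has_sum ip w b) B"
      using sum functional_ip b BV by blast
    moreover have "((\<lambda>b'. c b' * ip b' b) has_sum (\<Sum>b'\<in>{b}. c b' * ip b' b)) B"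
      using B b unfolding orthonormal_def
      by (intro has_sum_finite_neutralI[where B="{b}"]) auto
    ultimately show ?thesis
      using B b unfolding orthonormal_def by (auto dest: has_sum_unique)
  qed
  then show ?thesis using that w sum by blast
qed

lemma bessel_summable:
  assumes B: "orthonormal B" and v: "v \<in> V"
  shows "(\<lambda>b. (cmod (ip v b))\<^sup>2) summable_on B"
  by (rule nonneg_bdd_above_summable_on) (auto intro!: bdd_aboveI[of _ "sq v"] bessel[OF B] v)

text \<open>
  The vector built from the coefficients of \<open>v\<close> by the Riesz-Fischer theorem has the same
  coefficients, so by maximality of the basis it is at distance \<open>0\<close> from \<open>v\<close>.
\<close>

lemma functional_expansion:
  assumes B: "is_onb V ip B" and v: "v \<in> V" and l: "functional l"
  shows "((\<lambda>b. ip v b * l b) has_sum l v) B"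
proof -
  have ON: "orthonormal B" using B is_onb_iff by blast
  have BV: "B \<subseteq> V" using ON unfolding orthonormal_def by auto
  obtain w where w: "w \<in> V" and sum: "\<And>l. functional l \<Longrightarrow> ((\<lambda>b. ip v b * l b) has_sum l w) B"
    and wb: "\<And>b. b \<in> B \<Longrightarrow> ip w b = ip v b"
    using square_summable_has_vector[OF ON bessel_summable[OF ON v]] by blast
  have "sq (diff v w) = 0"
    using B v w wb BV unfolding is_onb_iff by (auto simp: ip_diff subset_iff)
  then have "ip v z = ip w z" if "z \<in> V" for z
    using ip_zero_if_sq_zero[of "diff v w" z] v w that by (simp add: ip_diff)
  then have "l v = l w" using functional_cong[OF l v w] by blast
  then show ?thesis using sum[OF l] by simp
qed

lemma parseval:
  assumes "is_onb V ip B" "v \<in> V" "w \<in> V"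
  shows "((\<lambda>b. ip v b * ip b w) has_sum ip v w) B"
  using functional_expansion[OF assms(1,2) functional_ip[OF assms(3)]] .

lemma onb_subset: "is_onb V ip B \<Longrightarrow> B \<subseteq> V" unfolding is_onb_def by blast

lemma parseval_sq:
  assumes B: "is_onb V ip B" and v: "v \<in> V"
  shows "ennreal (sq v) = (\<integral>\<^sup>+b. ennreal ((cmod (ip v b))\<^sup>2) \<partial>count_space B)"
proof -
  have "((\<lambda>b. ip v b * ip b v) has_sum ip v v) B" by (rule parseval[OF B v v])
  then have "((\<lambda>b. complex_of_real ((cmod (ip v b))\<^sup>2)) has_sum complex_of_real (sq v)) B"
    unfolding ip_self[OF v]
  proof (rule has_sum_cong[THEN iffD1, rotated])
    fix b assume "b \<in> B"
    then have "ip b v = cnj (ip v b)" using ip_commute[of b v] v onb_subset[OF B] by auto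
    then show "ip v b * ip b v = complex_of_real ((cmod (ip v b))\<^sup>2)"
      by (simp add: mult_cnj_eq_cmod)
  qed
  then have "((\<lambda>b. (cmod (ip v b))\<^sup>2) has_sum sq v) B"
    using has_sum_of_real_iff by blast
  then have s: "(\<lambda>b. (cmod (ip v b))\<^sup>2) summable_on B" "infsum (\<lambda>b. (cmod (ip v b))\<^sup>2) B = sq v"
    by (auto simp: summable_on_def infsumI)
  then have abs: "Infinite_Set_Sum.abs_summable_on (\<lambda>b. (cmod (ip v b))\<^sup>2) B"
    by (subst abs_summable_equivalent[symmetric]) simp
  have "(\<integral>\<^sup>+b. ennreal ((cmod (ip v b))\<^sup>2) \<partial>count_space B) = ennreal (infsetsum (\<lambda>b. (cmod (ip v b))\<^sup>2) B)"
    unfolding infsetsum_def using abs unfolding abs_summable_on_def by (intro nn_integral_eq_integral) auto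
  then show ?thesis using infsetsum_infsum[OF abs] s by simp
qed

text \<open>
  Testing \<open>l\<close> on the combinations with coefficients \<open>cnj (l b)\<close> bounds the sum of
  \<open>(cmod (l b))\<^sup>2\<close> by the squared norm of \<open>l\<close>, so these coefficients define a vector.
\<close>

lemma riesz_representation:
  assumes B: "is_onb V ip B" and l: "functional l"
  obtains w where "w \<in> V" "\<And>v. v \<in> V \<Longrightarrow> l v = ip v w"
proof -
  have ON: "orthonormal B" using B is_onb_iff by blast
  have BV: "B \<subseteq> V" by (rule onb_subset[OF B])
  obtain C0 where C0: "\<And>u. u \<in> V \<Longrightarrow> cmod (l u) \<le> C0 * nrm u" using l unfolding functional_def by blast
  have bd: "(\<Sum>b\<in>F. (cmod (l b))\<^sup>2) \<le> C0\<^sup>2" if F: "finite F" "F \<subseteq> B" for F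
  proof -
    have FV: "F \<subseteq> V" using F BV by auto
    define S where "S = (\<Sum>b\<in>F. (cmod (l b))\<^sup>2)"
    have S0: "0 \<le> S" unfolding S_def by (intro sum_nonneg) auto
    define s where "s = comb (\<lambda>b. cnj (l b)) F"
    have "l s = (\<Sum>b\<in>F. l b * cnj (l b))"
      unfolding s_def functional_comb[OF F(1) FV l] by (simp add: mult.commute)
    then have "l s = complex_of_real S" by (simp add: S_def mult_cnj_eq_cmod)
    moreover have "sq s = S" unfolding s_def S_def using sq_comb[OF ON F] by simp
    ultimately have "S \<le> C0 * sqrt S"
      using C0[of s] comb_closed[OF F(1) FV] S0 unfolding s_def nrm_def by simp
    then have "sqrt S * sqrt S \<le> C0 * sqrt S" using S0 by simp
    then have "sqrt S \<le> C0 \<or> S = 0"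
      using S0 mult_le_cancel_right_pos[of "sqrt S" "sqrt S" C0] by (cases "S = 0") auto
    then have "S \<le> C0\<^sup>2"
    proof
      assume "sqrt S \<le> C0"
      then have "(sqrt S)\<^sup>2 \<le> C0\<^sup>2" using S0 by (intro power_mono) auto
      then show ?thesis using S0 by simp
    qed simp
    then show ?thesis unfolding S_def .
  qed
  have "(\<lambda>b. (cmod (cnj (l b)))\<^sup>2) summable_on B"
    by (rule nonneg_bdd_above_summable_on) (auto intro!: bdd_aboveI[of _ "C0\<^sup>2"] bd)
  then have sm: "(\<lambda>b. (cmod (cnj (l b)))\<^sup>2) summable_on B" .
  obtain w where w: "w \<in> V" and wb: "\<And>b. b \<in> B \<Longrightarrow> ip w b = cnj (l b)"
    by (rule square_summable_has_vector[OF ON sm]) (rule that)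
  have "l v = ip v w" if v: "v \<in> V" for v
  proof -
    have "((\<lambda>b. ip v b * l b) has_sum l v) B" by (rule functional_expansion[OF B v l])
    moreover have "((\<lambda>b. ip v b * ip b w) has_sum ip v w) B" by (rule parseval[OF B v w])
    moreover have "l b = ip b w" if "b \<in> B" for b
      using wb[OF that] ip_commute[of b w] that BV w by auto
    ultimately show ?thesis
      by (metis (no_types, lifting) has_sum_cong has_sum_unique)
  qed
  then show ?thesis using that w by blast
qed

text \<open>
  By Zorn's lemma there is a maximal orthonormal set; a vector of positive norm orthogonal to it could be
  normalized and added.
\<close>

lemma onb_exists: "\<exists>B. is_onb V ip B"
proof -
  obtain B where B: "orthonormal B" and max: "\<And>X. orthonormal X \<Longrightarrow> B \<subseteq> X \<Longrightarrow> X = B"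
  proof -
    have "\<exists>M\<in>Collect orthonormal. \<forall>X\<in>Collect orthonormal. M \<subseteq> X \<longrightarrow> X = M"
    proof (rule subset_Zorn_nonempty)
      have "orthonormal {}" by (simp add: orthonormal_def)
      then show "Collect orthonormal \<noteq> {}" by blast
      fix \<C> assume ne: "\<C> \<noteq> {}" and ch: "subset.chain (Collect orthonormal) \<C>"
      have C: "orthonormal X" if "X \<in> \<C>" for X using ch that unfolding subset.chain_def by auto
      have tot: "X \<subseteq> Y \<or> Y \<subseteq> X" if "X \<in> \<C>" "Y \<in> \<C>" for X Y
        using ch that unfolding subset.chain_def by auto
      have "ip b b' = (if b = b' then 1 else 0)" if bb: "b \<in> \<Union>\<C>" "b' \<in> \<Union>\<C>" for b b'
      proof -
        obtain X1 X2 where "X1 \<in> \<C>" "b \<in> X1" "X2 \<in> \<C>" "b' \<in> X2" using bb by blast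
        then obtain X where "X \<in> \<C>" "b \<in> X" "b' \<in> X" using tot[of X1 X2] by blast
        then show ?thesis using C unfolding orthonormal_def by blast
      qed
      moreover have "\<Union>\<C> \<subseteq> V" using C unfolding orthonormal_def by blast
      ultimately show "\<Union>\<C> \<in> Collect orthonormal" unfolding orthonormal_def by simp
    qed
    then show ?thesis using that by blast
  qed
  have "sq v = 0" if v: "v \<in> V" "\<forall>b\<in>B. ip v b = 0" for v
  proof (rule ccontr)
    assume "sq v \<noteq> 0"
    then have pos: "sq v > 0" using sq_nonneg[OF v(1)] by linarith
    define w where "w = scale (complex_of_real (1 / sqrt (sq v))) v"
    have w: "w \<in> V" using v by (simp add: w_def)
    have "ip w w = complex_of_real ((1 / sqrt (sq v)) * ((1 / sqrt (sq v)) * sq v))"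
      unfolding w_def using v
      by (simp only: ip_scale ip_scale_right scale_closed ip_self[OF v(1)] complex_cnj_complex_of_real of_real_mult)
    moreover have "(1 / sqrt (sq v)) * ((1 / sqrt (sq v)) * sq v) = 1"
      using pos by (simp add: field_simps)
    ultimately have ww: "ip w w = 1" by simp
    have wb: "ip w b = 0" if "b \<in> B" for b
      using that v B unfolding w_def orthonormal_def by (auto simp: ip_scale subset_iff)
    have bw: "ip b w = 0" if "b \<in> B" for b
      using wb[OF that] ip_commute[of b w] w B that unfolding orthonormal_def by auto
    have "orthonormal (insert w B)"
      using B w ww wb bw unfolding orthonormal_def by auto
    then have "w \<in> B" using max by blast
    then show False using wb ww by fastforce
  qed
  then have "is_onb V ip B" using B unfolding is_onb_iff by blast
  then show ?thesis ..
qed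

lemma some_onb: "is_onb V ip (some_onb V ip)"
  unfolding some_onb_def using onb_exists by (rule someI_ex)

section \<open>Operators, Hilbert-Schmidt norms and traces\<close>

text \<open>
  Linearity holds only up to vectors of norm \<open>0\<close>, since operators act on representatives.
\<close>

definition bounded_op :: "('v \<Rightarrow> 'v) \<Rightarrow> bool" where
  "bounded_op T \<longleftrightarrow> (\<forall>v\<in>V. T v \<in> V) \<and>
     (\<forall>u\<in>V. \<forall>v\<in>V. \<forall>w\<in>V. ip (T (add u v)) w = ip (T u) w + ip (T v) w) \<and>
     (\<forall>c. \<forall>u\<in>V. \<forall>w\<in>V. ip (T (scale c u)) w = c * ip (T u) w) \<and>
     (\<exists>C. \<forall>v\<in>V. sq (T v) \<le> C * sq v)"

lemma bounded_op_closed: "bounded_op T \<Longrightarrow> v \<in> V \<Longrightarrow> T v \<in> V"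
  unfolding bounded_op_def by blast

lemma bounded_op_bound:
  assumes "bounded_op T" shows "\<exists>C\<ge>0. \<forall>v\<in>V. sq (T v) \<le> C * sq v"
proof -
  obtain C where C: "\<And>v. v \<in> V \<Longrightarrow> sq (T v) \<le> C * sq v" using assms unfolding bounded_op_def by blast
  have "sq (T v) \<le> \<bar>C\<bar> * sq v" if "v \<in> V" for v
    using C[OF that] mult_right_mono[of C "\<bar>C\<bar>" "sq v"] sq_nonneg[OF that] by linarith
  then show ?thesis by (intro exI[of _ "\<bar>C\<bar>"]) simp
qed

lemma bounded_op_functional:
  assumes T: "bounded_op T" and w: "w \<in> V"
  shows "functional (\<lambda>v. ip (T v) w)"
proof -
  obtain C where C: "C \<ge> 0" "\<And>v. v \<in> V \<Longrightarrow> sq (T v) \<le> C * sq v" using bounded_op_bound[OF T] by blast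
  have "cmod (ip (T v) w) \<le> (sqrt C * nrm w) * nrm v" if v: "v \<in> V" for v
  proof -
    have "nrm (T v) \<le> sqrt C * nrm v"
      using real_sqrt_le_mono[OF C(2)[OF v]] by (simp add: nrm_def real_sqrt_mult)
    then have "nrm (T v) * nrm w \<le> sqrt C * nrm v * nrm w"
      using w by (intro mult_right_mono) auto
    then show ?thesis
      using cauchy_schwarz[OF bounded_op_closed[OF T v] w] by (simp add: mult_ac)
  qed
  then show ?thesis using T w unfolding functional_def bounded_op_def by blast
qed

lemma bounded_op_expansion:
  assumes "is_onb V ip B" "bounded_op T" "v \<in> V" "w \<in> V"
  shows "((\<lambda>b. ip v b * ip (T b) w) has_sum ip (T v) w) B"
  by (rule functional_expansion[OF assms(1,3) bounded_op_functional[OF assms(2,4)]])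

lemma bounded_op_adjoint:
  assumes T: "bounded_op T" and w: "w \<in> V"
  shows "\<exists>u\<in>V. \<forall>v\<in>V. ip (T v) w = ip v u"
  by (rule riesz_representation[OF some_onb bounded_op_functional[OF T w]]) blast

lemma bounded_op_cong:
  assumes T: "bounded_op T" and V: "u \<in> V" "v \<in> V" "w \<in> V" and eq: "\<And>z. z \<in> V \<Longrightarrow> ip u z = ip v z"
  shows "ip (T u) w = ip (T v) w"
  by (rule functional_cong[OF bounded_op_functional[OF T V(3)] V(1,2) eq])

text \<open>
  Linearity of \<open>P\<close> cannot be applied directly because \<open>Q\<close> respects sums only weakly; the
  adjoint of \<open>P\<close> moves the question into the form.
\<close>

lemma bounded_op_comp:
  assumes P: "bounded_op P" and Q: "bounded_op Q"
  shows "bounded_op (P \<circ> Q)"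
proof -
  obtain C where C: "C \<ge> 0" "\<And>v. v \<in> V \<Longrightarrow> sq (P v) \<le> C * sq v" using bounded_op_bound[OF P] by blast
  obtain D where D: "D \<ge> 0" "\<And>v. v \<in> V \<Longrightarrow> sq (Q v) \<le> D * sq v" using bounded_op_bound[OF Q] by blast
  have "sq (P (Q v)) \<le> (C * D) * sq v" if v: "v \<in> V" for v
    using C(2)[OF bounded_op_closed[OF Q v]] mult_left_mono[OF D(2)[OF v] C(1)] by (simp add: mult_ac)
  moreover have "ip (P (Q (add u v))) w = ip (P (Q u)) w + ip (P (Q v)) w"
    if "u \<in> V" "v \<in> V" "w \<in> V" for u v w
  proof -
    obtain x where x: "x \<in> V" "\<And>v. v \<in> V \<Longrightarrow> ip (P v) w = ip v x"
      using bounded_op_adjoint[OF P \<open>w \<in> V\<close>] by blast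
    show ?thesis using that Q x(1) by (simp add: x(2) bounded_op_closed[OF Q]) (simp add: bounded_op_def)
  qed
  moreover have "ip (P (Q (scale c u))) w = c * ip (P (Q u)) w"
    if "u \<in> V" "w \<in> V" for c u w
  proof -
    obtain x where x: "x \<in> V" "\<And>v. v \<in> V \<Longrightarrow> ip (P v) w = ip v x"
      using bounded_op_adjoint[OF P \<open>w \<in> V\<close>] by blast
    show ?thesis using that Q x(1) by (simp add: x(2) bounded_op_closed[OF Q]) (simp add: bounded_op_def)
  qed
  moreover have "P (Q v) \<in> V" if "v \<in> V" for v
    using that P Q by (simp add: bounded_op_closed)
  ultimately show ?thesis unfolding bounded_op_def comp_def by blast
qed

lemma bounded_op_funpow:
  assumes T: "bounded_op T" and n: "n \<ge> 1"
  shows "bounded_op (T ^^ n)"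
  using n
proof (induction n rule: nat_induct_at_least)
  case (Suc n)
  show ?case unfolding funpow.simps by (rule bounded_op_comp[OF T Suc.IH])
qed (use T in \<open>simp add: eta_contract_eq\<close>)

lemma hs_norm_sq_eq_double:
  assumes T: "bounded_op T" and B: "is_onb V ip B" and C: "is_onb V ip C"
  shows "(\<integral>\<^sup>+b. ennreal (sq (T b)) \<partial>count_space B) =
         (\<integral>\<^sup>+b. \<integral>\<^sup>+c. ennreal ((cmod (ip (T b) c))\<^sup>2) \<partial>count_space C \<partial>count_space B)"
  using onb_subset[OF B] by (intro nn_integral_cong) (auto simp: parseval_sq[OF C] bounded_op_closed[OF T] subset_iff)

text \<open>
  Both sides equal the sum of the squared norms of the adjoint over one fixed basis, by exchanging the
  two summations of the squared matrix coefficients.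
\<close>

lemma hs_norm_sq_eq:
  assumes T: "bounded_op T" and B: "is_onb V ip B"
  shows "hs_norm_sq V ip T = (\<integral>\<^sup>+b. ennreal (sq (T b)) \<partial>count_space B)"
proof -
  define S where "S = some_onb V ip"
  have S: "is_onb V ip S" unfolding S_def by (rule some_onb)
  have "\<exists>u\<in>V. \<forall>v\<in>V. ip (T v) w = ip v u" if "w \<in> V" for w
    using bounded_op_adjoint[OF T that] .
  then obtain A where A: "\<And>w. w \<in> V \<Longrightarrow> A w \<in> V" "\<And>v w. v \<in> V \<Longrightarrow> w \<in> V \<Longrightarrow> ip (T v) w = ip v (A w)"
    by metis
  have flip: "(\<integral>\<^sup>+b. ennreal (sq (T b)) \<partial>count_space B) = (\<integral>\<^sup>+c. ennreal (sq (A c)) \<partial>count_space S)"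
    if B: "is_onb V ip B" for B
  proof -
    have "(\<integral>\<^sup>+b. ennreal (sq (T b)) \<partial>count_space B) =
        (\<integral>\<^sup>+c. \<integral>\<^sup>+b. ennreal ((cmod (ip (T b) c))\<^sup>2) \<partial>count_space B \<partial>count_space S)"
      unfolding hs_norm_sq_eq_double[OF T B S] by (rule nn_integral_count_space_swap)
    also have "\<dots> = (\<integral>\<^sup>+c. \<integral>\<^sup>+b. ennreal ((cmod (ip (A c) b))\<^sup>2) \<partial>count_space B \<partial>count_space S)"
    proof (intro nn_integral_cong)
      fix c b assume "c \<in> space (count_space S)" "b \<in> space (count_space B)"
      then have V: "c \<in> V" "b \<in> V" using onb_subset[OF S] onb_subset[OF B] by auto
      have "cmod (ip (T b) c) = cmod (ip (A c) b)"
        using A(2)[OF V(2,1)] ip_commute[OF V(2) A(1)[OF V(1)]] by simp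
      then show "ennreal ((cmod (ip (T b) c))\<^sup>2) = ennreal ((cmod (ip (A c) b))\<^sup>2)" by simp
    qed
    also have "\<dots> = (\<integral>\<^sup>+c. ennreal (sq (A c)) \<partial>count_space S)"
      using onb_subset[OF S] by (intro nn_integral_cong) (auto simp: parseval_sq[OF B] A subset_iff)
    finally show ?thesis .
  qed
  have "hs_norm_sq V ip T = (\<integral>\<^sup>+b. ennreal (sq (T b)) \<partial>count_space S)"
    unfolding hs_norm_sq_def S_def[symmetric] sq_def infsum_ennreal_eq_nn_integral ..
  then show ?thesis using flip[OF S] flip[OF B] by simp
qed

lemma hs_norm_sq_comp_le:
  assumes P: "bounded_op P" and Q: "bounded_op Q" and fin: "hs_norm_sq V ip Q < \<infinity>"
  shows "hs_norm_sq V ip (P \<circ> Q) < \<infinity>"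
proof -
  define S where "S = some_onb V ip"
  have S: "is_onb V ip S" unfolding S_def by (rule some_onb)
  obtain C where C: "C \<ge> 0" "\<And>v. v \<in> V \<Longrightarrow> sq (P v) \<le> C * sq v" using bounded_op_bound[OF P] by blast
  have "hs_norm_sq V ip (P \<circ> Q) \<le> (\<integral>\<^sup>+b. ennreal C * ennreal (sq (Q b)) \<partial>count_space S)"
    unfolding hs_norm_sq_eq[OF bounded_op_comp[OF P Q] S]
    using onb_subset[OF S] C
    by (intro nn_integral_mono) (auto simp: subset_iff bounded_op_closed[OF Q] simp flip: ennreal_mult intro!: ennreal_leI)
  also have "\<dots> = ennreal C * hs_norm_sq V ip Q"
    unfolding hs_norm_sq_eq[OF Q S] by (rule nn_integral_cmult) simp
  also have "\<dots> < \<infinity>" using fin by (simp add: ennreal_mult_less_top)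
  finally show ?thesis .
qed

lemma hs_norm_sq_funpow_finite:
  assumes T: "bounded_op T" and fin: "hs_norm_sq V ip T < \<infinity>" and n: "n \<ge> 1"
  shows "hs_norm_sq V ip (T ^^ n) < \<infinity>"
  using n
proof (induction n rule: nat_induct_at_least)
  case (Suc n)
  show ?case unfolding funpow.simps
    by (rule hs_norm_sq_comp_le[OF T bounded_op_funpow[OF T Suc.hyps] Suc.IH])
qed (use fin in \<open>simp add: eta_contract_eq\<close>)

text \<open>
  The double series of products of matrix coefficients converges absolutely, being a product of two square
  summable families. Summing over \<open>c\<close> first gives the trace of \<open>P \<circ> Q\<close> in the basis
  \<open>B\<close>, summing over \<open>b\<close> first gives the trace of \<open>Q \<circ> P\<close> in the basis \<open>C\<close>.
\<close>

lemma
  assumes P: "bounded_op P" "hs_norm_sq V ip P < \<infinity>" and Q: "bounded_op Q" "hs_norm_sq V ip Q < \<infinity>"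
    and B: "is_onb V ip B" and C: "is_onb V ip C"
  shows trace_double_summable: "(\<lambda>(b, c). ip (Q b) c * ip (P c) b) summable_on B \<times> C"
    and trace_has_sum: "((\<lambda>b. ip (P (Q b)) b) has_sum (\<Sum>\<^sub>\<infinity>(b, c)\<in>B \<times> C. ip (Q b) c * ip (P c) b)) B"
    and trace_has_sum_swap: "((\<lambda>c. ip (Q (P c)) c) has_sum (\<Sum>\<^sub>\<infinity>(b, c)\<in>B \<times> C. ip (Q b) c * ip (P c) b)) C"
proof -
  have BV: "B \<subseteq> V" "C \<subseteq> V" using onb_subset B C by auto
  have "(\<lambda>z. ip (Q (fst z)) (snd z) * ip (P (snd z)) (fst z)) summable_on B \<times> C"
  proof (rule summable_on_complex_mult)
    show "(\<integral>\<^sup>+z. ennreal ((cmod (ip (Q (fst z)) (snd z)))\<^sup>2) \<partial>count_space (B \<times> C)) < \<infinity>"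
      using Q(2) unfolding hs_norm_sq_eq[OF Q(1) B] hs_norm_sq_eq_double[OF Q(1) B C]
      unfolding nn_integral_count_space_Times by simp
    have "(\<integral>\<^sup>+z. ennreal ((cmod (ip (P (snd z)) (fst z)))\<^sup>2) \<partial>count_space (B \<times> C)) =
        (\<integral>\<^sup>+c. \<integral>\<^sup>+b. ennreal ((cmod (ip (P c) b))\<^sup>2) \<partial>count_space B \<partial>count_space C)"
      by (subst nn_integral_count_space_swap) (simp add: nn_integral_count_space_Times)
    then show "(\<integral>\<^sup>+z. ennreal ((cmod (ip (P (snd z)) (fst z)))\<^sup>2) \<partial>count_space (B \<times> C)) < \<infinity>"
      using P(2) unfolding hs_norm_sq_eq[OF P(1) C] hs_norm_sq_eq_double[OF P(1) C B] by simp
  qed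
  then show sm: "(\<lambda>(b, c). ip (Q b) c * ip (P c) b) summable_on B \<times> C"
    by (simp add: case_prod_unfold)
  have hs: "((\<lambda>(b, c). ip (Q b) c * ip (P c) b) has_sum (\<Sum>\<^sub>\<infinity>(b, c)\<in>B \<times> C. ip (Q b) c * ip (P c) b)) (B \<times> C)"
    by (rule has_sum_infsum[OF sm])
  show "((\<lambda>b. ip (P (Q b)) b) has_sum (\<Sum>\<^sub>\<infinity>(b, c)\<in>B \<times> C. ip (Q b) c * ip (P c) b)) B"
    using BV by (intro has_sum_SigmaD[OF hs])
      (auto intro!: bounded_op_expansion[OF C P(1)] bounded_op_closed[OF Q(1)])
  have hs': "((\<lambda>(c, b). ip (P c) b * ip (Q b) c) has_sum (\<Sum>\<^sub>\<infinity>(b, c)\<in>B \<times> C. ip (Q b) c * ip (P c) b)) (C \<times> B)"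
    using hs by (subst has_sum_swap) (simp add: mult.commute)
  show "((\<lambda>c. ip (Q (P c)) c) has_sum (\<Sum>\<^sub>\<infinity>(b, c)\<in>B \<times> C. ip (Q b) c * ip (P c) b)) C"
    using BV by (intro has_sum_SigmaD[OF hs'])
      (auto intro!: bounded_op_expansion[OF B Q(1)] bounded_op_closed[OF P(1)])
qed

text \<open>
  The trace of \<open>P \<circ> Q\<close> in \<open>B\<close> and in \<open>C\<close> both equal the trace of
  \<open>Q \<circ> P\<close> in \<open>C\<close>.
\<close>

lemma trace_comp:
  assumes P: "bounded_op P" "hs_norm_sq V ip P < \<infinity>" and Q: "bounded_op Q" "hs_norm_sq V ip Q < \<infinity>"
    and B: "is_onb V ip B" and C: "is_onb V ip C"
  shows "((\<lambda>b. ip (P (Q b)) b) has_sum (\<Sum>\<^sub>\<infinity>(b, c)\<in>C \<times> C. ip (Q b) c * ip (P c) b)) B"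
  using trace_has_sum[OF P Q B C]
  unfolding has_sum_unique[OF trace_has_sum_swap[OF P Q B C] trace_has_sum_swap[OF P Q C C]] .

lemma trace_class_comp:
  assumes "bounded_op P" "hs_norm_sq V ip P < \<infinity>" and "bounded_op Q" "hs_norm_sq V ip Q < \<infinity>"
  shows "trace_class V ip (P \<circ> Q)"
  unfolding trace_class_def comp_def by (intro exI allI impI) (rule trace_comp[OF assms _ some_onb])

lemma op_trace_comp:
  assumes "bounded_op P" "hs_norm_sq V ip P < \<infinity>" and "bounded_op Q" "hs_norm_sq V ip Q < \<infinity>"
    and C: "is_onb V ip C"
  shows "op_trace V ip (P \<circ> Q) = (\<Sum>\<^sub>\<infinity>(b, c)\<in>C \<times> C. ip (Q b) c * ip (P c) b)"
  unfolding op_trace_def comp_def using trace_comp[OF assms(1-4) some_onb C] by (rule infsumI)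

end

text \<open>
  The operator norm is at most the Hilbert-Schmidt norm. Apply the Cauchy-Schwarz inequality to the
  expansion of each coefficient of \<open>T v\<close>.
\<close>

lemma (in semi_hilbert) sq_le_hs_norm_sq:
  assumes T: "bounded_op T" and v: "v \<in> V"
  shows "ennreal (sq (T v)) \<le> hs_norm_sq V ip T * ennreal (sq v)"
proof -
  define B where "B = some_onb V ip"
  have B: "is_onb V ip B" unfolding B_def by (rule some_onb)
  have BV: "B \<subseteq> V" by (rule onb_subset[OF B])
  have le: "ennreal ((cmod (ip (T v) c))\<^sup>2) \<le>
      ennreal (sq v) * (\<integral>\<^sup>+b. ennreal ((cmod (ip (T b) c))\<^sup>2) \<partial>count_space B)" if c: "c \<in> V" for c
  proof -
    have hs: "((\<lambda>b. ip v b * ip (T b) c) has_sum ip (T v) c) B"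
      by (rule bounded_op_expansion[OF B T v c])
    then have int: "integrable (count_space B) (\<lambda>b. ip v b * ip (T b) c)"
      and eq: "(LINT b|count_space B. ip v b * ip (T b) c) = ip (T v) c"
      unfolding has_sum_complex_iff_integral by auto
    have "ennreal (cmod (ip (T v) c)) \<le> (\<integral>\<^sup>+b. ennreal (cmod (ip v b * ip (T b) c)) \<partial>count_space B)"
      unfolding eq[symmetric] by (rule integral_norm_bound_ennreal[OF int])
    also have "\<dots> = (\<integral>\<^sup>+b. ennreal (cmod (ip v b)) * ennreal (cmod (ip (T b) c)) \<partial>count_space B)"
      by (simp add: norm_mult ennreal_mult)
    finally have "(ennreal (cmod (ip (T v) c)))\<^sup>2 \<le>
        (\<integral>\<^sup>+b. ennreal (cmod (ip v b)) * ennreal (cmod (ip (T b) c)) \<partial>count_space B)\<^sup>2"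
      by (intro power_mono) auto
    also have "\<dots> \<le> (\<integral>\<^sup>+b. (ennreal (cmod (ip v b)))\<^sup>2 \<partial>count_space B) * (\<integral>\<^sup>+b. (ennreal (cmod (ip (T b) c)))\<^sup>2 \<partial>count_space B)"
      by (rule Cauchy_Schwarz_nn_integral) auto
    finally show ?thesis
      unfolding parseval_sq[OF B v] by (simp add: ennreal_power)
  qed
  have "ennreal (sq (T v)) = (\<integral>\<^sup>+c. ennreal ((cmod (ip (T v) c))\<^sup>2) \<partial>count_space B)"
    by (rule parseval_sq[OF B bounded_op_closed[OF T v]])
  also have "\<dots> \<le> (\<integral>\<^sup>+c. ennreal (sq v) * (\<integral>\<^sup>+b. ennreal ((cmod (ip (T b) c))\<^sup>2) \<partial>count_space B) \<partial>count_space B)"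
    using BV le by (intro nn_integral_mono) auto
  also have "\<dots> = ennreal (sq v) * (\<integral>\<^sup>+c. \<integral>\<^sup>+b. ennreal ((cmod (ip (T b) c))\<^sup>2) \<partial>count_space B \<partial>count_space B)"
    by (rule nn_integral_cmult) simp
  also have "(\<integral>\<^sup>+c. \<integral>\<^sup>+b. ennreal ((cmod (ip (T b) c))\<^sup>2) \<partial>count_space B \<partial>count_space B) = hs_norm_sq V ip T"
    unfolding hs_norm_sq_eq[OF T B] hs_norm_sq_eq_double[OF T B B] by (rule nn_integral_count_space_swap)
  finally show ?thesis by (simp add: mult.commute)
qed

text \<open>
  The Cauchy-Schwarz inequality for the double family of matrix coefficients of \<open>P\<close> and
  \<open>Q\<close>. Bounding the sum of the absolute values of the diagonal coefficients, it allows the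
  trace to be exchanged with integrals.
\<close>

lemma (in semi_hilbert) nn_integral_trace_le:
  assumes P: "bounded_op P" and Q: "bounded_op Q" and B: "is_onb V ip B"
  shows "(\<integral>\<^sup>+b. ennreal (cmod (ip (P (Q b)) b)) \<partial>count_space B)\<^sup>2 \<le> hs_norm_sq V ip P * hs_norm_sq V ip Q"
proof -
  have BV: "B \<subseteq> V" by (rule onb_subset[OF B])
  have "ennreal (cmod (ip (P (Q b)) b)) \<le>
      (\<integral>\<^sup>+c. ennreal (cmod (ip (Q b) c)) * ennreal (cmod (ip (P c) b)) \<partial>count_space B)" if b: "b \<in> V" for b
  proof -
    have hs: "((\<lambda>c. ip (Q b) c * ip (P c) b) has_sum ip (P (Q b)) b) B"
      by (rule bounded_op_expansion[OF B P bounded_op_closed[OF Q b] b])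
    then have int: "integrable (count_space B) (\<lambda>c. ip (Q b) c * ip (P c) b)"
      and eq: "(LINT c|count_space B. ip (Q b) c * ip (P c) b) = ip (P (Q b)) b"
      unfolding has_sum_complex_iff_integral by auto
    show ?thesis unfolding eq[symmetric]
      using integral_norm_bound_ennreal[OF int] by (simp add: norm_mult ennreal_mult)
  qed
  then have "(\<integral>\<^sup>+b. ennreal (cmod (ip (P (Q b)) b)) \<partial>count_space B)
      \<le> (\<integral>\<^sup>+b. \<integral>\<^sup>+c. ennreal (cmod (ip (Q b) c)) * ennreal (cmod (ip (P c) b)) \<partial>count_space B \<partial>count_space B)"
    using BV by (intro nn_integral_mono) auto
  also have "\<dots> = (\<integral>\<^sup>+z. ennreal (cmod (ip (Q (fst z)) (snd z))) * ennreal (cmod (ip (P (snd z)) (fst z))) \<partial>count_space (B \<times> B))"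
    by (rule nn_integral_count_space_Times)
  finally have "(\<integral>\<^sup>+b. ennreal (cmod (ip (P (Q b)) b)) \<partial>count_space B)\<^sup>2 \<le> \<dots>\<^sup>2"
    by (intro power_mono) auto
  also have "\<dots> \<le> (\<integral>\<^sup>+z. (ennreal (cmod (ip (Q (fst z)) (snd z))))\<^sup>2 \<partial>count_space (B \<times> B)) *
      (\<integral>\<^sup>+z. (ennreal (cmod (ip (P (snd z)) (fst z))))\<^sup>2 \<partial>count_space (B \<times> B))"
    by (rule Cauchy_Schwarz_nn_integral) auto
  also have "(\<integral>\<^sup>+z. (ennreal (cmod (ip (Q (fst z)) (snd z))))\<^sup>2 \<partial>count_space (B \<times> B)) = hs_norm_sq V ip Q"
    unfolding hs_norm_sq_eq[OF Q B] hs_norm_sq_eq_double[OF Q B B] nn_integral_count_space_Times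
    by (simp add: ennreal_power)
  also have "(\<integral>\<^sup>+z. (ennreal (cmod (ip (P (snd z)) (fst z))))\<^sup>2 \<partial>count_space (B \<times> B)) = hs_norm_sq V ip P"
  proof -
    have "(\<integral>\<^sup>+z. (ennreal (cmod (ip (P (snd z)) (fst z))))\<^sup>2 \<partial>count_space (B \<times> B)) =
        (\<integral>\<^sup>+b. \<integral>\<^sup>+c. ennreal ((cmod (ip (P c) b))\<^sup>2) \<partial>count_space B \<partial>count_space B)"
      unfolding nn_integral_count_space_Times by (simp add: ennreal_power)
    also have "\<dots> = (\<integral>\<^sup>+c. \<integral>\<^sup>+b. ennreal ((cmod (ip (P c) b))\<^sup>2) \<partial>count_space B \<partial>count_space B)"
      by (rule nn_integral_count_space_swap)
    finally show ?thesis unfolding hs_norm_sq_eq[OF P B] hs_norm_sq_eq_double[OF P B B] .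
  qed
  finally show ?thesis by (simp add: mult.commute)
qed

section \<open>Operators on a separable Hilbert space\<close>

lemma scaleC_zero_left [simp]: "0 *\<^sub>C (v::'h::chilbert_space) = 0"
  using scaleC_of_real[of 0 v] by simp
lemma scaleC_one [simp]: "1 *\<^sub>C (v::'h::chilbert_space) = v"
  using scaleC_of_real[of 1 v] by simp
lemma scaleC_minus_one [simp]: "(-1) *\<^sub>C (v::'h::chilbert_space) = - v"
  using scaleC_of_real[of "-1" v] by simp
lemma scaleC_zero_right [simp]: "c *\<^sub>C (0::'h::chilbert_space) = 0"
  using scaleC_add_right[of c "0::'h" 0] by simp
lemma scaleC_eq_scaleC_left: "c *\<^sub>C d *\<^sub>C (v::'h::chilbert_space) = d *\<^sub>C c *\<^sub>C v"
  by (simp add: scaleC_scaleC mult.commute)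

lemma cinner_add_right: "cinner (w::'h::chilbert_space) (u + v) = cinner w u + cinner w v"
  using cinner_commute[of w "u + v"] cinner_commute[of w u] cinner_commute[of w v]
  by (simp add: cinner_add_left)
lemma cinner_scaleC_right: "cinner (w::'h::chilbert_space) (c *\<^sub>C u) = cnj c * cinner w u"
  using cinner_commute[of w "c *\<^sub>C u"] cinner_commute[of w u] by (simp add: cinner_scaleC_left)

lemma norm_scaleC [simp]: "norm (c *\<^sub>C (v::'h::chilbert_space)) = cmod c * norm v"
proof -
  have "complex_of_real ((norm (c *\<^sub>C v))\<^sup>2) = (c * cnj c) * complex_of_real ((norm v)\<^sup>2)"
    unfolding cinner_self[symmetric] by (simp add: cinner_scaleC_left cinner_scaleC_right)
  also have "\<dots> = complex_of_real ((cmod c * norm v)\<^sup>2)"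
    by (simp add: mult_cnj_eq_cmod power_mult_distrib)
  finally have "(norm (c *\<^sub>C v))\<^sup>2 = (cmod c * norm v)\<^sup>2" using of_real_eq_iff by blast
  then show ?thesis by (rule power2_eq_imp_eq) auto
qed

lemma geometric_cauchy_limit:
  fixes s :: "nat \<Rightarrow> 'a::banach"
  assumes d: "\<And>n. norm (s (Suc n) - s n) \<le> K * r ^ n" and r: "0 \<le> r" "r < 1"
  shows "\<exists>l. s \<longlonglongrightarrow> l \<and> (\<forall>n. norm (s n - l) \<le> K * r ^ n / (1 - r))"
proof -
  have sm: "summable (\<lambda>n. K * r ^ n)" using r by (intro summable_mult summable_geometric) simp
  have "summable (\<lambda>n. norm (s (Suc n) - s n))"
    by (rule summable_comparison_test'[OF sm, where N=0]) (use d in simp)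
  then have "summable (\<lambda>n. s (Suc n) - s n)" by (rule summable_norm_cancel)
  then have "convergent (\<lambda>n. \<Sum>i<n. s (Suc i) - s i)" by (simp add: summable_iff_convergent)
  then have "convergent (\<lambda>n. s n - s 0)" by (simp add: sum_lessThan_telescope)
  then have "convergent (\<lambda>n. (s n - s 0) + s 0)" by (intro convergent_add convergent_const)
  then obtain l where l: "s \<longlonglongrightarrow> l" by (auto simp: convergent_def)
  have K: "0 \<le> K" using order_trans[OF norm_ge_zero d[of 0]] by simp
  have step: "norm (s (n + k) - s n) \<le> K * r ^ n * (1 - r ^ k) / (1 - r)" for n k
  proof (induction k)
    case (Suc k)
    have "norm (s (n + Suc k) - s n) \<le> norm (s (Suc (n + k)) - s (n + k)) + norm (s (n + k) - s n)"
      using norm_triangle_ineq[of "s (Suc (n + k)) - s (n + k)" "s (n + k) - s n"] by simp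
    also have "\<dots> \<le> K * r ^ (n + k) + K * r ^ n * (1 - r ^ k) / (1 - r)"
      by (intro add_mono d Suc.IH)
    also have "\<dots> = K * r ^ n * (1 - r ^ Suc k) / (1 - r)"
      using r by (simp add: field_simps power_add)
    finally show ?case .
  qed simp
  have "norm (s n - l) \<le> K * r ^ n / (1 - r)" for n
  proof (rule LIMSEQ_le_const2)
    have "(\<lambda>k. s (n + k)) \<longlonglongrightarrow> l" using LIMSEQ_ignore_initial_segment[OF l, of n] by (simp add: add.commute)
    then have "(\<lambda>k. norm (s (n + k) - s n)) \<longlonglongrightarrow> norm (l - s n)" by (intro tendsto_intros)
    then show "(\<lambda>k. norm (s (n + k) - s n)) \<longlonglongrightarrow> norm (s n - l)" by (simp add: norm_minus_commute)
    have "norm (s (n + k) - s n) \<le> K * r ^ n / (1 - r)" for k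
    proof -
      have "K * r ^ n * (1 - r ^ k) \<le> K * r ^ n * 1" using K r by (intro mult_left_mono) auto
      then have "K * r ^ n * (1 - r ^ k) / (1 - r) \<le> K * r ^ n / (1 - r)"
        using r by (intro divide_right_mono) auto
      then show ?thesis using step[of n k] by linarith
    qed
    then show "\<exists>N. \<forall>k\<ge>N. norm (s (n + k) - s n) \<le> K * r ^ n / (1 - r)" by blast
  qed
  then show ?thesis using l by blast
qed

lemma Re_cinner_self: "Re (cinner (v::'h::chilbert_space) v) = (norm v)\<^sup>2"
  unfolding cinner_self by (rule Re_complex_of_real)

lemma semi_hilbert_H: "semi_hilbert (UNIV::'h::chilbert_space set) (+) (*\<^sub>C) cinner"
proof
  fix seq :: "nat \<Rightarrow> 'h"
  assume "\<And>n::nat. Re (cinner (seq (Suc n) + (-1) *\<^sub>C seq n) (seq (Suc n) + (-1) *\<^sub>C seq n)) \<le> (1/4)^n"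
  then have 1: "(norm (seq (Suc n) - seq n))\<^sup>2 \<le> (1/4)^n" for n by (simp add: Re_cinner_self)
  have "norm (seq (Suc n) - seq n) \<le> (1/2)^n" for n
  proof (rule power2_le_imp_le)
    have "(((1::real)/2)^n)\<^sup>2 = (1/4)^n" by (simp add: power2_eq_square flip: power_mult_distrib)
    then show "(norm (seq (Suc n) - seq n))\<^sup>2 \<le> ((1/2)^n)\<^sup>2" using 1[of n] by simp
  qed simp
  then obtain l where l: "seq \<longlonglongrightarrow> l"
    using geometric_cauchy_limit[of seq 1 "1/2"] by auto
  have "(\<lambda>n. (norm (seq n - l))\<^sup>2) \<longlonglongrightarrow> (norm (l - l))\<^sup>2"
    by (intro tendsto_intros l)
  then show "\<exists>l\<in>UNIV. (\<lambda>n. Re (cinner (seq n + (-1) *\<^sub>C l) (seq n + (-1) *\<^sub>C l))) \<longlonglongrightarrow> 0"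
    by (intro bexI[of _ l]) (simp_all add: Re_cinner_self)
qed (auto simp: cinner_add_left cinner_scaleC_left Re_cinner_self intro: cinner_commute)

interpretation H: semi_hilbert "UNIV :: 'h::chilbert_space set" "(+)" "(*\<^sub>C)" cinner
  by (rule semi_hilbert_H)

lemma H_sq [simp]: "H.sq (v::'h::chilbert_space) = (norm v)\<^sup>2"
  by (simp add: H.sq_def Re_cinner_self)

lemma norm_cinner_le: "cmod (cinner (u::'h::chilbert_space) v) \<le> norm u * norm v"
  using H.cauchy_schwarz[of u v] by (simp add: H.nrm_def)

lemma scaleR_scaleC: "r *\<^sub>R (v::'h::chilbert_space) = complex_of_real r *\<^sub>C v"
  by (simp add: scaleC_of_real)

lemma bounded_bilinear_cinner: "bounded_bilinear (cinner :: 'h::chilbert_space \<Rightarrow> _)"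
  by (rule bounded_bilinear.intro)
    (auto simp: cinner_add_left cinner_add_right scaleR_scaleC[where 'h='h] cinner_scaleC_left cinner_scaleC_right
      scaleR_conv_of_real intro!: exI[of _ 1] norm_cinner_le)

lemma bounded_bilinear_scaleC: "bounded_bilinear ((*\<^sub>C) :: complex \<Rightarrow> 'h::chilbert_space \<Rightarrow> _)"
  by (rule bounded_bilinear.intro)
    (auto simp: scaleC_add_left scaleC_add_right scaleR_scaleC[where 'h='h] scaleC_scaleC
      scaleR_conv_of_real mult.commute intro!: exI[of _ 1])

lemma borel_measurable_cinner [measurable (raw)]:
  fixes f g :: "'a \<Rightarrow> 'h::{chilbert_space, second_countable_topology}"
  assumes "f \<in> borel_measurable M" "g \<in> borel_measurable M"
  shows "(\<lambda>x. cinner (f x) (g x)) \<in> borel_measurable M"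
  by (rule borel_measurable_continuous_Pair[OF assms])
    (intro bounded_bilinear.continuous_on[OF bounded_bilinear_cinner] continuous_intros)

lemma borel_measurable_scaleC [measurable (raw)]:
  fixes g :: "'a \<Rightarrow> 'h::{chilbert_space, second_countable_topology}"
  assumes "f \<in> borel_measurable M" "g \<in> borel_measurable M"
  shows "(\<lambda>x. f x *\<^sub>C g x) \<in> borel_measurable M"
  by (rule borel_measurable_continuous_Pair[OF assms])
    (intro bounded_bilinear.continuous_on[OF bounded_bilinear_scaleC] continuous_intros)

lemma integral_cinner_left:
  fixes f :: "'a \<Rightarrow> 'h::{chilbert_space, second_countable_topology}"
  assumes "integrable M f"
  shows "(LINT x|M. cinner (f x) v) = cinner (LINT x|M. f x) v"
  using integral_bounded_linear[OF bounded_bilinear.bounded_linear_left[OF bounded_bilinear_cinner] assms] .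

lemma integrable_cinner_left:
  fixes f :: "'a \<Rightarrow> 'h::{chilbert_space, second_countable_topology}"
  assumes "integrable M f"
  shows "integrable M (\<lambda>x. cinner (f x) v)"
  using integrable_bounded_linear[OF bounded_bilinear.bounded_linear_left[OF bounded_bilinear_cinner] assms] .

lemma integrable_scaleC_right:
  fixes f :: "'a \<Rightarrow> 'h::{chilbert_space, second_countable_topology}"
  assumes "integrable M f"
  shows "integrable M (\<lambda>x. c *\<^sub>C f x)"
  using integrable_bounded_linear[OF bounded_bilinear.bounded_linear_right[OF bounded_bilinear_scaleC] assms] .

abbreviation basis_H :: "'h::chilbert_space set" where "basis_H \<equiv> some_onb UNIV cinner"

lemma basis_H: "is_onb UNIV cinner basis_H" by (rule H.some_onb)

lemma cinner_basis_H: "e \<in> basis_H \<Longrightarrow> e' \<in> basis_H \<Longrightarrow> cinner e e' = (if e = e' then 1 else 0)"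
  using basis_H unfolding is_onb_def by blast

text \<open>
  Distinct basis vectors have distance at least \<open>1\<close>, so the balls of radius \<open>1/2\<close> around
  them are disjoint open sets.
\<close>

lemma countable_basis_H: "countable (basis_H :: 'h::{chilbert_space, second_countable_topology} set)"
proof -
  let ?E = "basis_H :: 'h set"
  have dist: "dist e e' \<ge> 1" if "e \<in> ?E" "e' \<in> ?E" "e \<noteq> e'" for e e'
  proof (rule power2_le_imp_le)
    have "(norm (e - e'))\<^sup>2 = Re (cinner (e + (-1) *\<^sub>C e') (e + (-1) *\<^sub>C e'))"
      by (simp add: Re_cinner_self)
    also have "\<dots> = 2"
      unfolding cinner_add_left cinner_add_right cinner_scaleC_left cinner_scaleC_right
      using that by (simp add: cinner_basis_H)
    finally show "1\<^sup>2 \<le> (dist e e')\<^sup>2" by (simp add: dist_norm)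
  qed simp
  have "countable ((\<lambda>e. ball e (1/2)) ` ?E)"
  proof (rule countable_disjoint_open_subsets)
    show "pairwise disjnt ((\<lambda>e. ball e (1/2)) ` ?E)"
    proof (clarsimp simp: pairwise_def)
      fix e e' assume e: "e \<in> ?E" "e' \<in> ?E" "ball e (1/2) \<noteq> ball e' (1/2)"
      then have "dist e e' \<ge> 1" using dist by blast
      then show "disjnt (ball e (1/2)) (ball e' (1/2))" unfolding disjnt_def
        by (intro disjoint_ballI) simp
    qed
  qed auto
  moreover have "inj_on (\<lambda>e. ball e (1/2)) ?E"
  proof (rule inj_onI, rule ccontr)
    fix e e' assume e: "e \<in> ?E" "e' \<in> ?E" "ball e (1/2) = ball e' (1/2)" "e \<noteq> e'"
    then have "e \<in> ball e' (1/2)" by (metis centre_in_ball zero_less_divide_1_iff zero_less_numeral)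
    then show False using dist[OF e(1,2,4)] by (simp add: dist_commute)
  qed
  ultimately show ?thesis by (rule countable_image_inj_on)
qed

lemma parseval_norm_H:
  "ennreal ((norm (v::'h::chilbert_space))\<^sup>2) = (\<integral>\<^sup>+e. ennreal ((cmod (cinner v e))\<^sup>2) \<partial>count_space basis_H)"
  using H.parseval_sq[OF basis_H, of v] by simp

lemma hs_norm_sq_H_altdef:
  fixes A :: "'h::chilbert_space \<Rightarrow> 'h"
  shows "hs_norm_sq_H A = (\<integral>\<^sup>+e. ennreal ((norm (A e))\<^sup>2) \<partial>count_space basis_H)"
  unfolding hs_norm_sq_def infsum_ennreal_eq_nn_integral Re_cinner_self ..

lemma op_trace_H_altdef: "op_trace_H A = (LINT e|count_space basis_H. cinner (A e) e)"
  unfolding op_trace_def infsum_complex_eq_integral ..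

lemma bounded_clinear_add: "bounded_clinear A \<Longrightarrow> A (u + v) = A u + A v"
  and bounded_clinear_scaleC: "bounded_clinear A \<Longrightarrow> A (c *\<^sub>C u) = c *\<^sub>C A u"
  unfolding bounded_clinear_def by (auto simp: linear_simps)

lemma bounded_clinear_bounded_linear: "bounded_clinear A \<Longrightarrow> bounded_linear A"
  unfolding bounded_clinear_def by simp

lemma bounded_clinear_bounded_op:
  assumes A: "bounded_clinear (A :: 'h::chilbert_space \<Rightarrow> 'h)"
  shows "H.bounded_op A"
proof -
  obtain K where K: "\<And>v. norm (A v) \<le> norm v * K"
    using bounded_linear.bounded[OF bounded_clinear_bounded_linear[OF A]] by blast
  have "(norm (A v))\<^sup>2 \<le> K\<^sup>2 * (norm v)\<^sup>2" for v
    using power_mono[OF K[of v], of 2] by (simp add: power_mult_distrib mult.commute)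
  then show ?thesis unfolding H.bounded_op_def
    using A by (auto simp: bounded_clinear_add bounded_clinear_scaleC cinner_add_left cinner_scaleC_left)
qed

lemma bounded_clinear_comp: "bounded_clinear A \<Longrightarrow> bounded_clinear B \<Longrightarrow> bounded_clinear (A \<circ> B)"
  unfolding bounded_clinear_def comp_def by (auto intro: bounded_linear_compose)

lemma bounded_clinear_id: "bounded_clinear id"
  unfolding bounded_clinear_def id_def by (simp add: bounded_linear_ident)

lemma norm_sq_le_hs_norm_sq:
  "bounded_clinear A \<Longrightarrow> ennreal ((norm (A v))\<^sup>2) \<le> hs_norm_sq_H A * ennreal ((norm v)\<^sup>2)"
  using H.sq_le_hs_norm_sq[OF bounded_clinear_bounded_op, of A v] by simp

lemma hs_norm_sq_H_comp_le:
  assumes A: "bounded_clinear A"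
  shows "hs_norm_sq_H (A \<circ> B) \<le> hs_norm_sq_H A * hs_norm_sq_H B"
proof -
  have "hs_norm_sq_H (A \<circ> B) \<le> (\<integral>\<^sup>+e. hs_norm_sq_H A * ennreal ((norm (B e))\<^sup>2) \<partial>count_space basis_H)"
    unfolding hs_norm_sq_H_altdef[of "A \<circ> B"] o_apply
    by (intro nn_integral_mono norm_sq_le_hs_norm_sq A)
  also have "\<dots> = hs_norm_sq_H A * hs_norm_sq_H B"
    unfolding hs_norm_sq_H_altdef[of B] by (rule nn_integral_cmult) simp
  finally show ?thesis .
qed

lemma hs_norm_sq_H_scaleC:
  "hs_norm_sq_H (\<lambda>v. c *\<^sub>C A v) = ennreal ((cmod c)\<^sup>2) * hs_norm_sq_H A"
  unfolding hs_norm_sq_H_altdef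
  by (simp add: power_mult_distrib ennreal_mult nn_integral_cmult)

section \<open>Pointwise bounds and measurability for families of operators\<close>

text \<open>
  The Hilbert-Schmidt norm may be infinite where \<open>g\<close> vanishes. Estimates in \<open>ennreal\<close> with
  \<open>0 * \<infinity> = 0\<close> then hold at every point without exceptional sets.
\<close>

definition ennreal_sqrt :: "ennreal \<Rightarrow> ennreal" where
  "ennreal_sqrt a = (if a = \<infinity> then \<infinity> else ennreal (sqrt (enn2real a)))"

lemma ennreal_sqrt_power2 [simp]: "(ennreal_sqrt a)\<^sup>2 = a"
  by (cases a) (auto simp: ennreal_sqrt_def ennreal_power)

lemma borel_measurable_ennreal_sqrt [measurable (raw)]:
  assumes [measurable]: "f \<in> borel_measurable M"
  shows "(\<lambda>x. ennreal_sqrt (f x)) \<in> borel_measurable M"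
  unfolding ennreal_sqrt_def by measurable

lemma ennreal_le_if_power2_le:
  fixes a b :: ennreal
  assumes "a\<^sup>2 \<le> b\<^sup>2" shows "a \<le> b"
proof (rule ccontr)
  assume "\<not> a \<le> b"
  then have ba: "b < a" by simp
  then have bf: "b \<noteq> top" by auto
  have "b * b \<le> b * a" using ba by (intro mult_left_mono) auto
  moreover have "b * a < a * a"
  proof (cases a)
    case (real r)
    obtain s where s: "b = ennreal s" "0 \<le> s" using bf by (cases b) auto
    have "s < r" using ba real s by (simp add: ennreal_less_iff)
    then show ?thesis using real s
      by (simp flip: ennreal_mult add: ennreal_less_iff mult_strict_right_mono)
  next
    case top
    then show ?thesis using ba assms bf by (cases "b = 0") (auto simp: power2_eq_square top_unique ennreal_mult_eq_top_iff)
  qed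
  ultimately show False using assms unfolding power2_eq_square by simp
qed

lemma norm_le_hs_norm:
  assumes "bounded_clinear A"
  shows "ennreal (norm (A v)) \<le> ennreal_sqrt (hs_norm_sq_H A) * ennreal (norm v)"
  by (rule ennreal_le_if_power2_le)
    (use norm_sq_le_hs_norm_sq[OF assms, of v] in \<open>simp add: power_mult_distrib ennreal_power\<close>)

lemma nn_integral_trace_H_le:
  assumes "bounded_clinear A" "bounded_clinear B"
  shows "(\<integral>\<^sup>+e. ennreal (cmod (cinner (A (B e)) e)) \<partial>count_space basis_H)
      \<le> ennreal_sqrt (hs_norm_sq_H A) * ennreal_sqrt (hs_norm_sq_H B)"
  by (rule ennreal_le_if_power2_le)
    (use H.nn_integral_trace_le[OF bounded_clinear_bounded_op bounded_clinear_bounded_op basis_H, OF assms]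
      in \<open>simp add: power_mult_distrib\<close>)

lemma borel_measurable_pair_count_space:
  fixes f :: "_ \<Rightarrow> _ \<Rightarrow> 'b::topological_space"
  assumes I: "countable I" and f[measurable]: "\<And>i. i \<in> I \<Longrightarrow> f i \<in> borel_measurable M"
  shows "(\<lambda>(x, i). f i x) \<in> borel_measurable (M \<Otimes>\<^sub>M count_space I)"
  unfolding case_prod_beta
  by (rule measurable_compose_countable'[where f="\<lambda>i p. f i (fst p)" and g=snd and I=I])
    (use I in measurable)

lemma borel_measurable_nn_integral_count_space:
  assumes I: "countable I" and f: "\<And>i. i \<in> I \<Longrightarrow> f i \<in> borel_measurable M"
  shows "(\<lambda>x. \<integral>\<^sup>+i. f i x \<partial>count_space I) \<in> borel_measurable M"
proof -
  interpret sigma_finite_measure "count_space I" using I by (rule sigma_finite_measure_count_space_countable)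
  show ?thesis using borel_measurable_pair_count_space[OF I f]
    by (rule borel_measurable_nn_integral)
qed

lemma borel_measurable_integral_count_space:
  fixes f :: "_ \<Rightarrow> _ \<Rightarrow> complex"
  assumes I: "countable I" and f: "\<And>i. i \<in> I \<Longrightarrow> f i \<in> borel_measurable M"
  shows "(\<lambda>x. LINT i|count_space I. f i x) \<in> borel_measurable M"
proof -
  interpret sigma_finite_measure "count_space I" using I by (rule sigma_finite_measure_count_space_countable)
  show ?thesis using borel_measurable_pair_count_space[OF I f]
    by (rule borel_measurable_lebesgue_integral)
qed

lemma borel_measurable_hs_norm_sq_H:
  fixes A :: "'a \<Rightarrow> 'h \<Rightarrow> 'h::{chilbert_space, second_countable_topology}"
  assumes [measurable]: "\<And>v. (\<lambda>x. A x v) \<in> borel_measurable M"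
  shows "(\<lambda>x. hs_norm_sq_H (A x)) \<in> borel_measurable M"
  unfolding hs_norm_sq_H_altdef
  by (rule borel_measurable_nn_integral_count_space[OF countable_basis_H]) measurable

text \<open>
  Replace \<open>w\<close> by simple functions converging to it; each \<open>S x\<close> is continuous.
\<close>

lemma borel_measurable_apply_operator:
  fixes S :: "'f \<Rightarrow> 'h \<Rightarrow> 'h::{chilbert_space, second_countable_topology}"
  assumes S: "\<And>x. x \<in> space M \<Longrightarrow> bounded_clinear (S x)"
    and [measurable]: "\<And>v. (\<lambda>x. S x v) \<in> borel_measurable M"
    and X[measurable]: "X \<in> measurable N M" and w: "w \<in> borel_measurable N"
  shows "(\<lambda>y. S (X y) (w y)) \<in> borel_measurable N"
proof -
  obtain F where F: "\<And>i::nat. simple_function N (F i)"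
    and lim: "\<And>y. y \<in> space N \<Longrightarrow> (\<lambda>i. F i y) \<longlonglongrightarrow> w y"
    using borel_measurable_implies_sequence_metric[OF w, of 0] by blast
  show ?thesis
  proof (rule borel_measurable_LIMSEQ_metric)
    fix i
    have "F i \<in> measurable N (count_space (F i ` space N))"
      using measurable_simple_function[OF F[of i]]
      by (auto simp: measurable_def simple_functionD[OF F])
    moreover have "countable (F i ` space N)"
      using simple_functionD(1)[OF F[of i]] by (rule countable_finite)
    ultimately show "(\<lambda>y. S (X y) (F i y)) \<in> borel_measurable N"
      by (intro measurable_compose_countable'[where f="\<lambda>v y. S (X y) v" and g="F i"]) measurable
  next
    fix y assume y: "y \<in> space N"
    then have "X y \<in> space M" using X by (rule measurable_space[rotated])
    then show "(\<lambda>i. S (X y) (F i y)) \<longlonglongrightarrow> S (X y) (w y)"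
      using bounded_linear.tendsto[OF bounded_clinear_bounded_linear[OF S] lim[OF y]] by blast
  qed
qed

section \<open>Square-integrable functions with values in a Hilbert space\<close>

lemma borel_measurable_cnj [measurable (raw)]:
  "f \<in> borel_measurable M \<Longrightarrow> (\<lambda>x. cnj (f x)) \<in> borel_measurable M"
  by (rule measurable_compose[OF _ borel_measurable_continuous_onI[OF continuous_on_cnj[OF continuous_on_id]]])

lemma L2_iff_nn_integral:
  "f \<in> L2 M \<longleftrightarrow> f \<in> borel_measurable M \<and> (\<integral>\<^sup>+x. ennreal ((norm (f x))\<^sup>2) \<partial>M) < \<infinity>"
  unfolding L2_def by (auto simp: integrable_iff_bounded)

lemma L2_measurable [measurable_dest]: "f \<in> L2 M \<Longrightarrow> f \<in> borel_measurable M"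
  unfolding L2_def by simp

lemma L2_nn_integral_finite: "f \<in> L2 M \<Longrightarrow> (\<integral>\<^sup>+x. ennreal ((norm (f x))\<^sup>2) \<partial>M) < \<infinity>"
  unfolding L2_iff_nn_integral by simp

lemma L2_dominated:
  assumes f: "f \<in> L2 M" and g: "g \<in> borel_measurable M"
    and le: "AE x in M. norm (g x) \<le> C * norm (f x)"
  shows "g \<in> L2 M"
proof -
  note [measurable] = L2_measurable[OF f]
  have "(\<integral>\<^sup>+x. ennreal ((norm (g x))\<^sup>2) \<partial>M) \<le> (\<integral>\<^sup>+x. ennreal (C\<^sup>2) * ennreal ((norm (f x))\<^sup>2) \<partial>M)"
  proof (rule nn_integral_mono_AE)
    show "AE x in M. ennreal ((norm (g x))\<^sup>2) \<le> ennreal (C\<^sup>2) * ennreal ((norm (f x))\<^sup>2)"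
      using le
    proof eventually_elim
      case (elim x)
      then show ?case using power_mono[OF elim, of 2]
        by (auto simp: power_mult_distrib simp flip: ennreal_mult intro!: ennreal_leI)
    qed
  qed
  also have "\<dots> = ennreal (C\<^sup>2) * (\<integral>\<^sup>+x. ennreal ((norm (f x))\<^sup>2) \<partial>M)"
    by (intro nn_integral_cmult) measurable
  also have "\<dots> < \<infinity>" using L2_nn_integral_finite[OF f] by (simp add: ennreal_mult_less_top)
  finally show ?thesis using g unfolding L2_iff_nn_integral by simp
qed

lemma L2_add:
  fixes f g :: "'a \<Rightarrow> 'h::{chilbert_space, second_countable_topology}"
  assumes f: "f \<in> L2 M" and g: "g \<in> L2 M"
  shows "(\<lambda>x. f x + g x) \<in> L2 M"
proof -
  note [measurable] = L2_measurable[OF f] L2_measurable[OF g]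
  have "(\<integral>\<^sup>+x. ennreal ((norm (f x + g x))\<^sup>2) \<partial>M) \<le>
      (\<integral>\<^sup>+x. 2 * ennreal ((norm (f x))\<^sup>2) + 2 * ennreal ((norm (g x))\<^sup>2) \<partial>M)"
  proof (rule nn_integral_mono)
    fix x
    have "(norm (f x + g x))\<^sup>2 \<le> (norm (f x) + norm (g x))\<^sup>2"
      by (intro power_mono norm_triangle_ineq) simp
    also have "\<dots> \<le> 2 * (norm (f x))\<^sup>2 + 2 * (norm (g x))\<^sup>2"
      using sum_squares_bound[of "norm (f x)" "norm (g x)"] by (simp add: power2_sum)
    finally have "ennreal ((norm (f x + g x))\<^sup>2) \<le> ennreal (2 * (norm (f x))\<^sup>2 + 2 * (norm (g x))\<^sup>2)"
      by (rule ennreal_leI)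
    then show "ennreal ((norm (f x + g x))\<^sup>2) \<le> 2 * ennreal ((norm (f x))\<^sup>2) + 2 * ennreal ((norm (g x))\<^sup>2)"
      by (simp add: ennreal_mult)
  qed
  also have "\<dots> < \<infinity>"
    using L2_nn_integral_finite[OF f] L2_nn_integral_finite[OF g]
    by (subst nn_integral_add) (auto simp: nn_integral_cmult ennreal_mult_less_top)
  finally show ?thesis unfolding L2_iff_nn_integral by simp
qed

lemma L2_scaleC:
  fixes f :: "'a \<Rightarrow> 'h::{chilbert_space, second_countable_topology}"
  assumes f: "f \<in> L2 M" shows "(\<lambda>x. c *\<^sub>C f x) \<in> L2 M"
  by (rule L2_dominated[OF f, where C="cmod c"]) (use L2_measurable[OF f] in auto)

lemma L2_uminus:
  fixes f :: "'a \<Rightarrow> 'h::{chilbert_space, second_countable_topology}"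
  shows "f \<in> L2 M \<Longrightarrow> (\<lambda>x. - f x) \<in> L2 M"
  using L2_scaleC[of f M "-1"] by simp

lemma L2_diff:
  fixes f g :: "'a \<Rightarrow> 'h::{chilbert_space, second_countable_topology}"
  shows "f \<in> L2 M \<Longrightarrow> g \<in> L2 M \<Longrightarrow> (\<lambda>x. f x - g x) \<in> L2 M"
  using L2_add[of f M "\<lambda>x. - g x"] L2_uminus[of g M] by simp

lemma L2_zero: "(\<lambda>x. 0) \<in> L2 M"
  unfolding L2_iff_nn_integral by simp

lemma L2_product_integrable:
  assumes f: "f \<in> L2 M" and g: "g \<in> L2 M" and h: "h \<in> borel_measurable M"
    and le: "AE x in M. norm (h x) \<le> norm (f x) * norm (g x)"
  shows "integrable M (h :: _ \<Rightarrow> 'b::{banach, second_countable_topology})"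
proof (rule integrableI_bounded[OF h])
  note [measurable] = L2_measurable[OF f] L2_measurable[OF g]
  have "(\<integral>\<^sup>+x. ennreal (norm (h x)) \<partial>M) \<le> (\<integral>\<^sup>+x. ennreal ((norm (f x))\<^sup>2) + ennreal ((norm (g x))\<^sup>2) \<partial>M)"
  proof (rule nn_integral_mono_AE)
    show "AE x in M. ennreal (norm (h x)) \<le> ennreal ((norm (f x))\<^sup>2) + ennreal ((norm (g x))\<^sup>2)"
      using le
    proof eventually_elim
      case (elim x)
      have "2 * (norm (f x) * norm (g x)) \<le> (norm (f x))\<^sup>2 + (norm (g x))\<^sup>2"
        using sum_squares_bound[of "norm (f x)" "norm (g x)"] by simp
      moreover have "0 \<le> norm (f x) * norm (g x)" by (rule mult_nonneg_nonneg) auto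
      ultimately have "norm (h x) \<le> (norm (f x))\<^sup>2 + (norm (g x))\<^sup>2" using elim by linarith
      then show ?case by (simp flip: ennreal_plus)
    qed
  qed
  also have "\<dots> < \<infinity>"
    using L2_nn_integral_finite[OF f] L2_nn_integral_finite[OF g] by (subst nn_integral_add) auto
  finally show "(\<integral>\<^sup>+x. ennreal (norm (h x)) \<partial>M) < \<infinity>" .
qed

lemma L2_cinner_integrable:
  fixes f g :: "'a \<Rightarrow> 'h::{chilbert_space, second_countable_topology}"
  assumes f: "f \<in> L2 M" and g: "g \<in> L2 M"
  shows "integrable M (\<lambda>x. cinner (f x) (g x))"
  by (rule L2_product_integrable[OF f g]) (use L2_measurable[OF f] L2_measurable[OF g] norm_cinner_le in auto)

lemma L2_inner_self:
  fixes f :: "'a \<Rightarrow> 'h::{chilbert_space, second_countable_topology}"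
  shows "Re (L2_inner M f f) = (LINT x|M. (norm (f x))\<^sup>2)"
proof -
  have "L2_inner M f f = (LINT x|M. complex_of_real ((norm (f x))\<^sup>2))"
    unfolding L2_inner_def cinner_self ..
  also have "\<dots> = complex_of_real (LINT x|M. (norm (f x))\<^sup>2)" by (rule integral_complex_of_real)
  finally show ?thesis by simp
qed

lemma L2_inner_self_nonneg:
  fixes f :: "'a \<Rightarrow> 'h::{chilbert_space, second_countable_topology}"
  shows "0 \<le> Re (L2_inner M f f)"
  unfolding L2_inner_self by (rule integral_nonneg_AE) simp

lemma L2_norm_nn_integral:
  fixes f :: "'a \<Rightarrow> 'h::{chilbert_space, second_countable_topology}"
  assumes "f \<in> L2 M"
  shows "ennreal (Re (L2_inner M f f)) = (\<integral>\<^sup>+x. ennreal ((norm (f x))\<^sup>2) \<partial>M)"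
  unfolding L2_inner_self using assms unfolding L2_def by (intro nn_integral_eq_integral[symmetric]) auto

lemma L2_inner_cong_AE:
  fixes f g :: "'a \<Rightarrow> 'h::{chilbert_space, second_countable_topology}"
  assumes "f \<in> borel_measurable M" "f' \<in> borel_measurable M" "g \<in> borel_measurable M" "g' \<in> borel_measurable M"
    and "AE x in M. f x = f' x" "AE x in M. g x = g' x"
  shows "L2_inner M f g = L2_inner M f' g'"
  unfolding L2_inner_def
proof (rule integral_cong_AE)
  show "AE x in M. cinner (f x) (g x) = cinner (f' x) (g' x)" using assms(5,6) by eventually_elim simp
qed (use assms in measurable)

text \<open>
  The weighted series \<open>G\<close> of the squared increments has integral at most \<open>2\<close>, hence is finite
  almost everywhere. There the increments are bounded by a geometric sequence with factor
  \<open>sqrt (1/2)\<close>, and the squared distance to the limit is at most a multiple of \<open>(1/2)^n * G\<close>.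
\<close>

lemma L2_complete:
  fixes f :: "nat \<Rightarrow> 'a \<Rightarrow> 'h::{chilbert_space, second_countable_topology}"
  assumes f: "\<And>n. f n \<in> L2 M"
    and d: "\<And>n. (\<integral>\<^sup>+x. ennreal ((norm (f (Suc n) x - f n x))\<^sup>2) \<partial>M) \<le> ennreal ((1/4)^n)"
  shows "\<exists>l\<in>L2 M. (\<lambda>n. Re (L2_inner M (\<lambda>x. f n x - l x) (\<lambda>x. f n x - l x))) \<longlonglongrightarrow> 0"
proof -
  note [measurable] = L2_measurable[OF f]
  define G where "G x = (\<Sum>n. ennreal (2^n) * ennreal ((norm (f (Suc n) x - f n x))\<^sup>2))" for x
  have [measurable]: "G \<in> borel_measurable M" unfolding G_def by measurable
  have intG: "(\<integral>\<^sup>+x. G x \<partial>M) \<le> 2"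
  proof -
    have "(\<integral>\<^sup>+x. G x \<partial>M) = (\<Sum>n. ennreal (2^n) * (\<integral>\<^sup>+x. ennreal ((norm (f (Suc n) x - f n x))\<^sup>2) \<partial>M))"
      unfolding G_def by (simp add: nn_integral_suminf nn_integral_cmult)
    also have "\<dots> \<le> (\<Sum>n. ennreal ((1/2)^n))"
    proof (intro suminf_le allI)
      fix n
      have "ennreal (2^n) * (\<integral>\<^sup>+x. ennreal ((norm (f (Suc n) x - f n x))\<^sup>2) \<partial>M) \<le> ennreal (2^n) * ennreal ((1/4)^n)"
        by (intro mult_left_mono d) auto
      also have "\<dots> = ennreal ((2 * (1/4))^n)"
        unfolding power_mult_distrib by (simp add: ennreal_mult)
      finally show "ennreal (2^n) * (\<integral>\<^sup>+x. ennreal ((norm (f (Suc n) x - f n x))\<^sup>2) \<partial>M) \<le> ennreal ((1/2)^n)"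
        by simp
    qed auto
    also have "\<dots> = ennreal (\<Sum>n. (1/2)^n)"
      by (rule suminf_ennreal2) (auto intro: summable_geometric)
    also have "\<dots> = 2" by (simp add: suminf_geometric)
    finally show ?thesis .
  qed
  then have "(\<integral>\<^sup>+x. G x \<partial>M) \<noteq> \<infinity>" by (auto simp: top_unique)
  then have Gfin: "AE x in M. G x \<noteq> \<infinity>" by (intro nn_integral_PInf_AE) auto
  define l where "l x = lim (\<lambda>n. f n x)" for x
  have [measurable]: "l \<in> borel_measurable M" unfolding l_def by measurable
  \<comment> \<open>the increments decrease like \<open>r^n\<close>, because \<open>2^n\<close> times their squares is bounded by \<open>G\<close>\<close>
  define r :: real where "r = sqrt (1/2)"
  have r: "0 \<le> r" "r < 1" by (auto simp: r_def real_sqrt_less_iff[of _ 1, simplified])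
  have r2: "(r^n)\<^sup>2 = (1/2)^n" for n
  proof -
    have "(r^n)\<^sup>2 = (r\<^sup>2)^n" by (simp add: power_mult[symmetric] mult.commute)
    then show ?thesis by (simp add: r_def)
  qed
  define C where "C = 1 / (1 - r)\<^sup>2"
  have C: "0 \<le> C" by (simp add: C_def)
  have close: "AE x in M. \<forall>n. ennreal ((norm (f n x - l x))\<^sup>2) \<le> ennreal (C * (1/2)^n) * G x"
    using Gfin
  proof eventually_elim
    case (elim x)
    define K where "K = sqrt (enn2real (G x))"
    have K: "ennreal (K\<^sup>2) = G x" using elim by (simp add: K_def less_top)
    have "norm (f (Suc n) x - f n x) \<le> K * r ^ n" for n
    proof (rule power2_le_imp_le)
      have "ennreal (2^n) * ennreal ((norm (f (Suc n) x - f n x))\<^sup>2) \<le> G x"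
        unfolding G_def using sum_le_suminf[of "\<lambda>n. ennreal (2^n) * ennreal ((norm (f (Suc n) x - f n x))\<^sup>2)" "{n}"] by simp
      then have "ennreal (2^n * (norm (f (Suc n) x - f n x))\<^sup>2) \<le> ennreal (K\<^sup>2)"
        unfolding K by (simp add: ennreal_mult)
      then have "2^n * (norm (f (Suc n) x - f n x))\<^sup>2 \<le> K\<^sup>2" by (simp add: ennreal_le_iff)
      then show "(norm (f (Suc n) x - f n x))\<^sup>2 \<le> (K * r ^ n)\<^sup>2"
        unfolding power_mult_distrib r2 by (simp add: field_simps power_one_over)
    qed (use r in \<open>simp add: K_def\<close>)
    then obtain z where z: "(\<lambda>n. f n x) \<longlonglongrightarrow> z" "\<And>n. norm (f n x - z) \<le> K * r ^ n / (1 - r)"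
      using geometric_cauchy_limit[OF _ r, of "\<lambda>n. f n x" K] by blast
    have lz: "l x = z" unfolding l_def by (rule limI[OF z(1)])
    show ?case
    proof
      fix n
      have "(norm (f n x - l x))\<^sup>2 \<le> (K * r ^ n / (1 - r))\<^sup>2"
        unfolding lz by (intro power_mono z(2)) simp
      also have "\<dots> = (C * (1/2)^n) * K\<^sup>2"
        unfolding power_mult_distrib power_divide r2 C_def by simp
      finally have "ennreal ((norm (f n x - l x))\<^sup>2) \<le> ennreal ((C * (1/2)^n) * K\<^sup>2)" by (rule ennreal_leI)
      also have "\<dots> = ennreal (C * (1/2)^n) * G x" unfolding K[symmetric] using C by (intro ennreal_mult) auto
      finally show "ennreal ((norm (f n x - l x))\<^sup>2) \<le> ennreal (C * (1/2)^n) * G x" .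
    qed
  qed
  have kernel_bound: "(\<integral>\<^sup>+x. ennreal ((norm (f n x - l x))\<^sup>2) \<partial>M) \<le> ennreal (2 * C * (1/2)^n)" for n
  proof -
    have "(\<integral>\<^sup>+x. ennreal ((norm (f n x - l x))\<^sup>2) \<partial>M) \<le> (\<integral>\<^sup>+x. ennreal (C * (1/2)^n) * G x \<partial>M)"
      by (rule nn_integral_mono_AE) (use close in auto)
    also have "\<dots> = ennreal (C * (1/2)^n) * (\<integral>\<^sup>+x. G x \<partial>M)" by (rule nn_integral_cmult) simp
    also have "\<dots> \<le> ennreal (C * (1/2)^n) * ennreal 2" using intG by (intro mult_left_mono) auto
    also have "\<dots> = ennreal (2 * C * (1/2)^n)" 
      using C by (subst ennreal_mult[symmetric]) (auto simp: mult_ac)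
    finally show ?thesis .
  qed
  have dl: "(\<lambda>x. f n x - l x) \<in> L2 M" for n
    unfolding L2_iff_nn_integral using le_less_trans[OF kernel_bound[of n] ennreal_less_top] by simp
  have "(\<lambda>x. f 0 x - (f 0 x - l x)) \<in> L2 M" by (rule L2_diff[OF f dl])
  then have l: "l \<in> L2 M" by simp
  have "(\<lambda>n. Re (L2_inner M (\<lambda>x. f n x - l x) (\<lambda>x. f n x - l x))) \<longlonglongrightarrow> 0"
  proof (rule tendsto_sandwich)
    show "\<forall>\<^sub>F n in sequentially. 0 \<le> Re (L2_inner M (\<lambda>x. f n x - l x) (\<lambda>x. f n x - l x))"
      by (simp add: L2_inner_self_nonneg)
    have "Re (L2_inner M (\<lambda>x. f n x - l x) (\<lambda>x. f n x - l x)) \<le> 2 * C * (1/2)^n" for n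
      using kernel_bound[of n] C unfolding L2_norm_nn_integral[OF dl, symmetric] by (simp add: ennreal_le_iff)
    then show "\<forall>\<^sub>F n in sequentially. Re (L2_inner M (\<lambda>x. f n x - l x) (\<lambda>x. f n x - l x)) \<le> 2 * C * (1/2)^n"
      by simp
    have "(\<lambda>n. 2 * C * (1/2)^n) \<longlonglongrightarrow> 2 * C * 0" by (intro tendsto_intros LIMSEQ_realpow_zero) auto
    then show "(\<lambda>n. 2 * C * (1/2)^n) \<longlonglongrightarrow> 0" by simp
  qed simp
  then show ?thesis using l by blast
qed

lemma semi_hilbert_L2:
  "semi_hilbert (L2 M :: ('a \<Rightarrow> 'h::{chilbert_space, second_countable_topology}) set)
     (\<lambda>f g x. f x + g x) (\<lambda>c f x. c *\<^sub>C f x) (L2_inner M)"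
proof
  fix u v w :: "'a \<Rightarrow> 'h" and c :: complex
  show "L2 M \<noteq> ({} :: ('a \<Rightarrow> 'h) set)" using L2_zero by blast
  assume u: "u \<in> L2 M"
  then show "(\<lambda>x. c *\<^sub>C u x) \<in> L2 M" by (rule L2_scaleC)
  show "0 \<le> Re (L2_inner M u u)" by (rule L2_inner_self_nonneg)
  assume w: "w \<in> L2 M"
  then show "(\<lambda>x. u x + w x) \<in> L2 M" by (rule L2_add[OF u])
  show "L2_inner M (\<lambda>x. c *\<^sub>C u x) w = c * L2_inner M u w"
    unfolding L2_inner_def cinner_scaleC_left by simp
  show "L2_inner M u w = cnj (L2_inner M w u)"
  proof -
    have "L2_inner M u w = (LINT x|M. cnj (cinner (w x) (u x)))"
      unfolding L2_inner_def by (intro Bochner_Integration.integral_cong refl) (rule cinner_commute)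
    also have "\<dots> = cnj (L2_inner M w u)" unfolding L2_inner_def
      by (rule integral_bounded_linear[OF bounded_linear_cnj L2_cinner_integrable[OF w u]])
    finally show ?thesis .
  qed
  assume v: "v \<in> L2 M"
  show "L2_inner M (\<lambda>x. u x + v x) w = L2_inner M u w + L2_inner M v w"
    unfolding L2_inner_def cinner_add_left
    by (rule Bochner_Integration.integral_add[OF L2_cinner_integrable[OF u w] L2_cinner_integrable[OF v w]])
next
  fix seq :: "nat \<Rightarrow> 'a \<Rightarrow> 'h"
  assume seq: "\<And>n. seq n \<in> L2 M"
    and le: "\<And>n. Re (L2_inner M (\<lambda>x. seq (Suc n) x + (-1) *\<^sub>C seq n x) (\<lambda>x. seq (Suc n) x + (-1) *\<^sub>C seq n x)) \<le> (1/4)^n"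
  have "\<exists>l\<in>L2 M. (\<lambda>n. Re (L2_inner M (\<lambda>x. seq n x - l x) (\<lambda>x. seq n x - l x))) \<longlonglongrightarrow> 0"
  proof (rule L2_complete[OF seq])
    fix n
    show "(\<integral>\<^sup>+x. ennreal ((norm (seq (Suc n) x - seq n x))\<^sup>2) \<partial>M) \<le> ennreal ((1/4)^n)"
      using ennreal_leI[OF le[of n]] unfolding L2_norm_nn_integral[OF L2_diff[OF seq seq], symmetric] by simp
  qed
  then show "\<exists>l\<in>L2 M. (\<lambda>n. Re (L2_inner M (\<lambda>x. seq n x + (-1) *\<^sub>C l x) (\<lambda>x. seq n x + (-1) *\<^sub>C l x))) \<longlonglongrightarrow> 0"
    by simp
qed

interpretation L2: semi_hilbert "L2 M :: ('a \<Rightarrow> 'h::{chilbert_space, second_countable_topology}) set"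
  "\<lambda>f g x. f x + g x" "\<lambda>c f x. c *\<^sub>C f x" "L2_inner M" for M :: "'a measure"
  by (rule semi_hilbert_L2)

abbreviation L2_bounded_op :: "'a measure \<Rightarrow> (('a \<Rightarrow> 'h) \<Rightarrow> ('a \<Rightarrow> 'h::{chilbert_space, second_countable_topology})) \<Rightarrow> bool" where
  "L2_bounded_op M \<equiv> semi_hilbert.bounded_op (L2 M) (\<lambda>f g x. f x + g x) (\<lambda>c f x. c *\<^sub>C f x) (L2_inner M)"

abbreviation L2_functional :: "'a measure \<Rightarrow> (('a \<Rightarrow> 'h::{chilbert_space, second_countable_topology}) \<Rightarrow> complex) \<Rightarrow> bool" where
  "L2_functional M \<equiv> semi_hilbert.functional (L2 M) (\<lambda>f g x. f x + g x) (\<lambda>c f x. c *\<^sub>C f x) (L2_inner M)"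

lemma L2_zero_AE:
  fixes f :: "'a \<Rightarrow> 'h::{chilbert_space, second_countable_topology}"
  assumes f: "f \<in> L2 M" and z: "Re (L2_inner M f f) = 0"
  shows "AE x in M. f x = 0"
proof -
  note [measurable] = L2_measurable[OF f]
  have "(\<integral>\<^sup>+x. ennreal ((norm (f x))\<^sup>2) \<partial>M) = 0"
    using L2_norm_nn_integral[OF f] z by simp
  then have "AE x in M. ennreal ((norm (f x))\<^sup>2) = 0" by (subst (asm) nn_integral_0_iff_AE) auto
  then show ?thesis by eventually_elim simp
qed

lemma L2_eq_AE_if_inner_eq:
  fixes f g :: "'a \<Rightarrow> 'h::{chilbert_space, second_countable_topology}"
  assumes f: "f \<in> L2 M" and g: "g \<in> L2 M" and eq: "\<And>h. h \<in> L2 M \<Longrightarrow> L2_inner M f h = L2_inner M g h"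
  shows "AE x in M. f x = g x"
proof -
  have d: "(\<lambda>x. f x - g x) \<in> L2 M" by (rule L2_diff[OF f g])
  have "L2_inner M (\<lambda>x. f x + (-1) *\<^sub>C g x) (\<lambda>x. f x - g x) = 0"
    using L2.ip_diff[OF f g d] eq[OF d] unfolding L2.diff_def by simp
  then have "Re (L2_inner M (\<lambda>x. f x - g x) (\<lambda>x. f x - g x)) = 0" by simp
  from L2_zero_AE[OF d this] show ?thesis by simp
qed

lemma L2_operator_bounded_op:
  fixes T :: "('a \<Rightarrow> 'h) \<Rightarrow> ('a \<Rightarrow> 'h::{chilbert_space, second_countable_topology})"
  assumes T: "L2_operator M T"
  shows "L2_bounded_op M T"
  unfolding L2.bounded_op_def
proof (intro conjI ballI allI)
  show cl: "T v \<in> L2 M" if "v \<in> L2 M" for v using T that unfolding L2_operator_def by blast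
  fix u v w :: "'a \<Rightarrow> 'h" and c
  assume u: "u \<in> L2 M" and w: "w \<in> L2 M"
  have "L2_inner M (T (\<lambda>x. c *\<^sub>C u x)) w = L2_inner M (\<lambda>x. c *\<^sub>C T u x) w"
  proof (rule L2_inner_cong_AE)
    show "AE x in M. T (\<lambda>x. c *\<^sub>C u x) x = c *\<^sub>C T u x"
      using T u unfolding L2_operator_def by blast
  qed (intro L2_measurable cl w u L2_scaleC AE_I2 refl)+
  then show "L2_inner M (T (\<lambda>x. c *\<^sub>C u x)) w = c * L2_inner M (T u) w"
    using L2.ip_scale[OF cl[OF u] w] by simp
  assume v: "v \<in> L2 M"
  have "L2_inner M (T (\<lambda>x. u x + v x)) w = L2_inner M (\<lambda>x. T u x + T v x) w"
  proof (rule L2_inner_cong_AE)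
    show "AE x in M. T (\<lambda>x. u x + v x) x = T u x + T v x"
      using T u v unfolding L2_operator_def by blast
  qed (intro L2_measurable cl w u v L2_add AE_I2 refl)+
  then show "L2_inner M (T (\<lambda>x. u x + v x)) w = L2_inner M (T u) w + L2_inner M (T v) w"
    using L2.ip_add[OF cl[OF u] cl[OF v] w] by simp
next
  show "\<exists>C. \<forall>v\<in>L2 M. L2.sq M (T v) \<le> C * L2.sq M v"
    using T unfolding L2_operator_def L2.sq_def by blast
qed

lemma tensor_L2:
  fixes v :: "'h::{chilbert_space, second_countable_topology}"
  assumes f: "f \<in> L2 M" shows "tensor f v \<in> L2 M"
  unfolding tensor_def
  by (rule L2_dominated[OF f, where C="norm v"]) (use L2_measurable[OF f] in \<open>auto simp: mult.commute\<close>)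

lemma cinner_component_L2:
  fixes f :: "'a \<Rightarrow> 'h::{chilbert_space, second_countable_topology}"
  assumes f: "f \<in> L2 M" shows "(\<lambda>x. cinner (f x) v) \<in> L2 M"
proof (rule L2_dominated[OF f, where C="norm v"])
  show "AE x in M. cmod (cinner (f x) v) \<le> norm v * norm (f x)"
  proof (rule AE_I2)
    fix x show "cmod (cinner (f x) v) \<le> norm v * norm (f x)"
      using norm_cinner_le[of "f x" v] by (simp add: mult.commute)
  qed
qed (use L2_measurable[OF f] in measurable)

lemma L2_inner_tensor:
  "L2_inner M (tensor f u) (tensor g v) = L2_inner M f g * cinner u v"
  unfolding L2_inner_def tensor_def cinner_scaleC_left cinner_scaleC_right cinner_complex_def
  by (simp add: mult_ac flip: integral_mult_right_zero)

lemma L2_inner_tensor_right: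
  fixes f :: "'a \<Rightarrow> 'h::{chilbert_space, second_countable_topology}"
  shows "L2_inner M f (tensor a v) = L2_inner M (\<lambda>x. cinner (f x) v) a"
  unfolding L2_inner_def tensor_def cinner_scaleC_right cinner_complex_def by (simp add: mult.commute)

text \<open>
  For an orthonormal basis \<open>A\<close> of \<open>L\<^sup>2(M)\<close> this is one of \<open>L\<^sup>2(M; 'h)\<close>.
\<close>

definition tensor_basis :: "('a \<Rightarrow> complex) set \<Rightarrow> ('a \<Rightarrow> 'h::{chilbert_space, second_countable_topology}) set" where
  "tensor_basis A = (\<lambda>(a, e). tensor a e) ` (A \<times> basis_H)"

lemma tensor_inj_on:
  assumes A: "is_onb (L2 M) (L2_inner M) A"
  shows "inj_on (\<lambda>(a, e). tensor a e) (A \<times> (basis_H :: 'h::{chilbert_space, second_countable_topology} set))"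
proof (rule inj_onI, clarify)
  fix a b and e e' :: 'h
  assume "a \<in> A" "b \<in> A" "e \<in> basis_H" "e' \<in> basis_H" and eq: "tensor a e = tensor b e'"
  then have "L2_inner M (tensor a e) (tensor a e) = 1"
    using A by (simp add: L2_inner_tensor is_onb_def cinner_basis_H)
  then have "L2_inner M (tensor a e) (tensor b e') = 1" using eq by simp
  then have "L2_inner M a b * cinner e e' \<noteq> 0" by (simp add: L2_inner_tensor)
  then show "a = b \<and> e = e'"
    using A \<open>a \<in> A\<close> \<open>b \<in> A\<close> \<open>e \<in> basis_H\<close> \<open>e' \<in> basis_H\<close>
    by (auto simp: is_onb_def cinner_basis_H split: if_splits)
qed

text \<open>
  If \<open>v\<close> is orthogonal to all tensors, its components in the countable basis of \<open>'h\<close> vanish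
  almost everywhere, since each is orthogonal to \<open>A\<close>.
\<close>

lemma tensor_basis_onb:
  assumes A: "is_onb (L2 M) (L2_inner M) A"
  shows "is_onb (L2 M) (L2_inner M) (tensor_basis A :: ('a \<Rightarrow> 'h::{chilbert_space, second_countable_topology}) set)"
  unfolding is_onb_def
proof (intro conjI ballI impI)
  have AL: "A \<subseteq> L2 M" using A unfolding is_onb_def by blast
  then show "tensor_basis A \<subseteq> (L2 M :: ('a \<Rightarrow> 'h) set)" unfolding tensor_basis_def by (auto intro: tensor_L2)
  fix b b' :: "'a \<Rightarrow> 'h" assume "b \<in> tensor_basis A" "b' \<in> tensor_basis A"
  then obtain a e a' e' where b: "b = tensor a e" "b' = tensor a' e'" "a \<in> A" "a' \<in> A" "e \<in> basis_H" "e' \<in> basis_H"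
    unfolding tensor_basis_def by auto
  have "tensor a e = tensor a' e' \<longleftrightarrow> a = a' \<and> e = e'"
    using inj_onD[OF tensor_inj_on[OF A, where 'h='h], of "(a, e)" "(a', e')"] b by auto
  then show "L2_inner M b b' = (if b = b' then 1 else 0)"
    using A b by (auto simp: L2_inner_tensor is_onb_def cinner_basis_H)
next
  fix v :: "'a \<Rightarrow> 'h" assume v: "v \<in> L2 M" and orth: "\<forall>b\<in>tensor_basis A. L2_inner M v b = 0"
  note [measurable] = L2_measurable[OF v]
  have comp: "(\<integral>\<^sup>+x. ennreal ((cmod (cinner (v x) e))\<^sup>2) \<partial>M) = 0" if e: "e \<in> basis_H" for e
  proof -
    have "L2_inner M (\<lambda>x. cinner (v x) e) a = 0" if "a \<in> A" for a
      using orth e that unfolding tensor_basis_def by (auto simp: L2_inner_tensor_right)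
    then have "L2_inner M (\<lambda>x. cinner (v x) e) (\<lambda>x. cinner (v x) e) = 0"
      using A cinner_component_L2[OF v] unfolding is_onb_def by blast
    then show ?thesis
      using L2_norm_nn_integral[OF cinner_component_L2[OF v], of e] by simp
  qed
  have "(\<integral>\<^sup>+x. ennreal ((norm (v x))\<^sup>2) \<partial>M) =
      (\<integral>\<^sup>+e. \<integral>\<^sup>+x. ennreal ((cmod (cinner (v x) e))\<^sup>2) \<partial>M \<partial>count_space basis_H)"
    by (subst nn_integral_count_space_nn_integral[OF countable_basis_H, symmetric], measurable)
      (intro nn_integral_cong parseval_norm_H)
  also have "\<dots> = (\<integral>\<^sup>+e. 0 \<partial>count_space (basis_H :: 'h set))"
    by (intro nn_integral_cong) (simp add: comp)
  finally have "ennreal (Re (L2_inner M v v)) = 0" using L2_norm_nn_integral[OF v] by simp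
  then have "L2.sq M v = 0" using L2_inner_self_nonneg[of M v] unfolding L2.sq_def by simp
  then show "L2_inner M v v = 0" using L2.ip_self[OF v] by simp
qed

section \<open>Integral operators determine their kernels\<close>

lemma (in semi_hilbert) functional_eq_if_eq_on_onb:
  assumes B: "is_onb V ip B" and l: "functional l" "functional l'"
    and eq: "\<And>b. b \<in> B \<Longrightarrow> l b = l' b" and v: "v \<in> V"
  shows "l v = l' v"
proof -
  have "((\<lambda>b. ip v b * l b) has_sum l v) B" by (rule functional_expansion[OF B v l(1)])
  moreover have "((\<lambda>b. ip v b * l b) has_sum l' v) B"
    using functional_expansion[OF B v l(2)] by (rule has_sum_cong[THEN iffD1, rotated]) (simp add: eq)
  ultimately show ?thesis by (rule has_sum_unique)
qed

lemma L2_eq_AE_if_eq_on_onb: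
  fixes f g :: "'a \<Rightarrow> 'h::{chilbert_space, second_countable_topology}"
  assumes A: "is_onb (L2 M) (L2_inner M) A" and f: "f \<in> L2 M" and g: "g \<in> L2 M"
    and eq: "\<And>a. a \<in> A \<Longrightarrow> L2_inner M f a = L2_inner M g a"
  shows "AE x in M. f x = g x"
proof -
  have AL: "A \<subseteq> L2 M" by (rule L2.onb_subset[OF A])
  have d: "(\<lambda>x. f x - g x) \<in> L2 M" by (rule L2_diff[OF f g])
  have "L2_inner M (\<lambda>x. f x - g x) a = 0" if "a \<in> A" for a
    using L2.ip_diff[OF f g, of a] eq[OF that] AL that unfolding L2.diff_def by auto
  then have "L2_inner M (\<lambda>x. f x - g x) (\<lambda>x. f x - g x) = 0"
    using A d unfolding is_onb_def by blast
  then have "Re (L2_inner M (\<lambda>x. f x - g x) (\<lambda>x. f x - g x)) = 0" by simp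
  from L2_zero_AE[OF d this] show ?thesis by simp
qed

lemma AE_zero_if_set_integrals_zero:
  fixes f :: "'a \<Rightarrow> real"
  assumes f: "integrable N f" and z: "\<And>C. C \<in> sets N \<Longrightarrow> (LINT x:C|N. f x) = 0"
  shows "AE x in N. f x = 0"
proof -
  note [measurable] = borel_measurable_integrable[OF f]
  have pos: "AE x in N. indicator {x\<in>space N. P (f x)} x *\<^sub>R f x = 0"
    if P[measurable]: "Measurable.pred borel P" and sgn: "(\<forall>y. P y \<longrightarrow> 0 \<le> y) \<or> (\<forall>y. P y \<longrightarrow> y \<le> 0)" for P
  proof -
    let ?C = "{x\<in>space N. P (f x)}"
    have int: "integrable N (\<lambda>x. indicator ?C x *\<^sub>R f x)"
      by (intro integrable_mult_indicator f) measurable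
    have z': "(LINT x|N. indicator ?C x *\<^sub>R f x) = 0"
      using z[of ?C] unfolding set_lebesgue_integral_def by simp
    from sgn show ?thesis
    proof
      assume "\<forall>y. P y \<longrightarrow> 0 \<le> y"
      then have "AE x in N. 0 \<le> indicator ?C x *\<^sub>R f x" by (auto simp: indicator_def)
      then show ?thesis using integral_nonneg_eq_0_iff_AE[OF int] z' by simp
    next
      assume "\<forall>y. P y \<longrightarrow> y \<le> 0"
      then have "AE x in N. 0 \<le> - (indicator ?C x *\<^sub>R f x)" by (auto simp: indicator_def)
      then have "AE x in N. - (indicator ?C x *\<^sub>R f x) = 0"
        using integral_nonneg_eq_0_iff_AE[OF Bochner_Integration.integrable_minus[OF int]] z' by simp
      then show ?thesis by eventually_elim simp
    qed
  qed
  have p: "AE x in N. indicator {x\<in>space N. (\<lambda>y. y > 0) (f x)} x *\<^sub>R f x = 0"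
    by (rule pos) auto
  have n: "AE x in N. indicator {x\<in>space N. (\<lambda>y. y < 0) (f x)} x *\<^sub>R f x = 0"
    by (rule pos) auto
  show ?thesis using p n AE_space
    by eventually_elim (auto simp: indicator_def split: if_splits)
qed

lemma AE_zero_if_complex_set_integrals_zero:
  fixes f :: "'a \<Rightarrow> complex"
  assumes f: "integrable N f" and z: "\<And>C. C \<in> sets N \<Longrightarrow> (LINT x:C|N. f x) = 0"
  shows "AE x in N. f x = 0"
proof -
  have int: "integrable N (\<lambda>x. indicator C x *\<^sub>R f x)" if "C \<in> sets N" for C
    by (rule integrable_mult_indicator[OF that f])
  have re: "(LINT x:C|N. Re (f x)) = 0" and im: "(LINT x:C|N. Im (f x)) = 0" if C: "C \<in> sets N" for C
    using integral_Re[OF int[OF C]] integral_Im[OF int[OF C]] z[OF C]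
    unfolding set_lebesgue_integral_def by simp_all
  have "AE x in N. Re (f x) = 0" "AE x in N. Im (f x) = 0"
    using AE_zero_if_set_integrals_zero[OF integrable_Re[OF f] re]
      AE_zero_if_set_integrals_zero[OF integrable_Im[OF f] im] by auto
  then show ?thesis by eventually_elim (simp add: complex_eq_iff)
qed

text \<open>
  The sets over which the integral vanishes form a Dynkin system that contains the rectangles.
\<close>

lemma AE_zero_if_rectangle_integrals_zero:
  fixes W :: "'a \<times> 'b \<Rightarrow> complex"
  assumes W: "integrable (M \<Otimes>\<^sub>M N) W"
    and rect: "\<And>A B. A \<in> sets M \<Longrightarrow> B \<in> sets N \<Longrightarrow> (LINT z:A \<times> B|M \<Otimes>\<^sub>M N. W z) = 0"
  shows "AE z in M \<Otimes>\<^sub>M N. W z = 0"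
proof (rule AE_zero_if_complex_set_integrals_zero[OF W])
  let ?G = "{a \<times> b |a b. a \<in> sets M \<and> b \<in> sets N}"
  fix C assume "C \<in> sets (M \<Otimes>\<^sub>M N)"
  then have C: "C \<in> sigma_sets (space M \<times> space N) ?G" unfolding sets_pair_measure .
  have G: "?G \<subseteq> Pow (space M \<times> space N)" by (rule pair_measure_closed)
  from Int_stable_pair_measure_generator G C show "(LINT z:C|M \<Otimes>\<^sub>M N. W z) = 0"
  proof (induction C rule: sigma_sets_induct_disjoint)
    case (basic A)
    then show ?case using rect by auto
  next
    case empty
    show ?case by (simp add: set_lebesgue_integral_def)
  next
    case (compl A)
    then have A: "A \<in> sets (M \<Otimes>\<^sub>M N)" unfolding sets_pair_measure by simp
    have "(LINT z:space M \<times> space N - A|M \<Otimes>\<^sub>M N. W z) = (LINT z:space M \<times> space N|M \<Otimes>\<^sub>M N. W z) - (LINT z:A|M \<Otimes>\<^sub>M N. W z)"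
      unfolding set_lebesgue_integral_def
    proof (subst Bochner_Integration.integral_diff[symmetric])
      show "integrable (M \<Otimes>\<^sub>M N) (\<lambda>z. indicator (space M \<times> space N) z *\<^sub>R W z)"
        by (intro integrable_mult_indicator W) auto
      show "integrable (M \<Otimes>\<^sub>M N) (\<lambda>z. indicator A z *\<^sub>R W z)"
        by (intro integrable_mult_indicator W A)
      show "integral\<^sup>L (M \<Otimes>\<^sub>M N) (\<lambda>z. indicator (space M \<times> space N - A) z *\<^sub>R W z) =
          integral\<^sup>L (M \<Otimes>\<^sub>M N) (\<lambda>z. indicator (space M \<times> space N) z *\<^sub>R W z - indicator A z *\<^sub>R W z)"
        using sets.sets_into_space[OF A]
        by (intro Bochner_Integration.integral_cong refl) (auto simp: indicator_def space_pair_measure)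
    qed
    then show ?case using compl.IH rect[of "space M" "space N"] by simp
  next
    case (union A)
    then have A: "A i \<in> sets (M \<Otimes>\<^sub>M N)" for i unfolding sets_pair_measure by auto
    have "(LINT z:(\<Union>i. A i)|M \<Otimes>\<^sub>M N. W z) = (\<Sum>i. (LINT z:A i|M \<Otimes>\<^sub>M N. W z))"
    proof (rule lebesgue_integral_countable_add[OF A])
      show "A i \<inter> A j = {}" if "i \<noteq> j" for i j
        using union(1) that unfolding disjoint_family_on_def by auto
      show "set_integrable (M \<Otimes>\<^sub>M N) (\<Union>i. A i) W"
        unfolding set_integrable_def using A by (intro integrable_mult_indicator W) auto
    qed
    then show ?case using union.IH by simp
  qed
qed

context sigma_finite_measure
begin

interpretation MM: pair_sigma_finite M M ..

text \<open>
  The exceptional set of \<open>s\<close> depends on \<open>f\<close>, so \<open>w\<close> cannot be tested pointwise in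
  \<open>s\<close>. Instead multiply \<open>w\<close> by positive functions \<open>f0 x\<close> and \<open>u s\<close> that make it
  integrable on the product. For \<open>f = f0\<close> restricted to \<open>A\<close>, the hypothesis says that the
  integrals over all rectangles \<open>A \<times> B\<close> vanish.
\<close>

lemma AE_zero_kernel_if_integrals_zero:
  fixes w :: "'a \<Rightarrow> 'a \<Rightarrow> complex"
  assumes w[measurable]: "(\<lambda>(x, s). w x s) \<in> borel_measurable (M \<Otimes>\<^sub>M M)"
    and z: "\<And>f. f \<in> L2 M \<Longrightarrow> AE s in M. integrable M (\<lambda>x. f x * w x s) \<and> (LINT x|M. f x * w x s) = 0"
  shows "AE p in M \<Otimes>\<^sub>M M. w (fst p) (snd p) = 0"
proof -
  obtain h where h[measurable]: "h \<in> borel_measurable M" and hint: "integral\<^sup>N M h \<noteq> \<infinity>"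
    and hpos: "\<And>x. x \<in> space M \<Longrightarrow> 0 < h x \<and> h x < \<infinity>"
    using Ex_finite_integrable_function by blast
  \<comment> \<open>a strictly positive square-integrable function\<close>
  define f0 where "f0 x = complex_of_real (sqrt (enn2real (h x)))" for x
  have [measurable]: "f0 \<in> borel_measurable M" unfolding f0_def by measurable
  have "(\<integral>\<^sup>+x. ennreal ((norm (f0 x))\<^sup>2) \<partial>M) = (\<integral>\<^sup>+x. h x \<partial>M)"
    using hpos by (intro nn_integral_cong) (auto simp: f0_def)
  then have f0: "f0 \<in> L2 M" unfolding L2_iff_nn_integral using hint by (simp add: less_top)
  define \<psi> where "\<psi> s = (\<integral>\<^sup>+x. ennreal (cmod (f0 x * w x s)) \<partial>M)" for s
  have [measurable]: "\<psi> \<in> borel_measurable M" unfolding \<psi>_def by measurable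
  have \<psi>fin: "AE s in M. \<psi> s < \<infinity>"
    using z[OF f0] unfolding \<psi>_def by eventually_elim (simp add: integrable_iff_bounded)
  \<comment> \<open>strictly positive, and \<open>u s * \<psi> s \<le> h s\<close> where \<open>\<psi> s\<close> is finite\<close>
  define u where "u s = enn2real (h s) / (1 + enn2real (\<psi> s))" for s
  have [measurable]: "u \<in> borel_measurable M" unfolding u_def by measurable
  have u0: "0 \<le> u s" for s by (simp add: u_def)
  define W where "W = (\<lambda>(x, s). complex_of_real (u s) * (f0 x * w x s))"
  have Wm[measurable]: "W \<in> borel_measurable (M \<Otimes>\<^sub>M M)" unfolding W_def by measurable
  have W: "integrable (M \<Otimes>\<^sub>M M) W"
  proof (rule integrableI_bounded[OF Wm])
    have "(\<integral>\<^sup>+p. ennreal (norm (W p)) \<partial>(M \<Otimes>\<^sub>M M)) = (\<integral>\<^sup>+s. \<integral>\<^sup>+x. ennreal (norm (W (x, s))) \<partial>M \<partial>M)"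
      by (rule MM.nn_integral_snd[symmetric]) measurable
    also have "\<dots> = (\<integral>\<^sup>+s. ennreal (u s) * \<psi> s \<partial>M)"
    proof (rule nn_integral_cong)
      fix s assume [measurable]: "s \<in> space M"
      have "(\<integral>\<^sup>+x. ennreal (norm (W (x, s))) \<partial>M) = (\<integral>\<^sup>+x. ennreal (u s) * ennreal (cmod (f0 x * w x s)) \<partial>M)"
        using u0 by (intro nn_integral_cong) (simp add: W_def norm_mult ennreal_mult[symmetric] abs_mult)
      also have "\<dots> = ennreal (u s) * \<psi> s" unfolding \<psi>_def by (rule nn_integral_cmult) measurable
      finally show "(\<integral>\<^sup>+x. ennreal (norm (W (x, s))) \<partial>M) = ennreal (u s) * \<psi> s" .
    qed
    also have "\<dots> \<le> (\<integral>\<^sup>+s. h s \<partial>M)"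
    proof (rule nn_integral_mono_AE)
      show "AE s in M. ennreal (u s) * \<psi> s \<le> h s"
        using \<psi>fin AE_space
      proof eventually_elim
        case (elim s)
        obtain t where t: "\<psi> s = ennreal t" "0 \<le> t" using elim(1) by (cases "\<psi> s") auto
        obtain r where r: "h s = ennreal r" "0 \<le> r" using hpos[OF elim(2)] by (cases "h s") auto
        have "r / (1 + t) * t \<le> r"
          using r t by (simp add: field_simps)
        then show ?case using t r by (simp add: u_def flip: ennreal_mult)
      qed
    qed
    also have "\<dots> < \<infinity>" using hint by (simp add: less_top)
    finally show "(\<integral>\<^sup>+p. ennreal (norm (W p)) \<partial>(M \<Otimes>\<^sub>M M)) < \<infinity>" .
  qed
  have "AE p in M \<Otimes>\<^sub>M M. W p = 0"
  proof (rule AE_zero_if_rectangle_integrals_zero[OF W])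
    fix A B assume [measurable]: "A \<in> sets M" "B \<in> sets M"
    have AB: "A \<times> B \<in> sets (M \<Otimes>\<^sub>M M)" by simp
    define fA where "fA x = indicator A x *\<^sub>R f0 x" for x
    have [measurable]: "fA \<in> borel_measurable M" unfolding fA_def by measurable
    have fA: "fA \<in> L2 M"
      by (rule L2_dominated[OF f0, where C=1]) (auto simp: fA_def indicator_def)
    have int: "integrable (M \<Otimes>\<^sub>M M) (\<lambda>(x, s). indicator (A \<times> B) (x, s) *\<^sub>R W (x, s))"
      using integrable_mult_indicator[OF AB W] by (simp add: case_prod_beta')
    have "(LINT p:A \<times> B|M \<Otimes>\<^sub>M M. W p) = (LINT s|M. LINT x|M. indicator (A \<times> B) (x, s) *\<^sub>R W (x, s))"
      unfolding set_lebesgue_integral_def MM.integral_snd[OF int] by (simp add: case_prod_beta')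
    also have "\<dots> = (LINT s|M. 0)"
    proof (rule integral_cong_AE)
      show "AE s in M. (LINT x|M. indicator (A \<times> B) (x, s) *\<^sub>R W (x, s)) = 0"
        using z[OF fA]
      proof eventually_elim
        case (elim s)
        have "(LINT x|M. indicator (A \<times> B) (x, s) *\<^sub>R W (x, s)) =
            (LINT x|M. (indicator B s * complex_of_real (u s)) * (fA x * w x s))"
          by (intro Bochner_Integration.integral_cong refl) (simp add: W_def fA_def indicator_def)
        also have "\<dots> = (indicator B s * complex_of_real (u s)) * (LINT x|M. fA x * w x s)"
          by (rule integral_mult_right_zero)
        finally show ?case using elim by simp
      qed
    qed (use int in measurable)
    finally show "(LINT p:A \<times> B|M \<Otimes>\<^sub>M M. W p) = 0" by simp
  qed
  then show ?thesis using AE_space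
  proof eventually_elim
    case (elim p)
    obtain x s where p: "p = (x, s)" "x \<in> space M" "s \<in> space M" using elim(2) by (auto simp: space_pair_measure)
    have "u s \<noteq> 0" using hpos[OF p(3)] unfolding u_def
      by (auto simp: add_nonneg_eq_0_iff enn2real_eq_0_iff)
    moreover have "f0 x \<noteq> 0" using hpos[OF p(2)] unfolding f0_def by (auto simp: enn2real_eq_0_iff)
    ultimately show ?case using elim(1) p by (simp add: W_def)
  qed
qed

text \<open>
  The conjugate is placed so that the inner product of a kernel with \<open>ptensor a b\<close> is the matrix
  coefficient at \<open>a\<close> and \<open>b\<close> of the operator with this kernel.
\<close>

definition ptensor :: "('a \<Rightarrow> complex) \<Rightarrow> ('a \<Rightarrow> complex) \<Rightarrow> 'a \<times> 'a \<Rightarrow> complex" where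
  "ptensor a b = (\<lambda>p. cnj (a (fst p)) * b (snd p))"

lemma ptensor_L2:
  assumes a: "a \<in> L2 M" and b: "b \<in> L2 M"
  shows "ptensor a b \<in> L2 (M \<Otimes>\<^sub>M M)"
proof -
  note [measurable] = L2_measurable[OF a] L2_measurable[OF b]
  have [measurable]: "ptensor a b \<in> borel_measurable (M \<Otimes>\<^sub>M M)" unfolding ptensor_def by measurable
  have "(\<integral>\<^sup>+p. ennreal ((norm (ptensor a b p))\<^sup>2) \<partial>(M \<Otimes>\<^sub>M M)) =
      (\<integral>\<^sup>+x. \<integral>\<^sup>+s. ennreal ((norm (ptensor a b (x, s)))\<^sup>2) \<partial>M \<partial>M)"
    by (rule nn_integral_fst[symmetric]) measurable
  also have "\<dots> = (\<integral>\<^sup>+x. \<integral>\<^sup>+s. ennreal ((norm (a x))\<^sup>2) * ennreal ((norm (b s))\<^sup>2) \<partial>M \<partial>M)"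
    by (simp add: ptensor_def norm_mult power_mult_distrib ennreal_mult)
  also have "\<dots> = (\<integral>\<^sup>+x. ennreal ((norm (a x))\<^sup>2) \<partial>M) * (\<integral>\<^sup>+s. ennreal ((norm (b s))\<^sup>2) \<partial>M)"
    by (simp add: nn_integral_cmult nn_integral_multc)
  also have "\<dots> < \<infinity>"
    using L2_nn_integral_finite[OF a] L2_nn_integral_finite[OF b] by (simp add: ennreal_mult_less_top)
  finally show ?thesis unfolding L2_iff_nn_integral by simp
qed

text \<open>
  By the Cauchy-Schwarz inequality in \<open>x\<close>, the integral of \<open>cmod (a x) * cmod (w (x, s))\<close> is a
  square-integrable function of \<open>s\<close>; the inner product with \<open>b\<close> is then given by the theorem of
  Fubini.
\<close>

lemma
  fixes w :: "'a \<times> 'a \<Rightarrow> complex"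
  assumes w: "w \<in> L2 (M \<Otimes>\<^sub>M M)" and a: "a \<in> L2 M"
  shows kernel_transform_integrable: "AE s in M. integrable M (\<lambda>x. a x * w (x, s))"
    and kernel_transform_L2: "(\<lambda>s. LINT x|M. a x * w (x, s)) \<in> L2 M"
    and kernel_transform_inner: "b \<in> L2 M \<Longrightarrow>
          L2_inner M (\<lambda>s. LINT x|M. a x * w (x, s)) b = L2_inner (M \<Otimes>\<^sub>M M) w (ptensor a b)"
proof -
  note [measurable] = L2_measurable[OF w] L2_measurable[OF a]
  define \<phi> where "\<phi> s = (\<integral>\<^sup>+x. ennreal (norm (a x)) * ennreal (norm (w (x, s))) \<partial>M)" for s
  have [measurable]: "\<phi> \<in> borel_measurable M" unfolding \<phi>_def by measurable
  have "(\<integral>\<^sup>+s. (\<phi> s)\<^sup>2 \<partial>M) \<le> (\<integral>\<^sup>+s. (\<integral>\<^sup>+x. (ennreal (norm (a x)))\<^sup>2 \<partial>M) * (\<integral>\<^sup>+x. (ennreal (norm (w (x, s))))\<^sup>2 \<partial>M) \<partial>M)"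
    unfolding \<phi>_def by (intro nn_integral_mono Cauchy_Schwarz_nn_integral) measurable
  also have "\<dots> = (\<integral>\<^sup>+x. (ennreal (norm (a x)))\<^sup>2 \<partial>M) * (\<integral>\<^sup>+s. \<integral>\<^sup>+x. (ennreal (norm (w (x, s))))\<^sup>2 \<partial>M \<partial>M)"
    by (rule nn_integral_cmult) measurable
  also have "(\<integral>\<^sup>+s. \<integral>\<^sup>+x. (ennreal (norm (w (x, s))))\<^sup>2 \<partial>M \<partial>M) = (\<integral>\<^sup>+p. (ennreal (norm (w p)))\<^sup>2 \<partial>(M \<Otimes>\<^sub>M M))"
    by (rule MM.nn_integral_snd) measurable
  also have "(\<integral>\<^sup>+x. (ennreal (norm (a x)))\<^sup>2 \<partial>M) * \<dots> < \<infinity>"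
    using L2_nn_integral_finite[OF a] L2_nn_integral_finite[OF w] by (simp add: ennreal_mult_less_top ennreal_power)
  finally have \<phi>2: "(\<integral>\<^sup>+s. (\<phi> s)\<^sup>2 \<partial>M) < \<infinity>" .
  then have "AE s in M. (\<phi> s)\<^sup>2 \<noteq> \<infinity>" by (intro nn_integral_PInf_AE) auto
  then have \<phi>fin: "AE s in M. \<phi> s < \<infinity>"
    by eventually_elim (auto simp: power2_eq_square ennreal_mult_eq_top_iff less_top)
  show int: "AE s in M. integrable M (\<lambda>x. a x * w (x, s))"
    using \<phi>fin AE_space
  proof eventually_elim
    case (elim s)
    then have [measurable]: "s \<in> space M" by simp
    show ?case
      using elim(1) unfolding \<phi>_def integrable_iff_bounded by (simp add: norm_mult ennreal_mult)
  qed
  define R where "R s = (LINT x|M. a x * w (x, s))" for s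
  have [measurable]: "R \<in> borel_measurable M" unfolding R_def by measurable
  have R_le: "ennreal (norm (R s)) \<le> \<phi> s" for s
    using integral_norm_bound_ennreal[of M "\<lambda>x. a x * w (x, s)"]
    unfolding R_def \<phi>_def by (cases "integrable M (\<lambda>x. a x * w (x, s))")
      (auto simp: norm_mult ennreal_mult not_integrable_integral_eq)
  have "(\<integral>\<^sup>+s. ennreal ((norm (R s))\<^sup>2) \<partial>M) \<le> (\<integral>\<^sup>+s. (\<phi> s)\<^sup>2 \<partial>M)"
    by (intro nn_integral_mono) (simp add: ennreal_power[symmetric] power_mono R_le)
  then have "R \<in> L2 M" unfolding L2_iff_nn_integral using \<phi>2 by (auto intro: le_less_trans)
  then show "(\<lambda>s. LINT x|M. a x * w (x, s)) \<in> L2 M" unfolding R_def .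
  assume b: "b \<in> L2 M"
  note [measurable] = L2_measurable[OF b]
  have i: "integrable (M \<Otimes>\<^sub>M M) (\<lambda>(x, s). cinner (w (x, s)) (ptensor a b (x, s)))"
    using L2_cinner_integrable[OF w ptensor_L2[OF a b]] by (simp add: case_prod_beta')
  have "L2_inner (M \<Otimes>\<^sub>M M) w (ptensor a b) = (LINT s|M. LINT x|M. cinner (w (x, s)) (ptensor a b (x, s)))"
    unfolding L2_inner_def MM.integral_snd[OF i] by (simp add: case_prod_beta')
  also have "\<dots> = (LINT s|M. cinner (R s) (b s))"
    unfolding R_def cinner_complex_def ptensor_def
    by (simp add: mult_ac flip: integral_mult_right_zero)
  finally show "L2_inner M (\<lambda>s. LINT x|M. a x * w (x, s)) b = L2_inner (M \<Otimes>\<^sub>M M) w (ptensor a b)"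
    unfolding L2_inner_def R_def by simp
qed

lemma L2_inner_ptensor:
  assumes "a \<in> L2 M" "b \<in> L2 M" "a' \<in> L2 M" "b' \<in> L2 M"
  shows "L2_inner (M \<Otimes>\<^sub>M M) (ptensor a b) (ptensor a' b') = L2_inner M a' a * L2_inner M b b'"
proof -
  have "L2_inner (M \<Otimes>\<^sub>M M) (ptensor a b) (ptensor a' b') =
      L2_inner M (\<lambda>s. LINT x|M. a' x * ptensor a b (x, s)) b'"
    using kernel_transform_inner[OF ptensor_L2[OF assms(1,2)] assms(3,4)] ..
  also have "(\<lambda>s. LINT x|M. a' x * ptensor a b (x, s)) = (\<lambda>s. L2_inner M a' a *\<^sub>C b s)"
  proof
    fix s
    have "(LINT x|M. a' x * ptensor a b (x, s)) = (LINT x|M. cinner (a' x) (a x) * b s)"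
      by (simp add: ptensor_def cinner_complex_def mult.assoc)
    also have "\<dots> = L2_inner M a' a * b s" unfolding L2_inner_def by (rule integral_mult_left_zero)
    finally show "(LINT x|M. a' x * ptensor a b (x, s)) = L2_inner M a' a *\<^sub>C b s"
      unfolding scaleC_complex_def .
  qed
  finally show ?thesis using L2.ip_scale[OF assms(2,4)] by simp
qed

lemma ptensor_functional:
  assumes w: "w \<in> L2 (M \<Otimes>\<^sub>M M)" and b: "b \<in> L2 M"
  shows "L2_functional M (\<lambda>a. L2_inner (M \<Otimes>\<^sub>M M) w (ptensor a b))"
proof -
  have add: "ptensor (\<lambda>x. f x + g x) b = (\<lambda>p. ptensor f b p + ptensor g b p)" for f g
    by (simp add: ptensor_def algebra_simps)
  have scale: "ptensor (\<lambda>x. c *\<^sub>C f x) b = (\<lambda>p. cnj c *\<^sub>C ptensor f b p)" for c f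
    by (simp add: ptensor_def scaleC_complex_def mult_ac)
  have "cmod (L2_inner (M \<Otimes>\<^sub>M M) w (ptensor a b)) \<le>
      (L2.nrm (M \<Otimes>\<^sub>M M) w * L2.nrm M b) * L2.nrm M a" if a: "a \<in> L2 M" for a
  proof -
    have "L2.sq (M \<Otimes>\<^sub>M M) (ptensor a b) = L2.sq M a * L2.sq M b"
    proof -
      have "L2_inner (M \<Otimes>\<^sub>M M) (ptensor a b) (ptensor a b) = complex_of_real (L2.sq M a * L2.sq M b)"
        unfolding L2_inner_ptensor[OF a b a b] L2.ip_self[OF a] L2.ip_self[OF b] by simp
      then show ?thesis unfolding L2.sq_def[of "M \<Otimes>\<^sub>M M" "ptensor a b"] by (simp only: Re_complex_of_real)
    qed
    then have "L2.nrm (M \<Otimes>\<^sub>M M) (ptensor a b) = L2.nrm M a * L2.nrm M b"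
      by (simp add: L2.nrm_def real_sqrt_mult)
    then show ?thesis using L2.cauchy_schwarz[OF w ptensor_L2[OF a b]] by (simp add: mult_ac)
  qed
  then show ?thesis unfolding L2.functional_def
    using w b by (auto simp: add scale L2.ip_add_right L2.ip_scale_right ptensor_L2)
qed

definition ptensor_basis :: "('a \<Rightarrow> complex) set \<Rightarrow> ('a \<times> 'a \<Rightarrow> complex) set" where
  "ptensor_basis A = (\<lambda>(a, b). ptensor a b) ` (A \<times> A)"

lemma ptensor_inj_on:
  assumes A: "is_onb (L2 M) (L2_inner M) A"
  shows "inj_on (\<lambda>(a, b). ptensor a b) (A \<times> A)"
proof (rule inj_onI, clarify)
  fix a b a' b' assume m: "a \<in> A" "b \<in> A" "a' \<in> A" "b' \<in> A" and eq: "ptensor a b = ptensor a' b'"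
  have AL: "a \<in> L2 M" "b \<in> L2 M" "a' \<in> L2 M" "b' \<in> L2 M" using m L2.onb_subset[OF A] by auto
  have "L2_inner (M \<Otimes>\<^sub>M M) (ptensor a b) (ptensor a b) = 1"
    using A m by (simp add: L2_inner_ptensor[OF AL(1,2,1,2)] is_onb_def)
  then have "L2_inner M a' a * L2_inner M b b' \<noteq> 0" using eq L2_inner_ptensor[OF AL(1,2,3,4)] by simp
  then show "a = a' \<and> b = b'" using A m by (auto simp: is_onb_def split: if_splits)
qed

text \<open>
  A kernel orthogonal to all these functions has an integral operator that is \<open>0\<close> on the basis
  \<open>A\<close>, hence everywhere, so the kernel vanishes almost everywhere.
\<close>

lemma ptensor_basis_onb:
  assumes A: "is_onb (L2 M) (L2_inner M) A"
  shows "is_onb (L2 (M \<Otimes>\<^sub>M M)) (L2_inner (M \<Otimes>\<^sub>M M)) (ptensor_basis A)"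
  unfolding is_onb_def
proof (intro conjI ballI impI)
  have AL: "A \<subseteq> L2 M" by (rule L2.onb_subset[OF A])
  then show "ptensor_basis A \<subseteq> L2 (M \<Otimes>\<^sub>M M)" unfolding ptensor_basis_def by (auto intro: ptensor_L2)
  fix p q assume "p \<in> ptensor_basis A" "q \<in> ptensor_basis A"
  then obtain a b a' b' where pq: "p = ptensor a b" "q = ptensor a' b'" "a \<in> A" "b \<in> A" "a' \<in> A" "b' \<in> A"
    unfolding ptensor_basis_def by auto
  have "ptensor a b = ptensor a' b' \<longleftrightarrow> a = a' \<and> b = b'"
    using inj_onD[OF ptensor_inj_on[OF A], of "(a, b)" "(a', b')"] pq by auto
  moreover have "L2_inner (M \<Otimes>\<^sub>M M) p q = L2_inner M a' a * L2_inner M b b'"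
    unfolding pq by (intro L2_inner_ptensor) (use AL pq in auto)
  ultimately show "L2_inner (M \<Otimes>\<^sub>M M) p q = (if p = q then 1 else 0)"
    using A pq by (auto simp: is_onb_def)
next
  have AL: "A \<subseteq> L2 M" by (rule L2.onb_subset[OF A])
  fix w assume w: "w \<in> L2 (M \<Otimes>\<^sub>M M)" and orth: "\<forall>p\<in>ptensor_basis A. L2_inner (M \<Otimes>\<^sub>M M) w p = 0"
  have zero: "L2_inner (M \<Otimes>\<^sub>M M) w (ptensor f b) = 0" if f: "f \<in> L2 M" and b: "b \<in> A" for f b
  proof -
    have bL: "b \<in> L2 M" using b AL by auto
    have "L2_functional M (\<lambda>a. 0)" unfolding L2.functional_def by (auto intro!: exI[of _ 0])
    from L2.functional_eq_if_eq_on_onb[OF A ptensor_functional[OF w bL] this _ f]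
    show ?thesis using orth b unfolding ptensor_basis_def by auto
  qed
  have "AE p in M \<Otimes>\<^sub>M M. w (fst p, snd p) = 0"
  proof (rule AE_zero_kernel_if_integrals_zero)
    show "(\<lambda>(x, s). w (x, s)) \<in> borel_measurable (M \<Otimes>\<^sub>M M)" using L2_measurable[OF w] by simp
    fix f :: "'a \<Rightarrow> complex" assume f: "f \<in> L2 M"
    have "AE s in M. (LINT x|M. f x * w (x, s)) = 0"
      by (rule L2_eq_AE_if_eq_on_onb[OF A kernel_transform_L2[OF w f] L2_zero])
        (use AL zero[OF f] kernel_transform_inner[OF w f] in \<open>auto simp: L2_inner_def cinner_complex_def\<close>)
    then show "AE s in M. integrable M (\<lambda>x. f x * w (x, s)) \<and> (LINT x|M. f x * w (x, s)) = 0"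
      using kernel_transform_integrable[OF w f] by eventually_elim simp
  qed
  then have w0: "AE p in M \<Otimes>\<^sub>M M. w p = 0" by simp
  have "L2_inner (M \<Otimes>\<^sub>M M) w w = L2_inner (M \<Otimes>\<^sub>M M) (\<lambda>_. 0 :: complex) (\<lambda>_. 0)"
    by (intro L2_inner_cong_AE L2_measurable w L2_zero w0)
  then show "L2_inner (M \<Otimes>\<^sub>M M) w w = 0" by (simp add: L2_inner_def cinner_complex_def)
qed

lemma ptensor_basis_bij:
  "is_onb (L2 M) (L2_inner M) A \<Longrightarrow> bij_betw (\<lambda>(a, b). ptensor a b) (A \<times> A) (ptensor_basis A)"
  unfolding ptensor_basis_def by (intro inj_on_imp_bij_betw ptensor_inj_on)

lemma ptensor_parseval_sq:
  assumes A: "is_onb (L2 M) (L2_inner M) A" and w: "w \<in> L2 (M \<Otimes>\<^sub>M M)"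
  shows "(\<integral>\<^sup>+p. ennreal ((cmod (w p))\<^sup>2) \<partial>(M \<Otimes>\<^sub>M M)) =
    (\<integral>\<^sup>+a. \<integral>\<^sup>+b. ennreal ((cmod (L2_inner (M \<Otimes>\<^sub>M M) w (ptensor a b)))\<^sup>2) \<partial>count_space A \<partial>count_space A)"
proof -
  have "(\<integral>\<^sup>+p. ennreal ((cmod (w p))\<^sup>2) \<partial>(M \<Otimes>\<^sub>M M)) = ennreal (L2.sq (M \<Otimes>\<^sub>M M) w)"
    unfolding L2.sq_def L2_norm_nn_integral[OF w] ..
  also have "\<dots> = (\<integral>\<^sup>+p. ennreal ((cmod (L2_inner (M \<Otimes>\<^sub>M M) w p))\<^sup>2) \<partial>count_space (ptensor_basis A))"
    by (rule L2.parseval_sq[OF ptensor_basis_onb[OF A] w])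
  also have "\<dots> = (\<integral>\<^sup>+z. ennreal ((cmod (L2_inner (M \<Otimes>\<^sub>M M) w ((\<lambda>(a, b). ptensor a b) z)))\<^sup>2) \<partial>count_space (A \<times> A))"
    by (rule nn_integral_bij_count_space[OF ptensor_basis_bij[OF A], symmetric])
  finally show ?thesis unfolding nn_integral_count_space_Times by (simp add: case_prod_beta')
qed

lemma ptensor_parseval:
  assumes A: "is_onb (L2 M) (L2_inner M) A" and v: "v \<in> L2 (M \<Otimes>\<^sub>M M)" and w: "w \<in> L2 (M \<Otimes>\<^sub>M M)"
  shows "((\<lambda>(a, b). L2_inner (M \<Otimes>\<^sub>M M) v (ptensor a b) * L2_inner (M \<Otimes>\<^sub>M M) (ptensor a b) w)
     has_sum L2_inner (M \<Otimes>\<^sub>M M) v w) (A \<times> A)"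
  using L2.parseval[OF ptensor_basis_onb[OF A] v w]
  unfolding has_sum_reindex_bij_betw[OF ptensor_basis_bij[OF A], symmetric]
  by (simp add: case_prod_beta')

text \<open>
  The Riesz-Fischer theorem on \<open>M \<times> M\<close> provides a kernel \<open>k\<close> with the coefficients of
  \<open>R\<close>. Its integral operator agrees with \<open>R\<close> on the basis, hence everywhere, and so
  \<open>k\<close> agrees with \<open>w\<close> almost everywhere.
\<close>

lemma kernel_L2_if_coefficients_square_summable:
  fixes w :: "'a \<Rightarrow> 'a \<Rightarrow> complex" and R :: "('a \<Rightarrow> complex) \<Rightarrow> 'a \<Rightarrow> complex"
  assumes A: "is_onb (L2 M) (L2_inner M) A"
    and w[measurable]: "(\<lambda>(x, s). w x s) \<in> borel_measurable (M \<Otimes>\<^sub>M M)"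
    and R: "\<And>f. f \<in> L2 M \<Longrightarrow> R f \<in> L2 M"
    and Rw: "\<And>f. f \<in> L2 M \<Longrightarrow> AE s in M. integrable M (\<lambda>x. f x * w x s) \<and> R f s = (LINT x|M. f x * w x s)"
    and fn: "\<And>b. b \<in> L2 M \<Longrightarrow> L2_functional M (\<lambda>f. L2_inner M (R f) b)"
    and fin: "(\<integral>\<^sup>+a. \<integral>\<^sup>+b. ennreal ((cmod (L2_inner M (R a) b))\<^sup>2) \<partial>count_space A \<partial>count_space A) < \<infinity>"
  shows "(\<lambda>p. w (fst p) (snd p)) \<in> L2 (M \<Otimes>\<^sub>M M)"
proof -
  have AL: "A \<subseteq> L2 M" by (rule L2.onb_subset[OF A])
  \<comment> \<open>the coefficient that the kernel must have at each basis function\<close>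
  define c where "c p = (case inv_into (A \<times> A) (\<lambda>(a, b). ptensor a b) p of (a, b) \<Rightarrow> L2_inner M (R a) b)" for p
  have c: "c (ptensor a b) = L2_inner M (R a) b" if "a \<in> A" "b \<in> A" for a b
    using inv_into_f_f[OF ptensor_inj_on[OF A], of "(a, b)"] that by (simp add: c_def)
  have "(\<integral>\<^sup>+p. ennreal (norm ((cmod (c p))\<^sup>2)) \<partial>count_space (ptensor_basis A)) =
      (\<integral>\<^sup>+z. ennreal (norm ((cmod (c ((\<lambda>(a, b). ptensor a b) z)))\<^sup>2)) \<partial>count_space (A \<times> A))"
    by (rule nn_integral_bij_count_space[OF ptensor_basis_bij[OF A], symmetric])
  also have "\<dots> = (\<integral>\<^sup>+z. ennreal ((cmod (L2_inner M (R (fst z)) (snd z)))\<^sup>2) \<partial>count_space (A \<times> A))"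
    by (intro nn_integral_cong) (auto simp: c)
  also have "\<dots> < \<infinity>" using fin unfolding nn_integral_count_space_Times .
  finally have "Infinite_Sum.abs_summable_on (\<lambda>p. (cmod (c p))\<^sup>2) (ptensor_basis A)"
    unfolding abs_summable_iff_nn_integral .
  then have sm: "(\<lambda>p. (cmod (c p))\<^sup>2) summable_on ptensor_basis A" by simp
  have on: "L2.orthonormal (M \<Otimes>\<^sub>M M) (ptensor_basis A)"
    using ptensor_basis_onb[OF A] L2.is_onb_iff by blast
  obtain k where k: "k \<in> L2 (M \<Otimes>\<^sub>M M)"
    and kc: "\<And>p. p \<in> ptensor_basis A \<Longrightarrow> L2_inner (M \<Otimes>\<^sub>M M) k p = c p"
    by (rule L2.square_summable_has_vector[OF on sm]) (rule that)
  note [measurable] = L2_measurable[OF k]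
  have eq: "L2_inner (M \<Otimes>\<^sub>M M) k (ptensor f b) = L2_inner M (R f) b" if f: "f \<in> L2 M" and b: "b \<in> A" for f b
  proof -
    have bL: "b \<in> L2 M" using b AL by auto
    show ?thesis
      by (rule L2.functional_eq_if_eq_on_onb[OF A ptensor_functional[OF k bL] fn[OF bL] _ f])
        (use b in \<open>auto simp: ptensor_basis_def c intro!: kc[THEN trans]\<close>)
  qed
  have "AE p in M \<Otimes>\<^sub>M M. w (fst p) (snd p) - k (fst p, snd p) = 0"
  proof (rule AE_zero_kernel_if_integrals_zero)
    show "(\<lambda>(x, s). w x s - k (x, s)) \<in> borel_measurable (M \<Otimes>\<^sub>M M)" by measurable
    fix f :: "'a \<Rightarrow> complex" assume f: "f \<in> L2 M"
    have "AE s in M. (LINT x|M. f x * k (x, s)) = R f s"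
      by (rule L2_eq_AE_if_eq_on_onb[OF A kernel_transform_L2[OF k f] R[OF f]])
        (use AL eq[OF f] kernel_transform_inner[OF k f] in auto)
    then show "AE s in M. integrable M (\<lambda>x. f x * (w x s - k (x, s))) \<and> (LINT x|M. f x * (w x s - k (x, s))) = 0"
      using kernel_transform_integrable[OF k f] Rw[OF f]
      by eventually_elim (simp add: right_diff_distrib)
  qed
  then have eqk: "AE p in M \<Otimes>\<^sub>M M. norm (w (fst p) (snd p)) \<le> 1 * norm (k p)"
    by eventually_elim simp
  show ?thesis
    by (rule L2_dominated[OF k _ eqk]) measurable
qed

end

section \<open>Hilbert-Schmidt norm and trace of integral operators\<close>

text \<open>
  Puts the sums over the basis of \<open>'h\<close> outside, so that the inner sums concern one scalar kernel.
\<close>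

lemma nn_integral_count_space_quad:
  fixes F :: "'a \<Rightarrow> 'e \<Rightarrow> 'a \<Rightarrow> 'e \<Rightarrow> ennreal"
  shows "(\<integral>\<^sup>+y. \<integral>\<^sup>+z. F (fst y) (snd y) (fst z) (snd z) \<partial>count_space (A \<times> E) \<partial>count_space (A \<times> E)) =
    (\<integral>\<^sup>+e. \<integral>\<^sup>+e'. \<integral>\<^sup>+a. \<integral>\<^sup>+a'. F a e a' e' \<partial>count_space A \<partial>count_space A \<partial>count_space E \<partial>count_space E)"
proof -
  have "(\<integral>\<^sup>+y. \<integral>\<^sup>+z. F (fst y) (snd y) (fst z) (snd z) \<partial>count_space (A \<times> E) \<partial>count_space (A \<times> E)) =
      (\<integral>\<^sup>+a. \<integral>\<^sup>+e. \<integral>\<^sup>+a'. \<integral>\<^sup>+e'. F a e a' e' \<partial>count_space E \<partial>count_space A \<partial>count_space E \<partial>count_space A)"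
    by (subst nn_integral_count_space_Times[where A=A and B=E
          and f="\<lambda>a e. \<integral>\<^sup>+z. F a e (fst z) (snd z) \<partial>count_space (A \<times> E)", symmetric])
      (intro nn_integral_cong nn_integral_count_space_Times[symmetric])
  also have "\<dots> = (\<integral>\<^sup>+e. \<integral>\<^sup>+a. \<integral>\<^sup>+a'. \<integral>\<^sup>+e'. F a e a' e' \<partial>count_space E \<partial>count_space A \<partial>count_space A \<partial>count_space E)"
    by (rule nn_integral_count_space_swap)
  also have "\<dots> = (\<integral>\<^sup>+e. \<integral>\<^sup>+a. \<integral>\<^sup>+e'. \<integral>\<^sup>+a'. F a e a' e' \<partial>count_space A \<partial>count_space E \<partial>count_space A \<partial>count_space E)"
    by (intro nn_integral_cong nn_integral_count_space_swap)
  also have "\<dots> = (\<integral>\<^sup>+e. \<integral>\<^sup>+e'. \<integral>\<^sup>+a. \<integral>\<^sup>+a'. F a e a' e' \<partial>count_space A \<partial>count_space A \<partial>count_space E \<partial>count_space E)"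
    by (intro nn_integral_cong nn_integral_count_space_swap)
  finally show ?thesis .
qed

lemma nn_integral_tensor_basis:
  fixes F :: "('a \<Rightarrow> 'h::{chilbert_space, second_countable_topology}) \<Rightarrow> ennreal"
  assumes A: "is_onb (L2 M) (L2_inner M) A"
  shows "(\<integral>\<^sup>+b. F b \<partial>count_space (tensor_basis A)) = (\<integral>\<^sup>+z. F (tensor (fst z) (snd z)) \<partial>count_space (A \<times> basis_H))"
proof -
  have "bij_betw (\<lambda>(a, e). tensor a e) (A \<times> basis_H) (tensor_basis A :: ('a \<Rightarrow> 'h) set)"
    unfolding tensor_basis_def by (intro inj_on_imp_bij_betw tensor_inj_on[OF A])
  from nn_integral_bij_count_space[OF this, of F] show ?thesis by (simp add: case_prod_beta')
qed

lemma hs_norm_sq_tensor_basis: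
  fixes T :: "('a \<Rightarrow> 'h) \<Rightarrow> ('a \<Rightarrow> 'h::{chilbert_space, second_countable_topology})"
  assumes A: "is_onb (L2 M) (L2_inner M) A" and T: "L2_bounded_op M T"
  shows "hs_norm_sq (L2 M) (L2_inner M) T =
    (\<integral>\<^sup>+e. \<integral>\<^sup>+e'. \<integral>\<^sup>+a. \<integral>\<^sup>+a'. ennreal ((cmod (L2_inner M (T (tensor a e)) (tensor a' e')))\<^sup>2)
       \<partial>count_space A \<partial>count_space A \<partial>count_space basis_H \<partial>count_space basis_H)"
  unfolding L2.hs_norm_sq_eq[OF T tensor_basis_onb[OF A]]
    L2.hs_norm_sq_eq_double[OF T tensor_basis_onb[OF A] tensor_basis_onb[OF A]]
    nn_integral_tensor_basis[OF A] nn_integral_count_space_quad[symmetric] ..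

lemma tensor_functional:
  fixes l :: "('a \<Rightarrow> 'h::{chilbert_space, second_countable_topology}) \<Rightarrow> complex"
  assumes l: "L2_functional M l"
  shows "L2_functional M (\<lambda>a. l (tensor a e))"
proof -
  have add: "tensor (\<lambda>x. f x + g x) e = (\<lambda>x. tensor f e x + tensor g e x)" for f g
    by (simp add: tensor_def scaleC_add_left)
  have scale: "tensor (\<lambda>x. c *\<^sub>C f x) e = (\<lambda>x. c *\<^sub>C tensor f e x)" for c f
    by (simp add: tensor_def scaleC_scaleC scaleC_complex_def)
  obtain C where C: "\<And>f. f \<in> L2 M \<Longrightarrow> cmod (l f) \<le> C * L2.nrm M f"
    using l unfolding L2.functional_def by blast
  have "cmod (l (tensor a e)) \<le> (C * norm e) * L2.nrm M a" if a: "a \<in> L2 M" for a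
  proof -
    have "L2_inner M (tensor a e) (tensor a e) = complex_of_real (L2.sq M a * (norm e)\<^sup>2)"
      unfolding L2_inner_tensor L2.ip_self[OF a] cinner_self by simp
    then have "L2.sq M (tensor a e) = L2.sq M a * (norm e)\<^sup>2"
      unfolding L2.sq_def[of M "tensor a e"] by (simp only: Re_complex_of_real)
    then have "L2.nrm M (tensor a e) = norm e * L2.nrm M a"
      by (simp add: L2.nrm_def real_sqrt_mult)
    then show ?thesis using C[OF tensor_L2[OF a, of e]] by (simp add: mult_ac)
  qed
  then have "\<exists>C. \<forall>u\<in>L2 M. cmod (l (tensor u e)) \<le> C * L2.nrm M u" by blast
  then show ?thesis using l unfolding L2.functional_def
    by (simp add: add scale tensor_L2)
qed

text \<open>
  The images of the tensors with basis vectors determine all matrix coefficients of \<open>T\<close>, and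
  these are all that the norm and the trace depend on.
\<close>

definition kernel_op ::
  "'a measure \<Rightarrow> ('a \<Rightarrow> 'a \<Rightarrow> 'h \<Rightarrow> 'h) \<Rightarrow> (('a \<Rightarrow> 'h) \<Rightarrow> ('a \<Rightarrow> 'h::{chilbert_space, second_countable_topology})) \<Rightarrow> bool" where
  "kernel_op M K T \<longleftrightarrow> L2_bounded_op M T \<and>
     (\<forall>e\<in>basis_H. (\<lambda>(x, s). K x s e) \<in> borel_measurable (M \<Otimes>\<^sub>M M)) \<and>
     (\<forall>a\<in>L2 M. \<forall>e\<in>basis_H. AE s in M. integrable M (\<lambda>x. a x *\<^sub>C K x s e) \<and>
        T (tensor a e) s = (LINT x|M. a x *\<^sub>C K x s e))"

definition kernel_entry :: "('a \<Rightarrow> 'a \<Rightarrow> 'h \<Rightarrow> 'h::chilbert_space) \<Rightarrow> 'h \<Rightarrow> 'h \<Rightarrow> 'a \<times> 'a \<Rightarrow> complex" where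
  "kernel_entry K e e' = (\<lambda>p. cinner (K (fst p) (snd p) e) e')"

context sigma_finite_measure
begin

interpretation MM: pair_sigma_finite M M ..

context
  fixes K :: "'a \<Rightarrow> 'a \<Rightarrow> 'h \<Rightarrow> 'h::{chilbert_space, second_countable_topology}"
    and T :: "('a \<Rightarrow> 'h) \<Rightarrow> 'a \<Rightarrow> 'h"
  assumes KT: "kernel_op M K T"
begin

lemma kernel_op_bounded: "L2_bounded_op M T" using KT unfolding kernel_op_def by blast

lemma kernel_measurable: "e \<in> basis_H \<Longrightarrow> (\<lambda>(x, s). K x s e) \<in> borel_measurable (M \<Otimes>\<^sub>M M)"
  using KT unfolding kernel_op_def by blast

lemma kernel_entry_measurable:
  assumes e: "e \<in> basis_H"
  shows "kernel_entry K e e' \<in> borel_measurable (M \<Otimes>\<^sub>M M)"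
proof -
  note [measurable] = kernel_measurable[OF e]
  have "(\<lambda>p. cinner ((\<lambda>(x, s). K x s e) p) e') \<in> borel_measurable (M \<Otimes>\<^sub>M M)" by measurable
  then show ?thesis unfolding kernel_entry_def by (simp add: case_prod_beta')
qed

lemma kernel_op_component:
  assumes a: "a \<in> L2 M" and e: "e \<in> basis_H"
  shows "AE s in M. integrable M (\<lambda>x. a x * kernel_entry K e e' (x, s)) \<and>
    cinner (T (tensor a e) s) e' = (LINT x|M. a x * kernel_entry K e e' (x, s))"
proof -
  have "AE s in M. integrable M (\<lambda>x. a x *\<^sub>C K x s e) \<and> T (tensor a e) s = (LINT x|M. a x *\<^sub>C K x s e)"
    using KT a e unfolding kernel_op_def by blast
  then show ?thesis
  proof eventually_elim
    case (elim s)
    then show ?case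
      using integrable_cinner_left[of M "\<lambda>x. a x *\<^sub>C K x s e" e'] integral_cinner_left[of M "\<lambda>x. a x *\<^sub>C K x s e" e']
      by (simp add: kernel_entry_def cinner_scaleC_left)
  qed
qed

lemma kernel_op_coefficient:
  assumes a: "a \<in> L2 M" "b \<in> L2 M" and e: "e \<in> basis_H"
    and L: "kernel_entry K e e' \<in> L2 (M \<Otimes>\<^sub>M M)"
  shows "L2_inner M (T (tensor a e)) (tensor b e') = L2_inner (M \<Otimes>\<^sub>M M) (kernel_entry K e e') (ptensor a b)"
proof -
  have "L2_inner M (T (tensor a e)) (tensor b e') = L2_inner M (\<lambda>s. cinner (T (tensor a e) s) e') b"
    by (rule L2_inner_tensor_right)
  also have "\<dots> = L2_inner M (\<lambda>s. LINT x|M. a x * kernel_entry K e e' (x, s)) b"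
  proof (rule L2_inner_cong_AE)
    show "AE s in M. cinner (T (tensor a e) s) e' = (LINT x|M. a x * kernel_entry K e e' (x, s))"
      using kernel_op_component[OF a(1) e, of e'] by eventually_elim simp
  qed (intro L2_measurable cinner_component_L2 L2.bounded_op_closed[OF kernel_op_bounded] tensor_L2 a
      kernel_transform_L2[OF L] AE_I2 refl)+
  also have "\<dots> = L2_inner (M \<Otimes>\<^sub>M M) (kernel_entry K e e') (ptensor a b)"
    by (rule kernel_transform_inner[OF L a])
  finally show ?thesis .
qed

text \<open>
  The squared coefficients of the entry at \<open>(e, e')\<close> are a part of the series for the
  Hilbert-Schmidt norm of \<open>T\<close>.
\<close>

lemma kernel_entry_L2_if_hilbert_schmidt:
  assumes fin: "hs_norm_sq (L2 M) (L2_inner M) T < \<infinity>" and e: "e \<in> basis_H" "e' \<in> basis_H"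
  shows "kernel_entry K e e' \<in> L2 (M \<Otimes>\<^sub>M M)"
proof -
  define A :: "('a \<Rightarrow> complex) set" where "A = some_onb (L2 M) (L2_inner M)"
  have A: "is_onb (L2 M) (L2_inner M) A" unfolding A_def by (rule L2.some_onb)
  let ?R = "\<lambda>f s. cinner (T (tensor f e) s) e'"
  define G where "G e e' = (\<integral>\<^sup>+a. \<integral>\<^sup>+a'. ennreal ((cmod (L2_inner M (T (tensor a e)) (tensor a' e')))\<^sup>2)
       \<partial>count_space A \<partial>count_space A)" for e e' :: 'h
  have "G e e' \<le> (\<integral>\<^sup>+e'. G e e' \<partial>count_space basis_H)"
    using nn_integral_ge_point[of e' basis_H "\<lambda>e'. G e e'"] e by simp
  also have "\<dots> \<le> (\<integral>\<^sup>+e. \<integral>\<^sup>+e'. G e e' \<partial>count_space basis_H \<partial>count_space basis_H)"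
    using nn_integral_ge_point[of e basis_H "\<lambda>e. \<integral>\<^sup>+e'. G e e' \<partial>count_space basis_H"] e by simp
  also have "\<dots> < \<infinity>"
    using fin unfolding hs_norm_sq_tensor_basis[OF A kernel_op_bounded] G_def .
  finally have Gfin: "G e e' < \<infinity>" .
  have "(\<lambda>p. kernel_entry K e e' (fst p, snd p)) \<in> L2 (M \<Otimes>\<^sub>M M)"
  proof (rule kernel_L2_if_coefficients_square_summable[OF A, where R="?R"])
    show "(\<lambda>(x, s). kernel_entry K e e' (x, s)) \<in> borel_measurable (M \<Otimes>\<^sub>M M)"
      using kernel_entry_measurable[OF e(1)] by simp
    show "?R f \<in> L2 M" if "f \<in> L2 M" for f
      by (intro cinner_component_L2 L2.bounded_op_closed[OF kernel_op_bounded] tensor_L2 that)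
    show "AE s in M. integrable M (\<lambda>x. f x * kernel_entry K e e' (x, s)) \<and>
        ?R f s = (LINT x|M. f x * kernel_entry K e e' (x, s))" if "f \<in> L2 M" for f
      by (rule kernel_op_component[OF that e(1)])
    show "L2_functional M (\<lambda>f. L2_inner M (?R f) b)" if b: "b \<in> L2 M" for b
      unfolding L2_inner_tensor_right[symmetric]
      by (rule tensor_functional[OF L2.bounded_op_functional[OF kernel_op_bounded tensor_L2[OF b]]])
    show "(\<integral>\<^sup>+a. \<integral>\<^sup>+b. ennreal ((cmod (L2_inner M (?R a) b))\<^sup>2) \<partial>count_space A \<partial>count_space A) < \<infinity>"
      using Gfin unfolding G_def L2_inner_tensor_right .
  qed
  then show ?thesis by simp
qed

lemma nn_integral_hs_norm_sq_kernel:
  "(\<integral>\<^sup>+s. \<integral>\<^sup>+x. hs_norm_sq_H (K x s) \<partial>M \<partial>M) =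
   (\<integral>\<^sup>+e. \<integral>\<^sup>+e'. \<integral>\<^sup>+p. ennreal ((cmod (kernel_entry K e e' p))\<^sup>2) \<partial>(M \<Otimes>\<^sub>M M) \<partial>count_space basis_H \<partial>count_space basis_H)"
proof -
  note [measurable] = kernel_entry_measurable
  have hs: "hs_norm_sq_H (K x s) = (\<integral>\<^sup>+e. \<integral>\<^sup>+e'. ennreal ((cmod (kernel_entry K e e' (x, s)))\<^sup>2) \<partial>count_space basis_H \<partial>count_space basis_H)" for x s
    unfolding hs_norm_sq_H_altdef kernel_entry_def by (simp add: parseval_norm_H[symmetric])
  have m1: "(\<lambda>p. \<integral>\<^sup>+e'. ennreal ((cmod (kernel_entry K e e' p))\<^sup>2) \<partial>count_space basis_H) \<in> borel_measurable (M \<Otimes>\<^sub>M M)"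
    if "e \<in> basis_H" for e
    using that by (intro borel_measurable_nn_integral_count_space countable_basis_H) measurable
  note [measurable] = m1
  have m2: "(\<lambda>p. \<integral>\<^sup>+e. \<integral>\<^sup>+e'. ennreal ((cmod (kernel_entry K e e' p))\<^sup>2) \<partial>count_space basis_H \<partial>count_space basis_H) \<in> borel_measurable (M \<Otimes>\<^sub>M M)"
    by (intro borel_measurable_nn_integral_count_space countable_basis_H) measurable
  have "(\<integral>\<^sup>+s. \<integral>\<^sup>+x. hs_norm_sq_H (K x s) \<partial>M \<partial>M) =
     (\<integral>\<^sup>+p. \<integral>\<^sup>+e. \<integral>\<^sup>+e'. ennreal ((cmod (kernel_entry K e e' p))\<^sup>2) \<partial>count_space basis_H \<partial>count_space basis_H \<partial>(M \<Otimes>\<^sub>M M))"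
    unfolding hs by (rule MM.nn_integral_snd[OF m2])
  also have "\<dots> = (\<integral>\<^sup>+e. \<integral>\<^sup>+p. \<integral>\<^sup>+e'. ennreal ((cmod (kernel_entry K e e' p))\<^sup>2) \<partial>count_space basis_H \<partial>(M \<Otimes>\<^sub>M M) \<partial>count_space basis_H)"
    by (intro nn_integral_count_space_nn_integral countable_basis_H) measurable
  also have "\<dots> = (\<integral>\<^sup>+e. \<integral>\<^sup>+e'. \<integral>\<^sup>+p. ennreal ((cmod (kernel_entry K e e' p))\<^sup>2) \<partial>(M \<Otimes>\<^sub>M M) \<partial>count_space basis_H \<partial>count_space basis_H)"
    by (intro nn_integral_cong nn_integral_count_space_nn_integral countable_basis_H) measurable
  finally show ?thesis .
qed

lemma kernel_entry_L2_if_nn_integral_finite: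
  assumes fin: "(\<integral>\<^sup>+s. \<integral>\<^sup>+x. hs_norm_sq_H (K x s) \<partial>M \<partial>M) < \<infinity>" and e: "e \<in> basis_H" "e' \<in> basis_H"
  shows "kernel_entry K e e' \<in> L2 (M \<Otimes>\<^sub>M M)"
proof -
  define G where "G e e' = (\<integral>\<^sup>+p. ennreal ((cmod (kernel_entry K e e' p))\<^sup>2) \<partial>(M \<Otimes>\<^sub>M M))" for e e'
  have "G e e' \<le> (\<integral>\<^sup>+e'. G e e' \<partial>count_space basis_H)"
    using nn_integral_ge_point[of e' basis_H "\<lambda>e'. G e e'"] e by simp
  also have "\<dots> \<le> (\<integral>\<^sup>+e. \<integral>\<^sup>+e'. G e e' \<partial>count_space basis_H \<partial>count_space basis_H)"
    using nn_integral_ge_point[of e basis_H "\<lambda>e. \<integral>\<^sup>+e'. G e e' \<partial>count_space basis_H"] e by simp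
  also have "\<dots> < \<infinity>" using fin unfolding nn_integral_hs_norm_sq_kernel G_def .
  finally show ?thesis using kernel_entry_measurable[OF e(1)] unfolding L2_iff_nn_integral G_def by simp
qed

lemma hs_norm_sq_kernel_op_if_entries_L2:
  assumes L: "\<And>e e'. e \<in> basis_H \<Longrightarrow> e' \<in> basis_H \<Longrightarrow> kernel_entry K e e' \<in> L2 (M \<Otimes>\<^sub>M M)"
  shows "hs_norm_sq (L2 M) (L2_inner M) T = (\<integral>\<^sup>+s. \<integral>\<^sup>+x. hs_norm_sq_H (K x s) \<partial>M \<partial>M)"
proof -
  define A :: "('a \<Rightarrow> complex) set" where "A = some_onb (L2 M) (L2_inner M)"
  have A: "is_onb (L2 M) (L2_inner M) A" unfolding A_def by (rule L2.some_onb)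
  have AL: "A \<subseteq> L2 M" by (rule L2.onb_subset[OF A])
  show ?thesis
    unfolding hs_norm_sq_tensor_basis[OF A kernel_op_bounded] nn_integral_hs_norm_sq_kernel
  proof (rule nn_integral_cong, rule nn_integral_cong)
    fix e e' :: 'h assume "e \<in> space (count_space basis_H)" "e' \<in> space (count_space basis_H)"
    then have e: "e \<in> basis_H" "e' \<in> basis_H" by auto
    show "(\<integral>\<^sup>+a. \<integral>\<^sup>+a'. ennreal ((cmod (L2_inner M (T (tensor a e)) (tensor a' e')))\<^sup>2) \<partial>count_space A \<partial>count_space A) =
       (\<integral>\<^sup>+p. ennreal ((cmod (kernel_entry K e e' p))\<^sup>2) \<partial>(M \<Otimes>\<^sub>M M))"
      unfolding ptensor_parseval_sq[OF A L[OF e]]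
      using AL by (intro nn_integral_cong) (auto simp: kernel_op_coefficient[OF _ _ e(1) L[OF e]] subset_iff)
  qed
qed

text \<open>
  Under either hypothesis the entries of the kernel are square integrable, and Parseval's identity applies
  to each of them.
\<close>

theorem hs_norm_sq_kernel_op:
  assumes "hs_norm_sq (L2 M) (L2_inner M) T < \<infinity> \<or> (\<integral>\<^sup>+s. \<integral>\<^sup>+x. hs_norm_sq_H (K x s) \<partial>M \<partial>M) < \<infinity>"
  shows "hs_norm_sq (L2 M) (L2_inner M) T = (\<integral>\<^sup>+s. \<integral>\<^sup>+x. hs_norm_sq_H (K x s) \<partial>M \<partial>M)"
  using assms kernel_entry_L2_if_hilbert_schmidt kernel_entry_L2_if_nn_integral_finite
  by (intro hs_norm_sq_kernel_op_if_entries_L2) blast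

end

text \<open>
  For fixed \<open>e\<close> and \<open>e'\<close>, the coefficients of the entry of \<open>KQ\<close> are paired with those of the
  entry of \<open>KP\<close> with exchanged arguments, and Parseval's identity gives the integral. The double series
  for the trace is absolutely convergent and may be grouped in this way.
\<close>

theorem op_trace_kernel_ops:
  fixes KP KQ :: "'a \<Rightarrow> 'a \<Rightarrow> 'h \<Rightarrow> 'h::{chilbert_space, second_countable_topology}"
  assumes P: "kernel_op M KP P" "hs_norm_sq (L2 M) (L2_inner M) P < \<infinity>"
    and Q: "kernel_op M KQ Q" "hs_norm_sq (L2 M) (L2_inner M) Q < \<infinity>"
  shows "((\<lambda>(e, e'). LINT p|(M \<Otimes>\<^sub>M M). kernel_entry KQ e e' p * kernel_entry KP e' e (snd p, fst p))
     has_sum op_trace (L2 M) (L2_inner M) (P \<circ> Q)) (basis_H \<times> basis_H)"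
proof -
  define A :: "('a \<Rightarrow> complex) set" where "A = some_onb (L2 M) (L2_inner M)"
  have A: "is_onb (L2 M) (L2_inner M) A" unfolding A_def by (rule L2.some_onb)
  have AL: "A \<subseteq> L2 M" by (rule L2.onb_subset[OF A])
  define B :: "('a \<Rightarrow> 'h) set" where "B = tensor_basis A"
  have B: "is_onb (L2 M) (L2_inner M) B" unfolding B_def by (rule tensor_basis_onb[OF A])
  note Pb = kernel_op_bounded[OF P(1)] and Qb = kernel_op_bounded[OF Q(1)]
  let ?\<tau> = "op_trace (L2 M) (L2_inner M) (P \<circ> Q)"
  let ?F = "\<lambda>a e a' e'. L2_inner M (Q (tensor a e)) (tensor a' e') * L2_inner M (P (tensor a' e')) (tensor a e)"
  have "((\<lambda>(b, c). L2_inner M (Q b) c * L2_inner M (P c) b) has_sum ?\<tau>) (B \<times> B)"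
    unfolding L2.op_trace_comp[OF Pb P(2) Qb Q(2) B]
    by (rule has_sum_infsum[OF L2.trace_double_summable[OF Pb P(2) Qb Q(2) B B]])
  moreover have "bij_betw (\<lambda>((e, e'), (a, a')). (tensor a e, tensor a' e'))
      ((basis_H \<times> basis_H) \<times> (A \<times> A)) (B \<times> B)"
  proof -
    have t: "bij_betw (\<lambda>(a, e). tensor a e) (A \<times> basis_H) B"
      unfolding B_def tensor_basis_def by (intro inj_on_imp_bij_betw tensor_inj_on[OF A])
    have 1: "bij_betw (map_prod (\<lambda>(a, e). tensor a e) (\<lambda>(a, e). tensor a e))
        ((A \<times> basis_H) \<times> (A \<times> basis_H)) (B \<times> B)"
      by (rule bij_betw_map_prod[OF t t])
    have 2: "bij_betw (\<lambda>((e, e'), (a, a')). ((a, e), (a', e')))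
        ((basis_H \<times> basis_H) \<times> (A \<times> A)) ((A \<times> basis_H) \<times> (A \<times> (basis_H::'h set)))"
      by (rule bij_betw_byWitness[where f'="\<lambda>((a, e), (a', e')). ((e, e'), (a, a'))"]) auto
    show ?thesis using bij_betw_trans[OF 2 1] by (simp add: comp_def case_prod_beta')
  qed
  ultimately have "((\<lambda>((e, e'), (a, a')). ?F a e a' e') has_sum ?\<tau>) ((basis_H \<times> basis_H) \<times> (A \<times> A))"
    by (subst (asm) has_sum_reindex_bij_betw[symmetric]) (auto simp: case_prod_beta')
  then show ?thesis
  proof (rule has_sum_SigmaD)
    fix ee :: "'h \<times> 'h" assume ee: "ee \<in> basis_H \<times> basis_H"
    then obtain e e' where e: "ee = (e, e')" "e \<in> basis_H" "e' \<in> basis_H" by auto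
    note LQ = kernel_entry_L2_if_hilbert_schmidt[OF Q e(2,3)]
    note LP = kernel_entry_L2_if_hilbert_schmidt[OF P e(3,2)]
    note [measurable] = L2_measurable[OF LQ] L2_measurable[OF LP]
    \<comment> \<open>conjugated because the second factor enters Parseval's identity in the second argument\<close>
    define w where "w p = cnj (kernel_entry KP e' e (snd p, fst p))" for p
    have [measurable]: "w \<in> borel_measurable (M \<Otimes>\<^sub>M M)" unfolding w_def by measurable
    have "(\<integral>\<^sup>+p. ennreal ((norm (w p))\<^sup>2) \<partial>(M \<Otimes>\<^sub>M M)) =
        (\<integral>\<^sup>+x. \<integral>\<^sup>+s. ennreal ((norm (w (x, s)))\<^sup>2) \<partial>M \<partial>M)"
      by (rule nn_integral_fst[symmetric]) measurable
    also have "\<dots> = (\<integral>\<^sup>+x. \<integral>\<^sup>+s. ennreal ((norm (kernel_entry KP e' e (s, x)))\<^sup>2) \<partial>M \<partial>M)"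
      by (simp add: w_def)
    also have "\<dots> = (\<integral>\<^sup>+p. ennreal ((norm (kernel_entry KP e' e p))\<^sup>2) \<partial>(M \<Otimes>\<^sub>M M))"
      by (rule MM.nn_integral_snd) measurable
    finally have w: "w \<in> L2 (M \<Otimes>\<^sub>M M)"
      unfolding L2_iff_nn_integral using L2_nn_integral_finite[OF LP] by simp
    have pw: "L2_inner (M \<Otimes>\<^sub>M M) (ptensor a b) w = L2_inner M (P (tensor b e')) (tensor a e)"
      if a: "a \<in> L2 M" and b: "b \<in> L2 M" for a b
    proof -
      note [measurable] = L2_measurable[OF a] L2_measurable[OF b]
      have "L2_inner M (P (tensor b e')) (tensor a e) =
          integral\<^sup>L (M \<Otimes>\<^sub>M M) (\<lambda>p. kernel_entry KP e' e p * (b (fst p) * cnj (a (snd p))))"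
        unfolding kernel_op_coefficient[OF P(1) b a e(3) LP]
        unfolding L2_inner_def ptensor_def cinner_complex_def by simp
      also have "\<dots> = (LINT (x, y)|(M \<Otimes>\<^sub>M M). kernel_entry KP e' e (y, x) * (b y * cnj (a x)))"
      proof -
        have "(\<lambda>p. kernel_entry KP e' e p * (b (fst p) * cnj (a (snd p)))) \<in> borel_measurable (M \<Otimes>\<^sub>M M)"
          by measurable
        from MM.integral_product_swap[OF this] show ?thesis by simp
      qed
      also have "\<dots> = L2_inner (M \<Otimes>\<^sub>M M) (ptensor a b) w"
        unfolding L2_inner_def ptensor_def cinner_complex_def w_def by (simp add: case_prod_beta' mult_ac)
      finally show ?thesis ..
    qed
    have "((\<lambda>(a, a'). ?F a e a' e') has_sum L2_inner (M \<Otimes>\<^sub>M M) (kernel_entry KQ e e') w) (A \<times> A)"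
      using ptensor_parseval[OF A LQ w]
    proof (rule has_sum_cong[THEN iffD1, rotated])
      fix z assume "z \<in> A \<times> A"
      then obtain a a' where z: "z = (a, a')" "a \<in> L2 M" "a' \<in> L2 M" using AL by auto
      show "(case z of (a, b) \<Rightarrow> L2_inner (M \<Otimes>\<^sub>M M) (kernel_entry KQ e e') (ptensor a b) *
            L2_inner (M \<Otimes>\<^sub>M M) (ptensor a b) w) = (case z of (a, a') \<Rightarrow> ?F a e a' e')"
        by (simp add: z pw kernel_op_coefficient[OF Q(1) z(2,3) e(2) LQ])
    qed
    then show "((\<lambda>y. (\<lambda>((e, e'), (a, a')). ?F a e a' e') (ee, y)) has_sum
        (\<lambda>(e, e'). LINT p|(M \<Otimes>\<^sub>M M). kernel_entry KQ e e' p * kernel_entry KP e' e (snd p, fst p)) ee) (A \<times> A)"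
      by (simp add: e(1) L2_inner_def w_def cinner_complex_def)
  qed
qed

end

section \<open>Splitting off a coordinate of a path\<close>

lemma (in product_sigma_finite) PiM_insert_eq_distr:
  assumes I: "finite I" "i \<notin> I"
  shows "distr (PiM I M \<Otimes>\<^sub>M M i) (PiM (insert i I) M) (\<lambda>(x, y). x(i := y)) = PiM (insert i I) M"
proof (rule measure_eqI)
  fix A assume "A \<in> sets (distr (PiM I M \<Otimes>\<^sub>M M i) (PiM (insert i I) M) (\<lambda>(x, y). x(i := y)))"
  then have A[measurable]: "A \<in> sets (PiM (insert i I) M)" by simp
  have upd[measurable]: "(\<lambda>(x, y). x(i := y)) \<in> measurable (PiM I M \<Otimes>\<^sub>M M i) (PiM (insert i I) M)"
    by (rule measurable_add_dim)
  have "emeasure (distr (PiM I M \<Otimes>\<^sub>M M i) (PiM (insert i I) M) (\<lambda>(x, y). x(i := y))) A =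
      (\<integral>\<^sup>+\<omega>. indicator A \<omega> \<partial>distr (PiM I M \<Otimes>\<^sub>M M i) (PiM (insert i I) M) (\<lambda>(x, y). x(i := y)))"
    by simp
  also have "\<dots> = (\<integral>\<^sup>+p. indicator A ((\<lambda>(x, y). x(i := y)) p) \<partial>(PiM I M \<Otimes>\<^sub>M M i))"
    by (rule nn_integral_distr[OF upd]) measurable
  also have "\<dots> = (\<integral>\<^sup>+x. \<integral>\<^sup>+y. indicator A (x(i := y)) \<partial>M i \<partial>PiM I M)"
    by (subst sigma_finite_measure.nn_integral_fst[OF sigma_finite_measures, symmetric]) simp_all
  also have "\<dots> = (\<integral>\<^sup>+\<omega>. indicator A \<omega> \<partial>PiM (insert i I) M)"
    by (rule product_nn_integral_insert[OF I, symmetric]) measurable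
  finally show "emeasure (distr (PiM I M \<Otimes>\<^sub>M M i) (PiM (insert i I) M) (\<lambda>(x, y). x(i := y))) A =
      emeasure (PiM (insert i I) M) A"
    by simp
qed simp

text \<open>
  The new coordinate is integrated last. The powers of \<open>T\<close> use this for the last point of a path, the
  kernels of the powers for the first one.
\<close>

lemma (in product_sigma_finite) integral_PiM_insert:
  fixes f :: "_ \<Rightarrow> 'b::{banach, second_countable_topology}"
  assumes I: "finite I" "i \<notin> I" and f: "integrable (PiM (insert i I) M) f"
  shows "AE y in M i. integrable (PiM I M) (\<lambda>x. f (x(i := y)))"
    and "integrable (M i) (\<lambda>y. LINT x|PiM I M. f (x(i := y)))"
    and "integral\<^sup>L (PiM (insert i I) M) f = (LINT y|M i. LINT x|PiM I M. f (x(i := y)))"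
proof -
  interpret pair_sigma_finite "PiM I M" "M i"
    by (intro pair_sigma_finite.intro sigma_finite sigma_finite_measures I)
  have upd: "(\<lambda>(x, y). x(i := y)) \<in> measurable (PiM I M \<Otimes>\<^sub>M M i) (PiM (insert i I) M)"
    by (rule measurable_add_dim)
  have int: "integrable (PiM I M \<Otimes>\<^sub>M M i) (\<lambda>(x, y). f (x(i := y)))"
    using integrable_distr[OF upd, of f] f unfolding PiM_insert_eq_distr[OF I]
    by (simp add: case_prod_beta')
  show "AE y in M i. integrable (PiM I M) (\<lambda>x. f (x(i := y)))"
    and "integrable (M i) (\<lambda>y. LINT x|PiM I M. f (x(i := y)))"
    using AE_integrable_snd[OF int] integrable_snd[OF int] by simp_all
  have "integral\<^sup>L (PiM (insert i I) M) f = integral\<^sup>L (PiM I M \<Otimes>\<^sub>M M i) (\<lambda>p. f ((\<lambda>(x, y). x(i := y)) p))"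
    using integral_distr[OF upd borel_measurable_integrable[OF f]] unfolding PiM_insert_eq_distr[OF I] .
  then show "integral\<^sup>L (PiM (insert i I) M) f = (LINT y|M i. LINT x|PiM I M. f (x(i := y)))"
    unfolding integral_snd[OF int] by (simp add: case_prod_beta')
qed

lemma integral_scaleC_right:
  fixes f :: "'a \<Rightarrow> 'h::{chilbert_space, second_countable_topology}"
  shows "(LINT x|M. c *\<^sub>C f x) = c *\<^sub>C (LINT x|M. f x)"
proof (cases "c = 0 \<or> integrable M f")
  case True
  then show ?thesis
    using integral_bounded_linear[OF bounded_bilinear.bounded_linear_right[OF bounded_bilinear_scaleC]] by auto
next
  case False
  then have c: "c \<noteq> 0" and nf: "\<not> integrable M f" by auto
  have "\<not> integrable M (\<lambda>x. c *\<^sub>C f x)"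
  proof
    assume "integrable M (\<lambda>x. c *\<^sub>C f x)"
    from integrable_scaleC_right[OF this, of "inverse c"] c nf show False by (simp add: scaleC_scaleC)
  qed
  then show ?thesis using nf by (simp add: not_integrable_integral_eq)
qed

lemma ennreal_mult_le_sum_squares: "(a::ennreal) * b \<le> a\<^sup>2 + b\<^sup>2"
proof (cases "a \<le> b")
  case True
  then have "a * b \<le> b * b" by (intro mult_right_mono) auto
  also have "\<dots> \<le> a\<^sup>2 + b\<^sup>2" by (simp add: power2_eq_square)
  finally show ?thesis .
next
  case False
  then have "a * b \<le> a * a" by (intro mult_left_mono) auto
  also have "\<dots> \<le> a\<^sup>2 + b\<^sup>2" by (simp add: power2_eq_square)
  finally show ?thesis .
qed

text \<open>
  The theorem of Fubini for the product with a counting measure.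
\<close>

lemma has_sum_integral:
  fixes f :: "'i \<Rightarrow> 'a \<Rightarrow> complex"
  assumes N: "sigma_finite_measure N" and I: "countable I" and m: "\<And>i. i \<in> I \<Longrightarrow> f i \<in> borel_measurable N"
    and fin: "(\<integral>\<^sup>+x. \<integral>\<^sup>+i. ennreal (cmod (f i x)) \<partial>count_space I \<partial>N) < \<infinity>"
  shows "integrable N (\<lambda>x. LINT i|count_space I. f i x)"
    and "((\<lambda>i. LINT x|N. f i x) has_sum (LINT x|N. LINT i|count_space I. f i x)) I"
    and "i \<in> I \<Longrightarrow> integrable N (f i)"
proof -
  interpret N: sigma_finite_measure N by (rule N)
  interpret I: sigma_finite_measure "count_space I" by (rule sigma_finite_measure_count_space_countable[OF I])
  interpret pair_sigma_finite N "count_space I" ..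
  have [measurable]: "(\<lambda>(x, i). f i x) \<in> borel_measurable (N \<Otimes>\<^sub>M count_space I)"
    by (rule borel_measurable_pair_count_space[OF I m])
  have int: "integrable (N \<Otimes>\<^sub>M count_space I) (\<lambda>(x, i). f i x)"
  proof (rule integrableI_bounded)
    have "(\<integral>\<^sup>+p. ennreal (norm (case p of (x, i) \<Rightarrow> f i x)) \<partial>(N \<Otimes>\<^sub>M count_space I)) =
      (\<integral>\<^sup>+x. \<integral>\<^sup>+i. ennreal (norm (case (x, i) of (x, i) \<Rightarrow> f i x)) \<partial>count_space I \<partial>N)"
      by (rule I.nn_integral_fst[symmetric]) measurable
    then show "(\<integral>\<^sup>+p. ennreal (norm (case p of (x, i) \<Rightarrow> f i x)) \<partial>(N \<Otimes>\<^sub>M count_space I)) < \<infinity>"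
      using fin by simp
  qed measurable
  show "integrable N (\<lambda>x. LINT i|count_space I. f i x)" by (rule integrable_fst[OF int])
  show "((\<lambda>i. LINT x|N. f i x) has_sum (LINT x|N. LINT i|count_space I. f i x)) I"
    unfolding has_sum_complex_iff_integral
    using integrable_snd[OF int] integral_snd[OF int] integral_fst[OF int] by simp
  show "integrable N (f i)" if "i \<in> I"
    using AE_integrable_snd[OF int] that by (simp add: AE_count_space)
qed

lemma chain_cong:
  "(\<And>j. j \<in> {1..n} \<Longrightarrow> x j = y j) \<Longrightarrow> chain S n x = chain S n y"
  by (induction n) auto

section \<open>Products of the kernel along paths\<close>

locale operator_kernel = sigma_finite_measure M for M :: "'f measure" +
  fixes g :: "'f \<Rightarrow> 'f \<Rightarrow> complex"
    and S :: "'f \<Rightarrow> 'h \<Rightarrow> 'h::{chilbert_space, second_countable_topology}"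
  assumes g_measurable_pair: "(\<lambda>(x, s). g x s) \<in> borel_measurable (M \<Otimes>\<^sub>M M)"
    and S_bounded_clinear: "x \<in> space M \<Longrightarrow> bounded_clinear (S x)"
    and S_measurable [measurable]: "(\<lambda>x. S x v) \<in> borel_measurable M"
begin

sublocale MM: pair_sigma_finite M M ..
sublocale PM: product_sigma_finite "\<lambda>_::nat. M" by unfold_locales

lemma g_measurable [measurable (raw)]:
  assumes "a \<in> measurable N M" "b \<in> measurable N M"
  shows "(\<lambda>\<omega>. g (a \<omega>) (b \<omega>)) \<in> borel_measurable N"
  using measurable_compose[OF measurable_Pair[OF assms] g_measurable_pair] by simp

lemma apply_S_measurable [measurable (raw)]:
  assumes "a \<in> measurable N M" "w \<in> borel_measurable N"
  shows "(\<lambda>\<omega>. S (a \<omega>) (w \<omega>)) \<in> borel_measurable N"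
  by (rule borel_measurable_apply_operator[OF S_bounded_clinear S_measurable assms])

definition hs_S :: "'f \<Rightarrow> ennreal" where "hs_S x = ennreal_sqrt (hs_norm_sq_H (S x))"

lemma hs_S_measurable [measurable]: "hs_S \<in> borel_measurable M"
  unfolding hs_S_def
  by (intro borel_measurable_ennreal_sqrt borel_measurable_hs_norm_sq_H S_measurable)

text \<open>
  The scalar kernel that dominates everything. It is an extended real, since the Hilbert-Schmidt norm of
  \<open>S x\<close> may be infinite where \<open>g x\<close> vanishes.
\<close>

definition kernel_bound :: "'f \<Rightarrow> 'f \<Rightarrow> ennreal" where
  "kernel_bound x s = ennreal (cmod (g x s)) * hs_S x"

lemma kernel_bound_measurable [measurable (raw)]:
  assumes [measurable]: "a \<in> measurable N M" "b \<in> measurable N M"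
  shows "(\<lambda>\<omega>. kernel_bound (a \<omega>) (b \<omega>)) \<in> borel_measurable N"
  unfolding kernel_bound_def by measurable

text \<open>
  The scalar factor of a path \<open>x 1, \<dots>, x n\<close> that ends in \<open>s\<close>.
\<close>

definition weight :: "nat \<Rightarrow> (nat \<Rightarrow> 'f) \<Rightarrow> 'f \<Rightarrow> complex" where
  "weight n x s = (\<Prod>j=1..n-1. g (x j) (x (j + 1))) * g (x n) s"

definition weight_bound :: "nat \<Rightarrow> (nat \<Rightarrow> 'f) \<Rightarrow> 'f \<Rightarrow> ennreal" where
  "weight_bound n x s = (\<Prod>j=1..n-1. kernel_bound (x j) (x (j + 1))) * kernel_bound (x n) s"

lemma weight_measurable:
  assumes n: "n \<ge> 1" and X[measurable]: "\<And>j. j \<in> {1..n} \<Longrightarrow> (\<lambda>\<omega>. X \<omega> j) \<in> measurable N M"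
    and [measurable]: "s \<in> measurable N M"
  shows "(\<lambda>\<omega>. weight n (X \<omega>) (s \<omega>)) \<in> borel_measurable N"
    and "(\<lambda>\<omega>. weight_bound n (X \<omega>) (s \<omega>)) \<in> borel_measurable N"
proof -
  have *: "(\<lambda>\<omega>. X \<omega> n) \<in> measurable N M" using n by (intro X) auto
  show "(\<lambda>\<omega>. weight n (X \<omega>) (s \<omega>)) \<in> borel_measurable N"
    unfolding weight_def using n
    by (intro borel_measurable_times borel_measurable_prod g_measurable X *) auto
  show "(\<lambda>\<omega>. weight_bound n (X \<omega>) (s \<omega>)) \<in> borel_measurable N"
    unfolding weight_bound_def using n
    by (intro borel_measurable_times_ennreal borel_measurable_prod_ennreal kernel_bound_measurable X *) auto
qed

lemma chain_measurable:
  assumes "\<And>j. j \<in> {1..n} \<Longrightarrow> (\<lambda>\<omega>. X \<omega> j) \<in> measurable N M" "w \<in> borel_measurable N"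
  shows "(\<lambda>\<omega>. chain S n (X \<omega>) (w \<omega>)) \<in> borel_measurable N"
  using assms
proof (induction n)
  case (Suc n)
  have "(\<lambda>\<omega>. S (X \<omega> (Suc n)) (chain S n (X \<omega>) (w \<omega>))) \<in> borel_measurable N"
    by (intro apply_S_measurable Suc.IH Suc.prems) (use Suc.prems(1) in auto)
  then show ?case by simp
qed simp

abbreviation paths :: "nat \<Rightarrow> (nat \<Rightarrow> 'f) measure" where "paths n \<equiv> \<Pi>\<^sub>M i\<in>{1..n}. M"
abbreviation tails :: "nat \<Rightarrow> (nat \<Rightarrow> 'f) measure" where "tails n \<equiv> \<Pi>\<^sub>M i\<in>{2..n}. M"

lemma paths_coordinate: "Z \<in> measurable N (paths n) \<Longrightarrow> j \<in> {1..n} \<Longrightarrow> (\<lambda>\<omega>. Z \<omega> j) \<in> measurable N M"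
  by (rule measurable_compose[OF _ measurable_component_singleton]) auto

lemma tails_coordinate:
  assumes "Z \<in> measurable N (tails n)" "Y \<in> measurable N M" "j \<in> {1..n}"
  shows "(\<lambda>\<omega>. ((Z \<omega>)(1 := Y \<omega>)) j) \<in> measurable N M"
proof (cases "j = 1")
  case False
  then have "(\<lambda>\<omega>. Z \<omega> j) \<in> measurable N M"
    using assms by (intro measurable_compose[OF assms(1) measurable_component_singleton]) auto
  then show ?thesis using False by simp
qed (use assms in simp)

lemma paths_Suc: "{1..Suc n :: nat} = insert (Suc n) {1..n}" by auto
lemma paths_insert: "n \<ge> 1 \<Longrightarrow> {1..n :: nat} = insert 1 {2..n}" by auto
lemma tails_Suc: "n \<ge> 1 \<Longrightarrow> {2..Suc n :: nat} = insert (Suc n) {2..n}" by auto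

lemma weight_Suc:
  assumes n: "n \<ge> 1"
  shows "weight (Suc n) (x(Suc n := y)) s = weight n x y * g y s"
    and "weight_bound (Suc n) (x(Suc n := y)) s = weight_bound n x y * kernel_bound y s"
proof -
  obtain m where m: "n = Suc m" using n by (cases n) auto
  have "(\<Prod>j=1..m. g ((x(Suc n := y)) j) ((x(Suc n := y)) (j + 1))) = (\<Prod>j=1..m. g (x j) (x (j + 1)))"
    by (intro prod.cong) (auto simp: m)
  then show "weight (Suc n) (x(Suc n := y)) s = weight n x y * g y s"
    by (simp add: weight_def m)
  have "(\<Prod>j=1..m. kernel_bound ((x(Suc n := y)) j) ((x(Suc n := y)) (j + 1))) = (\<Prod>j=1..m. kernel_bound (x j) (x (j + 1)))"
    by (intro prod.cong) (auto simp: m)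
  then show "weight_bound (Suc n) (x(Suc n := y)) s = weight_bound n x y * kernel_bound y s"
    by (simp add: weight_bound_def m)
qed

lemma chain_Suc_upd: "chain S (Suc n) (x(Suc n := y)) v = S y (chain S n x v)"
  using chain_cong[of n "x(Suc n := y)" x S] by simp

lemma chain_bounded_clinear:
  "(\<And>j. j \<in> {1..n} \<Longrightarrow> x j \<in> space M) \<Longrightarrow> bounded_clinear (chain S n x)"
  by (induction n) (auto intro!: bounded_clinear_comp S_bounded_clinear bounded_clinear_id)

lemma norm_chain_le:
  "(\<And>j. j \<in> {1..n} \<Longrightarrow> x j \<in> space M) \<Longrightarrow>
     ennreal (norm (chain S n x v)) \<le> (\<Prod>j=1..n. hs_S (x j)) * ennreal (norm v)"
proof (induction n)
  case (Suc n)
  have "ennreal (norm (chain S (Suc n) x v)) \<le> hs_S (x (Suc n)) * ennreal (norm (chain S n x v))"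
    using norm_le_hs_norm[OF S_bounded_clinear, of "x (Suc n)"] Suc.prems by (simp add: hs_S_def)
  also have "\<dots> \<le> hs_S (x (Suc n)) * ((\<Prod>j=1..n. hs_S (x j)) * ennreal (norm v))"
    using Suc by (intro mult_left_mono) auto
  finally show ?case by (simp add: mult_ac)
qed simp

lemma hs_chain_le:
  assumes "n \<ge> 1" "\<And>j. j \<in> {1..n} \<Longrightarrow> x j \<in> space M"
  shows "ennreal_sqrt (hs_norm_sq_H (chain S n x)) \<le> (\<Prod>j=1..n. hs_S (x j))"
proof -
  have "hs_norm_sq_H (chain S n x) \<le> (\<Prod>j=1..n. hs_norm_sq_H (S (x j)))"
    using assms
  proof (induction n rule: nat_induct_at_least)
    case (Suc n)
    have "hs_norm_sq_H (chain S (Suc n) x) \<le> hs_norm_sq_H (S (x (Suc n))) * hs_norm_sq_H (chain S n x)"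
      unfolding chain.simps by (rule hs_norm_sq_H_comp_le[OF S_bounded_clinear]) (use Suc.prems in auto)
    also have "\<dots> \<le> hs_norm_sq_H (S (x (Suc n))) * (\<Prod>j=1..n. hs_norm_sq_H (S (x j)))"
      using Suc.IH Suc.prems by (intro mult_left_mono) auto
    also have "\<dots> = (\<Prod>j=1..Suc n. hs_norm_sq_H (S (x j)))"
      by (subst prod.nat_ivl_Suc') (auto simp: mult.commute)
    finally show ?case .
  qed simp
  then have "(ennreal_sqrt (hs_norm_sq_H (chain S n x)))\<^sup>2 \<le> (\<Prod>j=1..n. hs_S (x j))\<^sup>2"
    unfolding hs_S_def by (simp only: prod_power_distrib ennreal_sqrt_power2)
  then show ?thesis by (rule ennreal_le_if_power2_le)
qed

lemma weight_bound_eq: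
  assumes "n \<ge> 1"
  shows "weight_bound n x s = ennreal (cmod (weight n x s)) * (\<Prod>j=1..n. hs_S (x j))"
proof -
  obtain m where m: "n = Suc m" using assms by (cases n) auto
  have "(\<Prod>j=1..m. ennreal (cmod (g (x j) (x (j + 1))))) = ennreal (\<Prod>j=1..m. cmod (g (x j) (x (j + 1))))"
    by (rule prod_ennreal) simp
  then show ?thesis
    by (simp add: m weight_bound_def weight_def kernel_bound_def prod.distrib norm_mult prod_norm[symmetric]
        ennreal_mult prod_nonneg mult_ac)
qed

lemma norm_path_le:
  assumes n: "n \<ge> 1" and x: "\<And>j. j \<in> {1..n} \<Longrightarrow> x j \<in> space M"
  shows "ennreal (norm (weight n x s *\<^sub>C chain S n x v)) \<le> weight_bound n x s * ennreal (norm v)"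
  using mult_left_mono[OF norm_chain_le[of n x v, OF x], of "ennreal (cmod (weight n x s))"]
  by (simp add: weight_bound_eq[OF n] ennreal_mult mult_ac)

text \<open>
  A composition of two Hilbert-Schmidt operators has an absolutely convergent trace; here
  \<open>S (x n)\<close> is separated from the others, which needs \<open>n \<ge> 2\<close>.
\<close>

lemma nn_integral_trace_path_le:
  assumes n: "n \<ge> 2" and x: "\<And>j. j \<in> {1..n} \<Longrightarrow> x j \<in> space M"
  shows "(\<integral>\<^sup>+e. ennreal (cmod (weight n x s * cinner (chain S n x e) e)) \<partial>count_space basis_H) \<le> weight_bound n x s"
proof -
  obtain m where m: "n = Suc m" "m \<ge> 1" using n by (cases n) auto
  have "(\<integral>\<^sup>+e. ennreal (cmod (cinner (chain S n x e) e)) \<partial>count_space basis_H)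
      \<le> hs_S (x n) * ennreal_sqrt (hs_norm_sq_H (chain S m x))"
    using nn_integral_trace_H_le[OF S_bounded_clinear[of "x n"] chain_bounded_clinear[of m x]] x
    unfolding hs_S_def by (auto simp: m)
  also have "\<dots> \<le> hs_S (x n) * (\<Prod>j=1..m. hs_S (x j))"
    using hs_chain_le[OF m(2), of x] x by (intro mult_left_mono) (auto simp: m)
  finally have *: "(\<integral>\<^sup>+e. ennreal (cmod (cinner (chain S n x e) e)) \<partial>count_space basis_H) \<le> (\<Prod>j=1..n. hs_S (x j))"
    by (simp add: m mult_ac)
  have "(\<integral>\<^sup>+e. ennreal (cmod (weight n x s * cinner (chain S n x e) e)) \<partial>count_space basis_H) =
      ennreal (cmod (weight n x s)) * (\<integral>\<^sup>+e. ennreal (cmod (cinner (chain S n x e) e)) \<partial>count_space basis_H)"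
    by (simp add: norm_mult ennreal_mult nn_integral_cmult)
  also have "\<dots> \<le> weight_bound n x s"
    using n * by (subst weight_bound_eq) (auto intro: mult_left_mono)
  finally show ?thesis .
qed

text \<open>
  The right-hand side of the formula for the squared Hilbert-Schmidt norm of \<open>T\<close>.
\<close>

definition total :: ennreal where "total = (\<integral>\<^sup>+s. \<integral>\<^sup>+y. (kernel_bound y s)\<^sup>2 \<partial>M \<partial>M)"

lemma total_eq:
  "total = (\<integral>\<^sup>+x. (\<integral>\<^sup>+s. ennreal ((cmod (g x s))\<^sup>2) \<partial>M) * hs_norm_sq_H (S x) \<partial>M)"
proof -
  have [measurable]: "(\<lambda>x. hs_norm_sq_H (S x)) \<in> borel_measurable M"
    by (intro borel_measurable_hs_norm_sq_H S_measurable)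
  have b: "(kernel_bound y s)\<^sup>2 = ennreal ((cmod (g y s))\<^sup>2) * hs_norm_sq_H (S y)" for y s
    by (simp add: kernel_bound_def hs_S_def power_mult_distrib ennreal_power)
  have "total = (\<integral>\<^sup>+x. \<integral>\<^sup>+s. (kernel_bound x s)\<^sup>2 \<partial>M \<partial>M)"
    unfolding total_def by (rule MM.Fubini') measurable
  also have "\<dots> = (\<integral>\<^sup>+x. (\<integral>\<^sup>+s. ennreal ((cmod (g x s))\<^sup>2) \<partial>M) * hs_norm_sq_H (S x) \<partial>M)"
    unfolding b by (intro nn_integral_cong nn_integral_multc) measurable
  finally show ?thesis .
qed

text \<open>
  The \<open>n\<close>-th power of the integral operator with kernel \<open>kernel_bound\<close>, applied to \<open>u\<close>.
\<close>

definition smear :: "nat \<Rightarrow> ('f \<Rightarrow> ennreal) \<Rightarrow> 'f \<Rightarrow> ennreal" where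
  "smear n u s = (\<integral>\<^sup>+x. weight_bound n x s * u (x 1) \<partial>paths n)"

lemma smear_measurable [measurable]:
  assumes n: "n \<ge> 1" and [measurable]: "u \<in> borel_measurable M"
  shows "smear n u \<in> borel_measurable M"
proof -
  interpret P: sigma_finite_measure "paths n" by (rule PM.sigma_finite) simp
  have [measurable]: "(\<lambda>\<omega>::'f \<times> (nat \<Rightarrow> 'f). snd \<omega> 1) \<in> measurable (M \<Otimes>\<^sub>M paths n) M"
    by (rule paths_coordinate[where n=n]) (use n in auto)
  have [measurable]: "(\<lambda>\<omega>::'f \<times> (nat \<Rightarrow> 'f). weight_bound n (snd \<omega>) (fst \<omega>)) \<in> borel_measurable (M \<Otimes>\<^sub>M paths n)"
    by (rule weight_measurable(2)[OF n], rule paths_coordinate[where n=n]) auto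
  have "(\<lambda>\<omega>. weight_bound n (snd \<omega>) (fst \<omega>) * u (snd \<omega> 1)) \<in> borel_measurable (M \<Otimes>\<^sub>M paths n)"
    by measurable
  then have "(\<lambda>s. \<integral>\<^sup>+x. weight_bound n x s * u (x 1) \<partial>paths n) \<in> borel_measurable M"
    by (intro P.borel_measurable_nn_integral) (simp add: case_prod_beta')
  then show ?thesis unfolding smear_def[abs_def] .
qed

lemma weight_path_measurable:
  assumes n: "n \<ge> 1" and s: "s \<in> space M" and u: "u \<in> borel_measurable M"
  shows "(\<lambda>x. weight_bound n x s * u (x 1)) \<in> borel_measurable (paths n)"
proof (rule borel_measurable_times_ennreal)
  show "(\<lambda>x. weight_bound n x s) \<in> borel_measurable (paths n)"
    by (rule weight_measurable(2)[OF n], rule paths_coordinate[where n=n]) (use s in auto)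
  show "(\<lambda>x. u (x 1)) \<in> borel_measurable (paths n)"
    by (rule measurable_compose[OF _ u], rule paths_coordinate[where n=n]) (use n in auto)
qed

lemma smear_1:
  assumes [measurable]: "u \<in> borel_measurable M" and [measurable]: "s \<in> space M"
  shows "smear 1 u s = (\<integral>\<^sup>+y. kernel_bound y s * u y \<partial>M)"
proof -
  have "smear 1 u s = (\<integral>\<^sup>+x. (\<lambda>y. kernel_bound y s * u y) (x 1) \<partial>(\<Pi>\<^sub>M i\<in>{1::nat}. M))"
    unfolding smear_def weight_bound_def by (simp del: One_nat_def)
  also have "\<dots> = (\<integral>\<^sup>+y. kernel_bound y s * u y \<partial>M)"
    by (rule PM.product_nn_integral_singleton) measurable
  finally show ?thesis .
qed

lemma smear_Suc:
  assumes n: "n \<ge> 1" and [measurable]: "u \<in> borel_measurable M" and s[measurable]: "s \<in> space M"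
  shows "smear (Suc n) u s = (\<integral>\<^sup>+y. kernel_bound y s * smear n u y \<partial>M)"
proof -
  have m: "(\<lambda>x. weight_bound (Suc n) x s * u (x 1)) \<in> borel_measurable (paths (Suc n))"
    using weight_path_measurable[of "Suc n" s u] s by simp
  have "smear (Suc n) u s = (\<integral>\<^sup>+y. \<integral>\<^sup>+x. weight_bound (Suc n) (x(Suc n := y)) s * u ((x(Suc n := y)) 1) \<partial>paths n \<partial>M)"
    unfolding smear_def paths_Suc
    by (rule PM.product_nn_integral_insert_rev[OF _ _ m[unfolded paths_Suc]]) auto
  also have "\<dots> = (\<integral>\<^sup>+y. \<integral>\<^sup>+x. kernel_bound y s * (weight_bound n x y * u (x 1)) \<partial>paths n \<partial>M)"
    using n by (simp add: weight_Suc mult_ac)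
  also have "\<dots> = (\<integral>\<^sup>+y. kernel_bound y s * smear n u y \<partial>M)"
    unfolding smear_def
  proof (intro nn_integral_cong nn_integral_cmult)
    fix y assume y: "y \<in> space M"
    show "(\<lambda>x. weight_bound n x y * u (x 1)) \<in> borel_measurable (paths n)"
      by (rule weight_path_measurable[OF n y]) measurable
  qed
  finally show ?thesis .
qed

lemma nn_integral_bound_sq_le:
  assumes [measurable]: "u \<in> borel_measurable M"
  shows "(\<integral>\<^sup>+s. (\<integral>\<^sup>+y. kernel_bound y s * u y \<partial>M)\<^sup>2 \<partial>M) \<le> total * (\<integral>\<^sup>+y. (u y)\<^sup>2 \<partial>M)"
proof -
  have "(\<integral>\<^sup>+s. (\<integral>\<^sup>+y. kernel_bound y s * u y \<partial>M)\<^sup>2 \<partial>M) \<le> (\<integral>\<^sup>+s. (\<integral>\<^sup>+y. (kernel_bound y s)\<^sup>2 \<partial>M) * (\<integral>\<^sup>+y. (u y)\<^sup>2 \<partial>M) \<partial>M)"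
    by (intro nn_integral_mono Cauchy_Schwarz_nn_integral) measurable
  also have "\<dots> = total * (\<integral>\<^sup>+y. (u y)\<^sup>2 \<partial>M)"
    unfolding total_def by (rule nn_integral_multc) measurable
  finally show ?thesis .
qed

lemma nn_integral_smear_sq_le:
  assumes n: "n \<ge> 1" and u[measurable]: "u \<in> borel_measurable M"
  shows "(\<integral>\<^sup>+s. (smear n u s)\<^sup>2 \<partial>M) \<le> total ^ n * (\<integral>\<^sup>+y. (u y)\<^sup>2 \<partial>M)"
  using n
proof (induction n rule: nat_induct_at_least)
  case base
  have "(\<integral>\<^sup>+s. (smear 1 u s)\<^sup>2 \<partial>M) = (\<integral>\<^sup>+s. (\<integral>\<^sup>+y. kernel_bound y s * u y \<partial>M)\<^sup>2 \<partial>M)"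
    by (intro nn_integral_cong) (simp add: smear_1[unfolded One_nat_def])
  then show ?case using nn_integral_bound_sq_le[OF u] by simp
next
  case (Suc n)
  have "(\<integral>\<^sup>+s. (smear (Suc n) u s)\<^sup>2 \<partial>M) = (\<integral>\<^sup>+s. (\<integral>\<^sup>+y. kernel_bound y s * smear n u y \<partial>M)\<^sup>2 \<partial>M)"
    by (intro nn_integral_cong) (simp add: smear_Suc[OF Suc.hyps])
  also have "\<dots> \<le> total * (\<integral>\<^sup>+y. (smear n u y)\<^sup>2 \<partial>M)"
    by (rule nn_integral_bound_sq_le[OF smear_measurable[OF Suc.hyps u]])
  also have "\<dots> \<le> total * (total ^ n * (\<integral>\<^sup>+y. (u y)\<^sup>2 \<partial>M))"
    by (intro mult_left_mono Suc.IH) simp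
  finally show ?case by (simp add: mult.assoc)
qed

lemma smear_finite_AE:
  assumes tot: "total < \<infinity>" and n: "n \<ge> 1" and f: "f \<in> L2 M"
  shows "AE s in M. smear n (\<lambda>y. ennreal (norm (f y))) s < \<infinity>"
proof -
  note [measurable] = L2_measurable[OF f]
  let ?u = "\<lambda>y. ennreal (norm (f y))"
  have u: "?u \<in> borel_measurable M" by measurable
  have "(\<integral>\<^sup>+s. (smear n ?u s)\<^sup>2 \<partial>M) \<le> total ^ n * (\<integral>\<^sup>+y. (?u y)\<^sup>2 \<partial>M)"
    by (rule nn_integral_smear_sq_le[OF n u])
  also have "\<dots> < \<infinity>"
    using tot L2_nn_integral_finite[OF f]
    by (simp add: ennreal_mult_less_top ennreal_power power_less_top_ennreal)
  finally have "AE s in M. (smear n ?u s)\<^sup>2 \<noteq> \<infinity>"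
    using smear_measurable[OF n u] by (intro nn_integral_PInf_AE) auto
  then show ?thesis by eventually_elim (auto simp: power2_eq_square ennreal_mult_eq_top_iff less_top)
qed

text \<open>
  The kernel of the \<open>n\<close>-th power of the integral operator with kernel \<open>kernel_bound\<close>. A path starts in \<open>y\<close> and the points \<open>x 2, \<dots>, x n\<close> are integrated
  out; for \<open>n = 1\<close> there are none.
\<close>

definition path_bound :: "nat \<Rightarrow> 'f \<Rightarrow> 'f \<Rightarrow> ennreal" where
  "path_bound n y s = (\<integral>\<^sup>+z. weight_bound n (z(1 := y)) s \<partial>tails n)"

lemma path_bound_measurable [measurable (raw)]:
  assumes n: "n \<ge> 1" and a: "a \<in> measurable N M" and b: "b \<in> measurable N M"
  shows "(\<lambda>\<omega>. path_bound n (a \<omega>) (b \<omega>)) \<in> borel_measurable N"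
proof -
  interpret Q: sigma_finite_measure "tails n" by (rule PM.sigma_finite) simp
  have "(\<lambda>\<omega>. weight_bound n ((snd \<omega>)(1 := a (fst \<omega>))) (b (fst \<omega>))) \<in> borel_measurable (N \<Otimes>\<^sub>M tails n)"
    by (intro weight_measurable n tails_coordinate[where n=n] measurable_compose[OF measurable_fst a]
        measurable_compose[OF measurable_fst b] measurable_snd)
  then show ?thesis unfolding path_bound_def
    by (intro Q.borel_measurable_nn_integral) (simp add: case_prod_beta')
qed

lemma path_bound_1: "path_bound 1 y s = kernel_bound y s"
  unfolding path_bound_def by (simp add: weight_bound_def space_PiM_empty)

lemma path_bound_Suc:
  assumes n: "n \<ge> 1" and y: "y \<in> space M" and s: "s \<in> space M"
  shows "path_bound (Suc n) y s = (\<integral>\<^sup>+t. path_bound n y t * kernel_bound t s \<partial>M)"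
proof -
  have "(\<lambda>z. weight_bound (Suc n) (z(1 := y)) s) \<in> borel_measurable (tails (Suc n))"
    by (intro weight_measurable tails_coordinate[where n="Suc n"]) (use y s in auto)
  then have "path_bound (Suc n) y s = (\<integral>\<^sup>+t. \<integral>\<^sup>+z. weight_bound (Suc n) ((z(Suc n := t))(1 := y)) s \<partial>tails n \<partial>M)"
    unfolding path_bound_def tails_Suc[OF n]
    by (intro PM.product_nn_integral_insert_rev) auto
  also have "\<dots> = (\<integral>\<^sup>+t. \<integral>\<^sup>+z. weight_bound n (z(1 := y)) t * kernel_bound t s \<partial>tails n \<partial>M)"
  proof -
    have "(z(Suc n := t))(1 := y) = (z(1 := y))(Suc n := t)" for z :: "nat \<Rightarrow> 'f" and t
      by (rule fun_upd_twist) (use n in simp)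
    then show ?thesis by (simp only: weight_Suc(2)[OF n])
  qed
  also have "\<dots> = (\<integral>\<^sup>+t. path_bound n y t * kernel_bound t s \<partial>M)"
    unfolding path_bound_def
  proof (intro nn_integral_cong nn_integral_multc)
    fix t assume t: "t \<in> space M"
    show "(\<lambda>z. weight_bound n (z(1 := y)) t) \<in> borel_measurable (tails n)"
      by (intro weight_measurable tails_coordinate[where n=n]) (use y t n in auto)
  qed
  finally show ?thesis .
qed

text \<open>
  The Hilbert-Schmidt norm is submultiplicative.
\<close>

lemma nn_integral_path_bound_sq_le:
  assumes n: "n \<ge> 1"
  shows "(\<integral>\<^sup>+s. \<integral>\<^sup>+y. (path_bound n y s)\<^sup>2 \<partial>M \<partial>M) \<le> total ^ n"
  using n
proof (induction n rule: nat_induct_at_least)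
  case base
  show ?case unfolding path_bound_1 total_def by simp
next
  case (Suc n)
  note [measurable (raw)] = path_bound_measurable[OF Suc.hyps]
  have "(\<integral>\<^sup>+s. \<integral>\<^sup>+y. (path_bound (Suc n) y s)\<^sup>2 \<partial>M \<partial>M) = (\<integral>\<^sup>+s. \<integral>\<^sup>+y. (\<integral>\<^sup>+t. path_bound n y t * kernel_bound t s \<partial>M)\<^sup>2 \<partial>M \<partial>M)"
    by (intro nn_integral_cong) (simp add: path_bound_Suc[OF Suc.hyps])
  also have "\<dots> \<le> (\<integral>\<^sup>+s. \<integral>\<^sup>+y. (\<integral>\<^sup>+t. (path_bound n y t)\<^sup>2 \<partial>M) * (\<integral>\<^sup>+t. (kernel_bound t s)\<^sup>2 \<partial>M) \<partial>M \<partial>M)"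
    by (intro nn_integral_mono Cauchy_Schwarz_nn_integral) measurable
  also have "\<dots> = (\<integral>\<^sup>+s. (\<integral>\<^sup>+y. \<integral>\<^sup>+t. (path_bound n y t)\<^sup>2 \<partial>M \<partial>M) * (\<integral>\<^sup>+t. (kernel_bound t s)\<^sup>2 \<partial>M) \<partial>M)"
    by (intro nn_integral_cong nn_integral_multc) measurable
  also have "\<dots> = (\<integral>\<^sup>+y. \<integral>\<^sup>+t. (path_bound n y t)\<^sup>2 \<partial>M \<partial>M) * total"
    unfolding total_def by (rule nn_integral_cmult) measurable
  also have "(\<integral>\<^sup>+y. \<integral>\<^sup>+t. (path_bound n y t)\<^sup>2 \<partial>M \<partial>M) = (\<integral>\<^sup>+t. \<integral>\<^sup>+y. (path_bound n y t)\<^sup>2 \<partial>M \<partial>M)"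
    by (rule MM.Fubini'[symmetric]) measurable
  also have "\<dots> * total \<le> total ^ n * total" by (intro mult_right_mono Suc.IH) simp
  finally show ?case by (simp add: mult.commute)
qed

text \<open>
  This holds for almost all end points and is independent of vectors in \<open>'h\<close>, which yields the
  integrability of the path kernels for all vectors simultaneously.
\<close>

lemma path_bound_finite_AE:
  assumes tot: "total < \<infinity>" and n: "n \<ge> 1"
  shows "AE s in M. AE y in M. path_bound n y s < \<infinity>"
proof -
  note [measurable (raw)] = path_bound_measurable[OF n]
  have "(\<integral>\<^sup>+s. \<integral>\<^sup>+y. (path_bound n y s)\<^sup>2 \<partial>M \<partial>M) < \<infinity>"
    using nn_integral_path_bound_sq_le[OF n] tot by (auto simp: power_less_top_ennreal intro: le_less_trans)
  then have "AE s in M. (\<integral>\<^sup>+y. (path_bound n y s)\<^sup>2 \<partial>M) \<noteq> \<infinity>"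
    by (intro nn_integral_PInf_AE) auto
  then show ?thesis using AE_space
  proof eventually_elim
    case (elim s)
    have [measurable]: "(\<lambda>y. path_bound n y s) \<in> borel_measurable M"
      by (intro path_bound_measurable[OF n]) (use elim in auto)
    have "AE y in M. (path_bound n y s)\<^sup>2 \<noteq> \<infinity>"
      using elim(1) by (intro nn_integral_PInf_AE) auto
    then show ?case by eventually_elim (auto simp: power2_eq_square ennreal_mult_eq_top_iff less_top)
  qed
qed

end

context operator_kernel
begin

section \<open>The integral operator and its powers\<close>

definition kernel1 :: "'f \<Rightarrow> 'f \<Rightarrow> 'h \<Rightarrow> 'h" where "kernel1 x s v = g x s *\<^sub>C S x v"

definition integral_op :: "('f \<Rightarrow> 'h) \<Rightarrow> 'f \<Rightarrow> 'h" where
  "integral_op f s = (LINT y|M. g y s *\<^sub>C S y (f y))"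

lemma hs_norm_sq_kernel1: "hs_norm_sq_H (kernel1 x s) = ennreal ((cmod (g x s))\<^sup>2) * hs_norm_sq_H (S x)"
  unfolding kernel1_def[abs_def] by (rule hs_norm_sq_H_scaleC)

lemma nn_integral_hs_norm_sq_kernel1: "(\<integral>\<^sup>+s. \<integral>\<^sup>+x. hs_norm_sq_H (kernel1 x s) \<partial>M \<partial>M) = total"
  unfolding total_def hs_norm_sq_kernel1 kernel_bound_def hs_S_def by (simp add: power_mult_distrib ennreal_power)

lemma integral_op_integrand_measurable [measurable]:
  assumes [measurable]: "f \<in> borel_measurable M" "s \<in> space M"
  shows "(\<lambda>y. g y s *\<^sub>C S y (f y)) \<in> borel_measurable M"
  by measurable

lemma integral_op_measurable:
  assumes [measurable]: "f \<in> borel_measurable M"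
  shows "integral_op f \<in> borel_measurable M"
  unfolding integral_op_def[abs_def] by measurable

lemma norm_integrand_le:
  assumes y: "y \<in> space M"
  shows "ennreal (norm (g y s *\<^sub>C S y v)) \<le> kernel_bound y s * ennreal (norm v)"
  using mult_left_mono[OF norm_le_hs_norm[OF S_bounded_clinear[OF y], of v], of "ennreal (cmod (g y s))"]
  by (simp add: kernel_bound_def hs_S_def ennreal_mult mult_ac)

lemma integral_op_integrable:
  assumes tot: "total < \<infinity>" and f: "f \<in> L2 M"
  shows "AE s in M. integrable M (\<lambda>y. g y s *\<^sub>C S y (f y))"
  using smear_finite_AE[OF tot order_refl f] AE_space
proof eventually_elim
  case (elim s)
  note [measurable] = L2_measurable[OF f] elim(2)
  have "(\<integral>\<^sup>+y. ennreal (norm (g y s *\<^sub>C S y (f y))) \<partial>M) \<le> (\<integral>\<^sup>+y. kernel_bound y s * ennreal (norm (f y)) \<partial>M)"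
    by (intro nn_integral_mono norm_integrand_le)
  also have "\<dots> < \<infinity>" using elim(1) by (subst (asm) smear_1) measurable
  finally show ?case by (intro integrableI_bounded integral_op_integrand_measurable elim(2) L2_measurable[OF f])
qed

lemma integral_op_L2:
  assumes f: "f \<in> L2 M"
  shows "(\<integral>\<^sup>+s. ennreal ((norm (integral_op f s))\<^sup>2) \<partial>M) \<le> total * (\<integral>\<^sup>+y. ennreal ((norm (f y))\<^sup>2) \<partial>M)"
    and "total < \<infinity> \<Longrightarrow> integral_op f \<in> L2 M"
proof -
  note [measurable] = L2_measurable[OF f] integral_op_measurable
  have le: "ennreal (norm (integral_op f s)) \<le> (\<integral>\<^sup>+y. kernel_bound y s * ennreal (norm (f y)) \<partial>M)" for s
  proof (cases "integrable M (\<lambda>y. g y s *\<^sub>C S y (f y))")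
    case True
    have "ennreal (norm (integral_op f s)) \<le> (\<integral>\<^sup>+y. ennreal (norm (g y s *\<^sub>C S y (f y))) \<partial>M)"
      unfolding integral_op_def by (rule integral_norm_bound_ennreal[OF True])
    also have "\<dots> \<le> (\<integral>\<^sup>+y. kernel_bound y s * ennreal (norm (f y)) \<partial>M)"
      by (intro nn_integral_mono norm_integrand_le)
    finally show ?thesis .
  qed (simp add: integral_op_def not_integrable_integral_eq)
  have "(\<integral>\<^sup>+s. ennreal ((norm (integral_op f s))\<^sup>2) \<partial>M) \<le> (\<integral>\<^sup>+s. (\<integral>\<^sup>+y. kernel_bound y s * ennreal (norm (f y)) \<partial>M)\<^sup>2 \<partial>M)"
    by (intro nn_integral_mono) (simp add: ennreal_power[symmetric] power_mono le)
  also have "\<dots> \<le> total * (\<integral>\<^sup>+y. (ennreal (norm (f y)))\<^sup>2 \<partial>M)"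
    by (rule nn_integral_bound_sq_le) measurable
  finally show *: "(\<integral>\<^sup>+s. ennreal ((norm (integral_op f s))\<^sup>2) \<partial>M) \<le> total * (\<integral>\<^sup>+y. ennreal ((norm (f y))\<^sup>2) \<partial>M)"
    by (simp add: ennreal_power)
  assume "total < \<infinity>"
  then have "total * (\<integral>\<^sup>+y. ennreal ((norm (f y))\<^sup>2) \<partial>M) < \<infinity>"
    using L2_nn_integral_finite[OF f] by (simp add: ennreal_mult_less_top)
  then show "integral_op f \<in> L2 M"
    unfolding L2_iff_nn_integral using * integral_op_measurable[OF L2_measurable[OF f]] by (auto intro: le_less_trans)
qed

lemma integral_op_L2_operator:
  assumes tot: "total < \<infinity>"
  shows "L2_operator M integral_op"
  unfolding L2_operator_def
proof (intro conjI ballI allI)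
  show "integral_op f \<in> L2 M" if "f \<in> L2 M" for f using integral_op_L2(2)[OF that tot] .
  show "AE s in M. integral_op (\<lambda>y. f y + h y) s = integral_op f s + integral_op h s"
    if f: "f \<in> L2 M" and h: "h \<in> L2 M" for f h
    using integral_op_integrable[OF tot f] integral_op_integrable[OF tot h]
  proof eventually_elim
    case (elim s)
    have "integral_op (\<lambda>y. f y + h y) s = (LINT y|M. g y s *\<^sub>C S y (f y) + g y s *\<^sub>C S y (h y))"
      unfolding integral_op_def
      by (intro Bochner_Integration.integral_cong refl)
        (simp add: bounded_clinear_add[OF S_bounded_clinear] scaleC_add_right)
    then show ?case using elim by (simp add: integral_op_def)
  qed
  show "AE s in M. integral_op (\<lambda>y. c *\<^sub>C f y) s = c *\<^sub>C integral_op f s" for c f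
  proof (rule AE_I2)
    fix s
    have "integral_op (\<lambda>y. c *\<^sub>C f y) s = (LINT y|M. c *\<^sub>C g y s *\<^sub>C S y (f y))"
      unfolding integral_op_def
      by (intro Bochner_Integration.integral_cong refl)
        (simp add: bounded_clinear_scaleC[OF S_bounded_clinear] scaleC_eq_scaleC_left[of c])
    then show "integral_op (\<lambda>y. c *\<^sub>C f y) s = c *\<^sub>C integral_op f s"
      by (simp add: integral_op_def integral_scaleC_right)
  qed
  show "\<exists>C. \<forall>f\<in>L2 M. Re (L2_inner M (integral_op f) (integral_op f)) \<le> C * Re (L2_inner M f f)"
  proof (intro exI ballI)
    fix f :: "'f \<Rightarrow> 'h" assume f: "f \<in> L2 M"
    have "ennreal (Re (L2_inner M (integral_op f) (integral_op f))) \<le> ennreal (enn2real total) * ennreal (Re (L2_inner M f f))"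
      unfolding L2_norm_nn_integral[OF f] L2_norm_nn_integral[OF integral_op_L2(2)[OF f tot]]
      using integral_op_L2(1)[OF f] tot by simp
    then show "Re (L2_inner M (integral_op f) (integral_op f)) \<le> enn2real total * Re (L2_inner M f f)"
      using L2_inner_self_nonneg[of M f] by (simp flip: ennreal_mult)
  qed
qed

lemma kernel_op_if_given_by_kernel:
  assumes T: "L2_operator M T" and gT: "given_by_kernel M g S T"
  shows "kernel_op M kernel1 T"
  unfolding kernel_op_def
proof (intro conjI ballI)
  show "L2_bounded_op M T" by (rule L2_operator_bounded_op[OF T])
  show "(\<lambda>(x, s). kernel1 x s e) \<in> borel_measurable (M \<Otimes>\<^sub>M M)" for e
    unfolding kernel1_def by measurable
  fix a :: "'f \<Rightarrow> complex" and e assume a: "a \<in> L2 M"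
  have eq: "(g x s * a x) *\<^sub>C S x e = a x *\<^sub>C kernel1 x s e" for x s
    by (simp add: kernel1_def scaleC_scaleC mult.commute)
  show "AE s in M. integrable M (\<lambda>x. a x *\<^sub>C kernel1 x s e) \<and> T (tensor a e) s = (LINT x|M. a x *\<^sub>C kernel1 x s e)"
  proof -
    have "AE s in M. integrable M (\<lambda>x. (g x s * a x) *\<^sub>C S x e) \<and> T (tensor a e) s = (LINT x|M. (g x s * a x) *\<^sub>C S x e)"
      using gT a unfolding given_by_kernel_def by blast
    then show ?thesis unfolding eq .
  qed
qed

lemma integral_op_given_by_kernel:
  assumes tot: "total < \<infinity>"
  shows "given_by_kernel M g S integral_op"
  unfolding given_by_kernel_def
proof (intro ballI allI)
  fix a :: "'f \<Rightarrow> complex" and v :: 'h assume a: "a \<in> L2 M"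
  have eq: "g x s *\<^sub>C S x (tensor a v x) = (g x s * a x) *\<^sub>C S x v" if "x \<in> space M" for x s
    using that by (simp add: tensor_def bounded_clinear_scaleC[OF S_bounded_clinear] scaleC_scaleC)
  have int: "integrable M (\<lambda>x. g x s *\<^sub>C S x (tensor a v x)) \<longleftrightarrow> integrable M (\<lambda>x. (g x s * a x) *\<^sub>C S x v)" for s
    by (intro Bochner_Integration.integrable_cong refl eq)
  have "integral_op (tensor a v) s = (LINT x|M. (g x s * a x) *\<^sub>C S x v)" for s
    unfolding integral_op_def by (intro Bochner_Integration.integral_cong refl eq)
  then show "AE s in M. integrable M (\<lambda>x. (g x s * a x) *\<^sub>C S x v) \<and>
      integral_op (tensor a v) s = (LINT x|M. (g x s * a x) *\<^sub>C S x v)"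
    using integral_op_integrable[OF tot tensor_L2[OF a, of v]] unfolding int by simp
qed

lemma integral_op_hilbert_schmidt:
  assumes tot: "total < \<infinity>"
  shows "L2_hilbert_schmidt M integral_op"
  unfolding L2_hilbert_schmidt_def
  using integral_op_L2_operator[OF tot] tot
    hs_norm_sq_kernel_op[OF kernel_op_if_given_by_kernel[OF integral_op_L2_operator[OF tot] integral_op_given_by_kernel[OF tot]]]
  unfolding nn_integral_hs_norm_sq_kernel1 by simp

text \<open>
  Both operators are bounded and agree on the tensors of a basis.
\<close>

lemma given_by_kernel_eq_integral_op:
  assumes T: "L2_operator M T" and gT: "given_by_kernel M g S T" and tot: "total < \<infinity>" and f: "f \<in> L2 M"
  shows "AE s in M. T f s = integral_op f s"
proof -
  note Tb = L2_operator_bounded_op[OF T] and Ib = L2_operator_bounded_op[OF integral_op_L2_operator[OF tot]]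
  define A :: "('f \<Rightarrow> complex) set" where "A = some_onb (L2 M) (L2_inner M)"
  have A: "is_onb (L2 M) (L2_inner M) A" unfolding A_def by (rule L2.some_onb)
  have AL: "A \<subseteq> L2 M" by (rule L2.onb_subset[OF A])
  have B: "is_onb (L2 M) (L2_inner M) (tensor_basis A :: ('f \<Rightarrow> 'h) set)" by (rule tensor_basis_onb[OF A])
  show ?thesis
  proof (rule L2_eq_AE_if_inner_eq[OF L2.bounded_op_closed[OF Tb f] L2.bounded_op_closed[OF Ib f]])
    fix w :: "'f \<Rightarrow> 'h" assume w: "w \<in> L2 M"
    show "L2_inner M (T f) w = L2_inner M (integral_op f) w"
    proof (rule L2.functional_eq_if_eq_on_onb[OF B L2.bounded_op_functional[OF Tb w] L2.bounded_op_functional[OF Ib w] _ f])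
      fix b :: "'f \<Rightarrow> 'h" assume "b \<in> tensor_basis A"
      then obtain a e where b: "b = tensor a e" "a \<in> L2 M" using AL unfolding tensor_basis_def by auto
      have bL: "b \<in> L2 M" unfolding b by (rule tensor_L2[OF b(2)])
      have "AE s in M. integrable M (\<lambda>x. (g x s * a x) *\<^sub>C S x e) \<and> T b s = (LINT x|M. (g x s * a x) *\<^sub>C S x e)"
        using gT b(2) unfolding given_by_kernel_def b(1) by blast
      moreover have "AE s in M. integrable M (\<lambda>x. (g x s * a x) *\<^sub>C S x e) \<and> integral_op b s = (LINT x|M. (g x s * a x) *\<^sub>C S x e)"
        using integral_op_given_by_kernel[OF tot] b(2) unfolding given_by_kernel_def b(1) by blast
      ultimately have "AE s in M. T b s = integral_op b s" by eventually_elim simp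
      then show "L2_inner M (T b) w = L2_inner M (integral_op b) w"
        by (intro L2_inner_cong_AE L2_measurable w L2.bounded_op_closed[OF Tb] L2.bounded_op_closed[OF Ib] bL) auto
    qed
  qed
qed

lemma path_measurable:
  assumes n: "n \<ge> 1" and X: "\<And>j. j \<in> {1..n} \<Longrightarrow> (\<lambda>\<omega>. X \<omega> j) \<in> measurable N M"
    and s: "s \<in> measurable N M" and w: "w \<in> borel_measurable N"
  shows "(\<lambda>\<omega>. weight n (X \<omega>) (s \<omega>) *\<^sub>C chain S n (X \<omega>) (w \<omega>)) \<in> borel_measurable N"
  by (rule borel_measurable_scaleC[OF weight_measurable(1)[OF n X s] chain_measurable[OF X w]])

definition path_integral :: "nat \<Rightarrow> ('f \<Rightarrow> 'h) \<Rightarrow> 'f \<Rightarrow> 'h" where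
  "path_integral n f s = (LINT x|paths n. weight n x s *\<^sub>C chain S n x (f (x 1)))"

lemma paths_space: "x \<in> space (paths n) \<Longrightarrow> j \<in> {1..n} \<Longrightarrow> x j \<in> space M"
  by (auto simp: space_PiM)

lemma tails_space: "z \<in> space (tails n) \<Longrightarrow> y \<in> space M \<Longrightarrow> j \<in> {1..n} \<Longrightarrow> (z(1 := y)) j \<in> space M"
  by (cases "j = 1") (auto simp: space_PiM)

lemma path_integrable:
  assumes n: "n \<ge> 1" and f: "f \<in> borel_measurable M" and s: "s \<in> space M"
    and fin: "smear n (\<lambda>y. ennreal (norm (f y))) s < \<infinity>"
  shows "integrable (paths n) (\<lambda>x. weight n x s *\<^sub>C chain S n x (f (x 1)))"
proof (rule integrableI_bounded)
  show "(\<lambda>x. weight n x s *\<^sub>C chain S n x (f (x 1))) \<in> borel_measurable (paths n)"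
  proof (rule path_measurable[OF n])
    show "(\<lambda>x. f (x 1)) \<in> borel_measurable (paths n)"
      by (rule measurable_compose[OF paths_coordinate[OF measurable_ident_sets[OF refl]] f]) (use n in auto)
  qed (use s in \<open>auto intro: paths_coordinate[OF measurable_ident_sets[OF refl]]\<close>)
  have "(\<integral>\<^sup>+x. ennreal (norm (weight n x s *\<^sub>C chain S n x (f (x 1)))) \<partial>paths n) \<le> smear n (\<lambda>y. ennreal (norm (f y))) s"
    unfolding smear_def by (intro nn_integral_mono norm_path_le n paths_space)
  then show "(\<integral>\<^sup>+x. ennreal (norm (weight n x s *\<^sub>C chain S n x (f (x 1)))) \<partial>paths n) < \<infinity>"
    using fin by (rule le_less_trans)
qed

lemma path_integral_measurable:
  assumes n: "n \<ge> 1" and f: "f \<in> borel_measurable M"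
  shows "path_integral n f \<in> borel_measurable M"
proof -
  interpret P: sigma_finite_measure "paths n" by (rule PM.sigma_finite) simp
  have "(\<lambda>\<omega>. weight n (snd \<omega>) (fst \<omega>) *\<^sub>C chain S n (snd \<omega>) (f (snd \<omega> 1))) \<in> borel_measurable (M \<Otimes>\<^sub>M paths n)"
  proof (rule path_measurable[OF n])
    show "(\<lambda>\<omega>. f (snd \<omega> 1)) \<in> borel_measurable (M \<Otimes>\<^sub>M paths n)"
      by (rule measurable_compose[OF paths_coordinate[OF measurable_snd] f]) (use n in auto)
  qed (auto intro: paths_coordinate[OF measurable_snd])
  then have "(\<lambda>s. path_integral n f s) \<in> borel_measurable M"
    unfolding path_integral_def by (intro P.borel_measurable_lebesgue_integral) (simp add: case_prod_beta')
  then show ?thesis .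
qed

lemma path_integral_1: "f \<in> borel_measurable M \<Longrightarrow> s \<in> space M \<Longrightarrow> path_integral 1 f s = integral_op f s"
proof -
  assume [measurable]: "f \<in> borel_measurable M" "s \<in> space M"
  have "path_integral 1 f s = (LINT x|(\<Pi>\<^sub>M i\<in>{1::nat}. M). (\<lambda>y. g y s *\<^sub>C S y (f y)) (x 1))"
    unfolding path_integral_def weight_def by simp
  also have "\<dots> = integral_op f s"
    unfolding integral_op_def by (rule PM.product_integral_singleton) measurable
  finally show ?thesis .
qed

text \<open>
  The last point of the path is integrated last, and \<open>S y\<close> is moved under the integral over the
  remaining points.
\<close>

lemma path_integral_Suc:
  assumes tot: "total < \<infinity>" and n: "n \<ge> 1" and f: "f \<in> L2 M"
  shows "AE s in M. path_integral (Suc n) f s = integral_op (path_integral n f) s"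
proof -
  let ?u = "\<lambda>y. ennreal (norm (f y))"
  note fm = L2_measurable[OF f]
  show ?thesis
    using smear_finite_AE[OF tot le_SucI[OF n] f] AE_space
  proof eventually_elim
    case (elim s)
    let ?G = "\<lambda>x. weight (Suc n) x s *\<^sub>C chain S (Suc n) x (f (x 1))"
    have int: "integrable (PiM (insert (Suc n) {1..n}) (\<lambda>_. M)) ?G"
      using path_integrable[OF le_SucI[OF n] fm elim(2,1)] unfolding paths_Suc .
    have G: "?G (x(Suc n := y)) = g y s *\<^sub>C S y (weight n x y *\<^sub>C chain S n x (f (x 1)))" if y: "y \<in> space M" for x y
    proof -
      have "(x(Suc n := y)) 1 = x 1" using n by simp
      then show ?thesis
        unfolding weight_Suc(1)[OF n] chain_Suc_upd
        by (simp add: bounded_clinear_scaleC[OF S_bounded_clinear[OF y]] scaleC_scaleC mult.commute)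
    qed
    have "path_integral (Suc n) f s = integral\<^sup>L (PiM (insert (Suc n) {1..n}) (\<lambda>_. M)) ?G"
      unfolding path_integral_def paths_Suc ..
    also have "\<dots> = (LINT y|M. LINT x|paths n. ?G (x(Suc n := y)))"
      by (rule PM.integral_PiM_insert(3)[OF _ _ int]) auto
    also have "\<dots> = (LINT y|M. g y s *\<^sub>C S y (path_integral n f y))"
    proof (rule integral_cong_AE)
      show "(\<lambda>y. LINT x|paths n. ?G (x(Suc n := y))) \<in> borel_measurable M"
        by (rule borel_measurable_integrable, rule PM.integral_PiM_insert(2)[OF _ _ int]) auto
      show "(\<lambda>y. g y s *\<^sub>C S y (path_integral n f y)) \<in> borel_measurable M"
        by (intro integral_op_integrand_measurable path_integral_measurable n fm elim(2))
      show "AE y in M. (LINT x|paths n. ?G (x(Suc n := y))) = g y s *\<^sub>C S y (path_integral n f y)"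
        using smear_finite_AE[OF tot n f] AE_space
      proof eventually_elim
        case (elim y)
        have int': "integrable (paths n) (\<lambda>x. weight n x y *\<^sub>C chain S n x (f (x 1)))"
          by (rule path_integrable[OF n fm elim(2,1)])
        have "(LINT x|paths n. ?G (x(Suc n := y))) = g y s *\<^sub>C (LINT x|paths n. S y (weight n x y *\<^sub>C chain S n x (f (x 1))))"
          unfolding G[OF elim(2)] by (rule integral_scaleC_right)
        also have "(LINT x|paths n. S y (weight n x y *\<^sub>C chain S n x (f (x 1)))) = S y (path_integral n f y)"
          unfolding path_integral_def
          by (rule integral_bounded_linear[OF bounded_clinear_bounded_linear[OF S_bounded_clinear[OF elim(2)]] int'])
        finally show ?case .
      qed
    qed
    finally show ?case unfolding integral_op_def .
  qed
qed

lemma funpow_eq_path_integral: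
  assumes T: "L2_operator M T" and gT: "given_by_kernel M g S T" and tot: "total < \<infinity>"
    and n: "n \<ge> 1" and f: "f \<in> L2 M"
  shows "AE s in M. (T ^^ n) f s = path_integral n f s"
  using n
proof (induction n rule: nat_induct_at_least)
  case base
  show ?case
    using given_by_kernel_eq_integral_op[OF T gT tot f] AE_space
  proof eventually_elim
    case (elim s)
    have "(T ^^ 1) f s = T f s" by simp
    then show ?case unfolding path_integral_1[OF L2_measurable[OF f] elim(2)] elim(1) .
  qed
next
  case (Suc n)
  note Tb = L2_operator_bounded_op[OF T]
  have uL: "(T ^^ n) f \<in> L2 M" by (rule L2.bounded_op_closed[OF L2.bounded_op_funpow[OF Tb Suc.hyps] f])
  note [measurable] = L2_measurable[OF uL] path_integral_measurable[OF Suc.hyps L2_measurable[OF f]]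
  have eq: "integral_op ((T ^^ n) f) s = integral_op (path_integral n f) s" if [measurable]: "s \<in> space M" for s
    unfolding integral_op_def
    by (rule integral_cong_AE) (measurable, use Suc.IH in eventually_elim, simp)
  show ?case
    using given_by_kernel_eq_integral_op[OF T gT tot uL] path_integral_Suc[OF tot Suc.hyps f] AE_space
  proof eventually_elim
    case (elim s)
    then show ?case using eq[of s] by simp
  qed
qed

definition path_kernel :: "nat \<Rightarrow> 'f \<Rightarrow> 'f \<Rightarrow> 'h \<Rightarrow> 'h" where
  "path_kernel n y s v = (LINT z|tails n. weight n (z(1 := y)) s *\<^sub>C chain S n (z(1 := y)) v)"

lemma tail_path_measurable:
  assumes n: "n \<ge> 1" and a: "a \<in> measurable N M" and b: "b \<in> measurable N M"
  shows "(\<lambda>\<omega>. weight n ((snd \<omega>)(1 := a (fst \<omega>))) (b (fst \<omega>)) *\<^sub>C chain S n ((snd \<omega>)(1 := a (fst \<omega>))) v)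
    \<in> borel_measurable (N \<Otimes>\<^sub>M tails n)"
proof (rule path_measurable[OF n])
  show "(\<lambda>\<omega>. ((snd \<omega>)(1 := a (fst \<omega>))) j) \<in> measurable (N \<Otimes>\<^sub>M tails n) M" if "j \<in> {1..n}" for j
    by (rule tails_coordinate[OF measurable_snd measurable_compose[OF measurable_fst a] that])
qed (auto intro: measurable_compose[OF measurable_fst b])

lemma path_kernel_measurable [measurable (raw)]:
  assumes n: "n \<ge> 1" and a: "a \<in> measurable N M" and b: "b \<in> measurable N M"
  shows "(\<lambda>\<omega>. path_kernel n (a \<omega>) (b \<omega>) v) \<in> borel_measurable N"
proof -
  interpret Q: sigma_finite_measure "tails n" by (rule PM.sigma_finite) simp
  show ?thesis unfolding path_kernel_def
    using tail_path_measurable[OF n a b] by (intro Q.borel_measurable_lebesgue_integral) (simp add: case_prod_beta')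
qed

lemma tail_path_integrable:
  assumes n: "n \<ge> 1" and y: "y \<in> space M" and s: "s \<in> space M" and fin: "path_bound n y s < \<infinity>"
  shows "integrable (tails n) (\<lambda>z. weight n (z(1 := y)) s *\<^sub>C chain S n (z(1 := y)) v)"
proof (rule integrableI_bounded)
  have "(\<lambda>\<omega>. (y, \<omega>)) \<in> measurable (tails n) (M \<Otimes>\<^sub>M tails n)" using y by simp
  from measurable_compose[OF this tail_path_measurable[OF n measurable_ident_sets[OF refl] measurable_const[OF s]]]
  show "(\<lambda>z. weight n (z(1 := y)) s *\<^sub>C chain S n (z(1 := y)) v) \<in> borel_measurable (tails n)" by simp
  have m: "(\<lambda>z. weight_bound n (z(1 := y)) s) \<in> borel_measurable (tails n)"
    by (rule weight_measurable(2)[OF n], rule tails_coordinate[where n=n]) (use y s in auto)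
  have "(\<integral>\<^sup>+z. ennreal (norm (weight n (z(1 := y)) s *\<^sub>C chain S n (z(1 := y)) v)) \<partial>tails n)
      \<le> (\<integral>\<^sup>+z. weight_bound n (z(1 := y)) s * ennreal (norm v) \<partial>tails n)"
    by (intro nn_integral_mono norm_path_le n tails_space y)
  also have "\<dots> = path_bound n y s * ennreal (norm v)"
    unfolding path_bound_def by (rule nn_integral_multc[OF m])
  also have "\<dots> < \<infinity>" using fin by (simp add: ennreal_mult_less_top)
  finally show "(\<integral>\<^sup>+z. ennreal (norm (weight n (z(1 := y)) s *\<^sub>C chain S n (z(1 := y)) v)) \<partial>tails n) < \<infinity>" .
qed

text \<open>
  Here the first point of the path is integrated last, since it is the argument of the function to which
  \<open>T ^^ n\<close> is applied.
\<close>

lemma kernel_op_funpow: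
  assumes T: "L2_operator M T" and gT: "given_by_kernel M g S T" and tot: "total < \<infinity>" and n: "n \<ge> 1"
  shows "kernel_op M (path_kernel n) (T ^^ n)"
  unfolding kernel_op_def
proof (intro conjI ballI)
  show "L2_bounded_op M (T ^^ n)" by (rule L2.bounded_op_funpow[OF L2_operator_bounded_op[OF T] n])
  show "(\<lambda>(x, s). path_kernel n x s e) \<in> borel_measurable (M \<Otimes>\<^sub>M M)" for e
    using path_kernel_measurable[OF n measurable_fst measurable_snd] by (simp add: case_prod_beta')
  fix a :: "'f \<Rightarrow> complex" and e :: 'h assume a: "a \<in> L2 M"
  have t: "tensor a e \<in> L2 M" by (rule tensor_L2[OF a])
  show "AE s in M. integrable M (\<lambda>x. a x *\<^sub>C path_kernel n x s e) \<and>
      (T ^^ n) (tensor a e) s = (LINT x|M. a x *\<^sub>C path_kernel n x s e)"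
    using funpow_eq_path_integral[OF T gT tot n t] smear_finite_AE[OF tot n t] AE_space
  proof eventually_elim
    case (elim s)
    let ?G = "\<lambda>x. weight n x s *\<^sub>C chain S n x (tensor a e (x 1))"
    have int: "integrable (PiM (insert 1 {2..n}) (\<lambda>_. M)) ?G"
      using path_integrable[OF n L2_measurable[OF t] elim(3,2)] unfolding paths_insert[OF n] .
    have G: "(LINT z|tails n. ?G (z(1 := y))) = a y *\<^sub>C path_kernel n y s e" if y: "y \<in> space M" for y
    proof -
      have "(LINT z|tails n. ?G (z(1 := y))) =
          (LINT z|tails n. a y *\<^sub>C weight n (z(1 := y)) s *\<^sub>C chain S n (z(1 := y)) e)"
      proof (intro Bochner_Integration.integral_cong refl)
        fix z assume z: "z \<in> space (tails n)"
        have "bounded_clinear (chain S n (z(1 := y)))"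
          by (rule chain_bounded_clinear) (rule tails_space[OF z y])
        then show "?G (z(1 := y)) = a y *\<^sub>C weight n (z(1 := y)) s *\<^sub>C chain S n (z(1 := y)) e"
          by (simp add: tensor_def bounded_clinear_scaleC scaleC_eq_scaleC_left[of "a y"])
      qed
      then show ?thesis unfolding path_kernel_def integral_scaleC_right .
    qed
    have "integrable M (\<lambda>y. LINT z|tails n. ?G (z(1 := y)))"
      by (rule PM.integral_PiM_insert(2)[OF _ _ int]) auto
    then have 1: "integrable M (\<lambda>y. a y *\<^sub>C path_kernel n y s e)"
      by (subst (asm) Bochner_Integration.integrable_cong[OF refl G]) auto
    have "path_integral n (tensor a e) s = (LINT y|M. LINT z|tails n. ?G (z(1 := y)))"
      unfolding path_integral_def paths_insert[OF n]
      by (rule PM.integral_PiM_insert(3)[OF _ _ int]) auto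
    also have "\<dots> = (LINT y|M. a y *\<^sub>C path_kernel n y s e)"
      by (intro Bochner_Integration.integral_cong refl G)
    finally show ?case using 1 elim(1) by simp
  qed
qed

text \<open>
  Cut the cycle at its first and last points: the integral becomes that of a path kernel times
  \<open>kernel_bound\<close> with exchanged arguments, and both are square integrable.
\<close>

lemma cycle_bound_finite:
  assumes tot: "total < \<infinity>" and m: "m \<ge> 1"
  shows "(\<integral>\<^sup>+x. weight_bound (Suc m) x (x 1) \<partial>paths (Suc m)) < \<infinity>"
proof -
  note [measurable (raw)] = path_bound_measurable[OF m]
  have ms: "(\<lambda>x. weight_bound (Suc m) x (x 1)) \<in> borel_measurable (paths (Suc m))"
    by (rule weight_measurable(2); (rule paths_coordinate[OF measurable_ident_sets[OF refl]])?) auto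
  have "(\<integral>\<^sup>+x. weight_bound (Suc m) x (x 1) \<partial>paths (Suc m)) =
      (\<integral>\<^sup>+y. \<integral>\<^sup>+x. weight_bound (Suc m) (x(Suc m := y)) ((x(Suc m := y)) 1) \<partial>paths m \<partial>M)"
    unfolding paths_Suc by (rule PM.product_nn_integral_insert_rev[OF _ _ ms[unfolded paths_Suc]]) auto
  also have "\<dots> = (\<integral>\<^sup>+y. \<integral>\<^sup>+x. weight_bound m x y * kernel_bound y (x 1) \<partial>paths m \<partial>M)"
    using m by (simp add: weight_Suc(2)[OF m])
  also have "\<dots> = (\<integral>\<^sup>+y. \<integral>\<^sup>+t. path_bound m t y * kernel_bound y t \<partial>M \<partial>M)"
  proof (rule nn_integral_cong)
    fix y assume y: "y \<in> space M"
    have my: "(\<lambda>x. weight_bound m x y * kernel_bound y (x 1)) \<in> borel_measurable (paths m)"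
      by (rule weight_path_measurable[OF m y]) (use y in measurable)
    have "(\<integral>\<^sup>+x. weight_bound m x y * kernel_bound y (x 1) \<partial>paths m) =
        (\<integral>\<^sup>+t. \<integral>\<^sup>+z. weight_bound m (z(1 := t)) y * kernel_bound y ((z(1 := t)) 1) \<partial>tails m \<partial>M)"
      unfolding paths_insert[OF m]
      by (rule PM.product_nn_integral_insert_rev[OF _ _ my[unfolded paths_insert[OF m]]]) auto
    also have "\<dots> = (\<integral>\<^sup>+t. path_bound m t y * kernel_bound y t \<partial>M)"
      unfolding path_bound_def
    proof (rule nn_integral_cong)
      fix t assume t: "t \<in> space M"
      have "(\<lambda>z. weight_bound m (z(1 := t)) y) \<in> borel_measurable (tails m)"
        by (rule weight_measurable(2)[OF m], rule tails_coordinate[where n=m]) (use y t in auto)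
      from nn_integral_multc[OF this, of "kernel_bound y t"]
      show "(\<integral>\<^sup>+z. weight_bound m (z(1 := t)) y * kernel_bound y ((z(1 := t)) 1) \<partial>tails m) =
          (\<integral>\<^sup>+z. weight_bound m (z(1 := t)) y \<partial>tails m) * kernel_bound y t" by simp
    qed
    finally show "(\<integral>\<^sup>+x. weight_bound m x y * kernel_bound y (x 1) \<partial>paths m) = (\<integral>\<^sup>+t. path_bound m t y * kernel_bound y t \<partial>M)" .
  qed
  also have "\<dots> \<le> (\<integral>\<^sup>+y. \<integral>\<^sup>+t. (path_bound m t y)\<^sup>2 + (kernel_bound y t)\<^sup>2 \<partial>M \<partial>M)"
    by (intro nn_integral_mono ennreal_mult_le_sum_squares)
  also have "\<dots> = (\<integral>\<^sup>+y. (\<integral>\<^sup>+t. (path_bound m t y)\<^sup>2 \<partial>M) + (\<integral>\<^sup>+t. (kernel_bound y t)\<^sup>2 \<partial>M) \<partial>M)"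
    by (intro nn_integral_cong nn_integral_add) measurable
  also have "\<dots> = (\<integral>\<^sup>+y. \<integral>\<^sup>+t. (path_bound m t y)\<^sup>2 \<partial>M \<partial>M) + (\<integral>\<^sup>+y. \<integral>\<^sup>+t. (kernel_bound y t)\<^sup>2 \<partial>M \<partial>M)"
    by (intro nn_integral_add) measurable
  also have "(\<integral>\<^sup>+y. \<integral>\<^sup>+t. (kernel_bound y t)\<^sup>2 \<partial>M \<partial>M) = total"
    unfolding total_def by (rule MM.Fubini'[symmetric]) measurable
  also have "(\<integral>\<^sup>+y. \<integral>\<^sup>+t. (path_bound m t y)\<^sup>2 \<partial>M \<partial>M) + total < \<infinity>"
    using nn_integral_path_bound_sq_le[OF m] tot by (auto simp: power_less_top_ennreal intro: le_less_trans)
  finally show ?thesis .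
qed

section \<open>The trace of a power\<close>

definition cycle_term :: "nat \<Rightarrow> 'h \<Rightarrow> (nat \<Rightarrow> 'f) \<Rightarrow> complex" where
  "cycle_term n e x = weight n x (x 1) * cinner (chain S n x e) e"

lemma cycle_term_measurable:
  assumes n: "n \<ge> 1" shows "cycle_term n e \<in> borel_measurable (paths n)"
proof -
  have c: "(\<lambda>x. x j) \<in> measurable (paths n) M" if "j \<in> {1..n}" for j
    by (rule paths_coordinate[OF measurable_ident_sets[OF refl] that])
  have "(\<lambda>x. weight n x (x 1) * cinner (chain S n x e) e) \<in> borel_measurable (paths n)"
    by (intro borel_measurable_times borel_measurable_cinner weight_measurable(1)[OF n] chain_measurable c) (use n in auto)
  then show ?thesis unfolding cycle_term_def[abs_def] .
qed

lemma
  assumes tot: "total < \<infinity>" and n: "n \<ge> 2"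
  shows cycle_trace_integrable: "integrable (paths n) (\<lambda>x. weight n x (x 1) * op_trace_H (chain S n x))"
    and cycle_trace_has_sum: "((\<lambda>e. LINT x|paths n. cycle_term n e x) has_sum
          (LINT x|paths n. weight n x (x 1) * op_trace_H (chain S n x))) basis_H"
    and cycle_term_integrable: "e \<in> basis_H \<Longrightarrow> integrable (paths n) (cycle_term n e)"
proof -
  obtain m where m: "n = Suc m" "m \<ge> 1" using n by (cases n) auto
  have sf: "sigma_finite_measure (paths n)" by (rule PM.sigma_finite) simp
  have "(\<integral>\<^sup>+x. \<integral>\<^sup>+e. ennreal (cmod (cycle_term n e x)) \<partial>count_space basis_H \<partial>paths n) \<le>
      (\<integral>\<^sup>+x. weight_bound n x (x 1) \<partial>paths n)"
    unfolding cycle_term_def by (intro nn_integral_mono nn_integral_trace_path_le n paths_space)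
  also have "\<dots> < \<infinity>" using cycle_bound_finite[OF tot m(2)] unfolding m .
  finally have fin: "(\<integral>\<^sup>+x. \<integral>\<^sup>+e. ennreal (cmod (cycle_term n e x)) \<partial>count_space basis_H \<partial>paths n) < \<infinity>" .
  have cm: "cycle_term n e \<in> borel_measurable (paths n)" for e by (rule cycle_term_measurable) (use n in simp)
  have eq: "(LINT e|count_space basis_H. cycle_term n e x) = weight n x (x 1) * op_trace_H (chain S n x)" for x
    unfolding cycle_term_def op_trace_H_altdef by (rule integral_mult_right_zero)
  note hs = has_sum_integral[OF sf countable_basis_H cm fin]
  show "integrable (paths n) (\<lambda>x. weight n x (x 1) * op_trace_H (chain S n x))"
    using hs(1) unfolding eq .
  show "((\<lambda>e. LINT x|paths n. cycle_term n e x) has_sum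
          (LINT x|paths n. weight n x (x 1) * op_trace_H (chain S n x))) basis_H"
    using hs(2) unfolding eq .
  show "e \<in> basis_H \<Longrightarrow> integrable (paths n) (cycle_term n e)" by (rule hs(3))
qed

text \<open>
  The diagonal coefficient at \<open>e\<close> of the product of the kernel of \<open>T\<close> from \<open>snd p\<close> to
  \<open>fst p\<close> with the path kernel from \<open>fst p\<close> to \<open>snd p\<close>.
\<close>

definition trace_density :: "nat \<Rightarrow> 'h \<Rightarrow> 'f \<times> 'f \<Rightarrow> complex" where
  "trace_density m e p = g (snd p) (fst p) * cinner (S (snd p) (path_kernel m (fst p) (snd p) e)) e"

text \<open>
  Integrate over the last point \<open>y\<close>, then over the first point \<open>t\<close>; the remaining points give the
  path kernel of length \<open>m\<close> from \<open>t\<close> to \<open>y\<close>.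
\<close>

lemma cycle_integral_eq:
  assumes tot: "total < \<infinity>" and m: "m \<ge> 1" and e: "e \<in> basis_H"
    and int: "integrable (M \<Otimes>\<^sub>M M) (trace_density m e)"
  shows "(LINT x|paths (Suc m). cycle_term (Suc m) e x) = integral\<^sup>L (M \<Otimes>\<^sub>M M) (trace_density m e)"
proof -
  note [measurable (raw)] = path_kernel_measurable[OF m]
  let ?G = "cycle_term (Suc m) e"
  have intG: "integrable (PiM (insert (Suc m) {1..m}) (\<lambda>_. M)) ?G"
    using cycle_term_integrable[OF tot _ e, of "Suc m"] m unfolding paths_Suc by simp
  have G: "?G (x(Suc m := y)) = weight m x y * g y (x 1) * cinner (S y (chain S m x e)) e" for x y
  proof -
    have "(x(Suc m := y)) 1 = x 1" using m by simp
    then show ?thesis unfolding cycle_term_def weight_Suc(1)[OF m] chain_Suc_upd by simp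
  qed
  have "(LINT x|paths (Suc m). ?G x) = (LINT y|M. LINT x|paths m. ?G (x(Suc m := y)))"
    unfolding paths_Suc by (rule PM.integral_PiM_insert(3)[OF _ _ intG]) auto
  also have "\<dots> = (LINT y|M. LINT t|M. trace_density m e (t, y))"
  proof (rule integral_cong_AE)
    show "(\<lambda>y. LINT x|paths m. ?G (x(Suc m := y))) \<in> borel_measurable M"
      by (rule borel_measurable_integrable, rule PM.integral_PiM_insert(2)[OF _ _ intG]) auto
    show "(\<lambda>y. LINT t|M. trace_density m e (t, y)) \<in> borel_measurable M"
      unfolding trace_density_def by measurable
    have ae: "AE y in M. integrable (paths m) (\<lambda>x. ?G (x(Suc m := y)))"
      by (rule PM.integral_PiM_insert(1)[OF _ _ intG]) auto
    show "AE y in M. (LINT x|paths m. ?G (x(Suc m := y))) = (LINT t|M. trace_density m e (t, y))"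
      using ae path_bound_finite_AE[OF tot m] AE_space
    proof eventually_elim
      case (elim y)
      then have y[measurable]: "y \<in> space M" by simp
      let ?H = "\<lambda>x. weight m x y * g y (x 1) * cinner (S y (chain S m x e)) e"
      have intH: "integrable (PiM (insert 1 {2..m}) (\<lambda>_. M)) ?H"
        using elim(1) unfolding G paths_insert[OF m] .
      have "(LINT x|paths m. ?G (x(Suc m := y))) = (LINT t|M. LINT z|tails m. ?H (z(1 := t)))"
        unfolding G paths_insert[OF m] by (rule PM.integral_PiM_insert(3)[OF _ _ intH]) auto
      also have "\<dots> = (LINT t|M. trace_density m e (t, y))"
      proof (rule integral_cong_AE)
        show "(\<lambda>t. LINT z|tails m. ?H (z(1 := t))) \<in> borel_measurable M"
          by (rule borel_measurable_integrable, rule PM.integral_PiM_insert(2)[OF _ _ intH]) auto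
        show "(\<lambda>t. trace_density m e (t, y)) \<in> borel_measurable M"
          unfolding trace_density_def by measurable
        show "AE t in M. (LINT z|tails m. ?H (z(1 := t))) = trace_density m e (t, y)"
          using elim(2) AE_space
        proof eventually_elim
          case (elim t)
          note lin = S_bounded_clinear[OF y]
          let ?K = "\<lambda>z. weight m (z(1 := t)) y *\<^sub>C chain S m (z(1 := t)) e"
          have intK: "integrable (tails m) ?K" by (rule tail_path_integrable[OF m elim(2) y elim(1)])
          have "(LINT z|tails m. ?H (z(1 := t))) = (LINT z|tails m. g y t * cinner (S y (?K z)) e)"
            by (intro Bochner_Integration.integral_cong refl)
              (simp add: bounded_clinear_scaleC[OF lin] cinner_scaleC_left mult_ac)
          also have "\<dots> = g y t * (LINT z|tails m. cinner (S y (?K z)) e)" by (rule integral_mult_right_zero)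
          also have "(LINT z|tails m. cinner (S y (?K z)) e) = cinner (LINT z|tails m. S y (?K z)) e"
            by (rule integral_cinner_left[OF integrable_bounded_linear[OF bounded_clinear_bounded_linear[OF lin] intK]])
          also have "(LINT z|tails m. S y (?K z)) = S y (path_kernel m t y e)"
            unfolding path_kernel_def by (rule integral_bounded_linear[OF bounded_clinear_bounded_linear[OF lin] intK])
          finally have *: "(LINT z|tails m. ?H (z(1 := t))) = g y t * cinner (S y (path_kernel m t y e)) e" .
          show ?case unfolding * trace_density_def by simp
        qed
      qed
      finally show ?case .
    qed
  qed
  also have "\<dots> = integral\<^sup>L (M \<Otimes>\<^sub>M M) (trace_density m e)"
    using MM.integral_snd[of "\<lambda>t y. trace_density m e (t, y)"] int by (simp add: case_prod_beta')
  finally show ?thesis .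
qed

text \<open>
  Summation over \<open>e'\<close> is matrix multiplication on \<open>'h\<close>. It may be exchanged with the integral
  because the squared norms of both kernels are integrable.
\<close>

lemma trace_density_sum:
  assumes T: "L2_operator M T" and gT: "given_by_kernel M g S T" and tot: "total < \<infinity>" and m: "m \<ge> 1"
    and fin: "hs_norm_sq (L2 M) (L2_inner M) T < \<infinity>" and e: "e \<in> basis_H"
  shows "integrable (M \<Otimes>\<^sub>M M) (trace_density m e)"
    and "((\<lambda>e'. LINT p|(M \<Otimes>\<^sub>M M). kernel_entry (path_kernel m) e e' p * kernel_entry kernel1 e' e (snd p, fst p))
      has_sum integral\<^sup>L (M \<Otimes>\<^sub>M M) (trace_density m e)) basis_H"
proof -
  note [measurable (raw)] = path_kernel_measurable[OF m]
  note KT = kernel_op_funpow[OF T gT tot m]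
  note Tb = L2_operator_bounded_op[OF T]
  have fin_m: "hs_norm_sq (L2 M) (L2_inner M) (T ^^ m) < \<infinity>"
    by (rule L2.hs_norm_sq_funpow_finite[OF Tb fin m])
  define h where "h e' p = kernel_entry (path_kernel m) e e' p * kernel_entry kernel1 e' e (snd p, fst p)" for e' p
  have h: "h e' p = cinner (path_kernel m (fst p) (snd p) e) e' * (g (snd p) (fst p) * cinner (S (snd p) e') e)" for e' p
    unfolding h_def kernel_entry_def kernel1_def by (simp add: cinner_scaleC_left)
  have hm: "h e' \<in> borel_measurable (M \<Otimes>\<^sub>M M)" for e' unfolding h[abs_def] by measurable
  have le: "(\<integral>\<^sup>+e'. ennreal (cmod (h e' p)) \<partial>count_space basis_H) \<le>
      hs_norm_sq_H (path_kernel m (fst p) (snd p)) + hs_norm_sq_H (kernel1 (snd p) (fst p))" for p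
  proof -
    let ?v = "path_kernel m (fst p) (snd p) e"
    have "(\<integral>\<^sup>+e'. ennreal (cmod (h e' p)) \<partial>count_space basis_H) \<le>
        (\<integral>\<^sup>+e'. ennreal ((cmod (cinner ?v e'))\<^sup>2) + ennreal ((norm (kernel1 (snd p) (fst p) e'))\<^sup>2) \<partial>count_space basis_H)"
    proof (rule nn_integral_mono)
      fix e' :: 'h
      have "(norm e)\<^sup>2 = 1\<^sup>2"
        using Re_cinner_self[of e] cinner_basis_H[OF e e] by simp
      then have "norm e = 1" by (rule power2_eq_imp_eq) auto
      then have "cmod (cinner (kernel1 (snd p) (fst p) e') e) \<le> norm (kernel1 (snd p) (fst p) e')"
        using norm_cinner_le[of "kernel1 (snd p) (fst p) e'" e] by simp
      then have "ennreal (cmod (h e' p)) \<le> ennreal (cmod (cinner ?v e')) * ennreal (norm (kernel1 (snd p) (fst p) e'))"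
        unfolding h_def kernel_entry_def by (simp add: norm_mult ennreal_mult[symmetric] ennreal_leI mult_left_mono)
      also have "\<dots> \<le> (ennreal (cmod (cinner ?v e')))\<^sup>2 + (ennreal (norm (kernel1 (snd p) (fst p) e')))\<^sup>2"
        by (rule ennreal_mult_le_sum_squares)
      finally show "ennreal (cmod (h e' p)) \<le> ennreal ((cmod (cinner ?v e'))\<^sup>2) + ennreal ((norm (kernel1 (snd p) (fst p) e'))\<^sup>2)"
        by (simp add: ennreal_power)
    qed
    also have "\<dots> = ennreal ((norm ?v)\<^sup>2) + hs_norm_sq_H (kernel1 (snd p) (fst p))"
      unfolding hs_norm_sq_H_altdef parseval_norm_H[of ?v] by (rule nn_integral_add) auto
    also have "ennreal ((norm ?v)\<^sup>2) \<le> hs_norm_sq_H (path_kernel m (fst p) (snd p))"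
      unfolding hs_norm_sq_H_altdef
      using nn_integral_ge_point[OF e, of "\<lambda>e. ennreal ((norm (path_kernel m (fst p) (snd p) e))\<^sup>2)"] by simp
    finally show ?thesis by (simp add: add_right_mono)
  qed
  have m1: "(\<lambda>p. hs_norm_sq_H (path_kernel m (fst p) (snd p))) \<in> borel_measurable (M \<Otimes>\<^sub>M M)"
    by (rule borel_measurable_hs_norm_sq_H) measurable
  have m2: "(\<lambda>p. hs_norm_sq_H (kernel1 (snd p) (fst p))) \<in> borel_measurable (M \<Otimes>\<^sub>M M)"
    by (rule borel_measurable_hs_norm_sq_H) (unfold kernel1_def, measurable)
  have "(\<integral>\<^sup>+p. \<integral>\<^sup>+e'. ennreal (cmod (h e' p)) \<partial>count_space basis_H \<partial>(M \<Otimes>\<^sub>M M)) \<le>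
      (\<integral>\<^sup>+p. hs_norm_sq_H (path_kernel m (fst p) (snd p)) + hs_norm_sq_H (kernel1 (snd p) (fst p)) \<partial>(M \<Otimes>\<^sub>M M))"
    by (intro nn_integral_mono le)
  also have "\<dots> = (\<integral>\<^sup>+p. hs_norm_sq_H (path_kernel m (fst p) (snd p)) \<partial>(M \<Otimes>\<^sub>M M)) +
      (\<integral>\<^sup>+p. hs_norm_sq_H (kernel1 (snd p) (fst p)) \<partial>(M \<Otimes>\<^sub>M M))"
    by (rule nn_integral_add[OF m1 m2])
  also have "(\<integral>\<^sup>+p. hs_norm_sq_H (path_kernel m (fst p) (snd p)) \<partial>(M \<Otimes>\<^sub>M M)) =
      (\<integral>\<^sup>+s. \<integral>\<^sup>+x. hs_norm_sq_H (path_kernel m x s) \<partial>M \<partial>M)"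
    using MM.nn_integral_snd[OF m1] by simp
  also have "\<dots> = hs_norm_sq (L2 M) (L2_inner M) (T ^^ m)"
    by (rule hs_norm_sq_kernel_op[OF KT, symmetric]) (use fin_m in simp)
  also have "(\<integral>\<^sup>+p. hs_norm_sq_H (kernel1 (snd p) (fst p)) \<partial>(M \<Otimes>\<^sub>M M)) = (\<integral>\<^sup>+x. \<integral>\<^sup>+s. hs_norm_sq_H (kernel1 s x) \<partial>M \<partial>M)"
    using nn_integral_fst[OF m2] by simp
  also have "\<dots> = total" by (rule nn_integral_hs_norm_sq_kernel1)
  finally have hfin: "(\<integral>\<^sup>+p. \<integral>\<^sup>+e'. ennreal (cmod (h e' p)) \<partial>count_space basis_H \<partial>(M \<Otimes>\<^sub>M M)) < \<infinity>"
    using fin_m tot by (auto intro: le_less_trans)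
  have sf: "sigma_finite_measure (M \<Otimes>\<^sub>M M)" by (rule MM.sigma_finite_measure_axioms)
  have eq: "(LINT e'|count_space basis_H. h e' p) = trace_density m e p" if "p \<in> space (M \<Otimes>\<^sub>M M)" for p
  proof -
    have S: "H.bounded_op (S (snd p))"
      using that by (intro bounded_clinear_bounded_op S_bounded_clinear) (auto simp: space_pair_measure)
    let ?v = "path_kernel m (fst p) (snd p) e"
    have "(LINT e'|count_space basis_H. h e' p) =
        g (snd p) (fst p) * (LINT e'|count_space basis_H. cinner ?v e' * cinner (S (snd p) e') e)"
      unfolding h by (simp add: mult_ac flip: integral_mult_right_zero)
    also have "(LINT e'|count_space basis_H. cinner ?v e' * cinner (S (snd p) e') e) = cinner (S (snd p) ?v) e"
      using H.bounded_op_expansion[OF basis_H S, of ?v e] unfolding has_sum_complex_iff_integral by simp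
    finally show ?thesis by (simp add: trace_density_def)
  qed
  note hs = has_sum_integral[OF sf countable_basis_H hm hfin]
  show "integrable (M \<Otimes>\<^sub>M M) (trace_density m e)"
    using hs(1) by (subst (asm) Bochner_Integration.integrable_cong[OF refl eq]) auto
  have "integral\<^sup>L (M \<Otimes>\<^sub>M M) (trace_density m e) = integral\<^sup>L (M \<Otimes>\<^sub>M M) (\<lambda>p. LINT e'|count_space basis_H. h e' p)"
    by (intro Bochner_Integration.integral_cong refl) (simp add: eq)
  then show "((\<lambda>e'. LINT p|(M \<Otimes>\<^sub>M M). kernel_entry (path_kernel m) e e' p * kernel_entry kernel1 e' e (snd p, fst p))
      has_sum integral\<^sup>L (M \<Otimes>\<^sub>M M) (trace_density m e)) basis_H"
    using hs(2) unfolding h_def by simp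
qed

text \<open>
  Both series over \<open>e\<close> have the same terms: one is the trace of the product of \<open>T\<close> and
  \<open>T ^^ m\<close>, the other one the trace under the integral over cycles.
\<close>

lemma op_trace_funpow:
  assumes T: "L2_operator M T" and gT: "given_by_kernel M g S T" and tot: "total < \<infinity>"
    and fin: "hs_norm_sq (L2 M) (L2_inner M) T < \<infinity>" and n: "n \<ge> 2"
  shows "trace_class (L2 M) (L2_inner M) (T ^^ n)"
    and "op_trace (L2 M) (L2_inner M) (T ^^ n) = (LINT x|paths n. weight n x (x 1) * op_trace_H (chain S n x))"
proof -
  obtain m where m: "n = Suc m" "m \<ge> 1" using n by (cases n) auto
  note Tb = L2_operator_bounded_op[OF T]
  have fin_m: "hs_norm_sq (L2 M) (L2_inner M) (T ^^ m) < \<infinity>"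
    by (rule L2.hs_norm_sq_funpow_finite[OF Tb fin m(2)])
  have Tn: "T ^^ n = T \<circ> T ^^ m" by (simp add: m)
  show "trace_class (L2 M) (L2_inner M) (T ^^ n)"
    unfolding Tn by (rule L2.trace_class_comp[OF Tb fin L2.bounded_op_funpow[OF Tb m(2)] fin_m])
  have "((\<lambda>(e, e'). LINT p|(M \<Otimes>\<^sub>M M). kernel_entry (path_kernel m) e e' p * kernel_entry kernel1 e' e (snd p, fst p))
     has_sum op_trace (L2 M) (L2_inner M) (T ^^ n)) (basis_H \<times> basis_H)"
    unfolding Tn
    by (rule op_trace_kernel_ops[OF kernel_op_if_given_by_kernel[OF T gT] fin kernel_op_funpow[OF T gT tot m(2)] fin_m])
  then have "((\<lambda>e. integral\<^sup>L (M \<Otimes>\<^sub>M M) (trace_density m e)) has_sum op_trace (L2 M) (L2_inner M) (T ^^ n)) basis_H"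
    by (rule has_sum_SigmaD) (use trace_density_sum(2)[OF T gT tot m(2) fin] in simp)
  moreover have "((\<lambda>e. integral\<^sup>L (M \<Otimes>\<^sub>M M) (trace_density m e)) has_sum
      (LINT x|paths n. weight n x (x 1) * op_trace_H (chain S n x))) basis_H"
    using cycle_trace_has_sum[OF tot n]
    by (rule has_sum_cong[THEN iffD1, rotated])
      (simp only: m cycle_integral_eq[OF tot m(2) _ trace_density_sum(1)[OF T gT tot m(2) fin]])
  ultimately show "op_trace (L2 M) (L2_inner M) (T ^^ n) = (LINT x|paths n. weight n x (x 1) * op_trace_H (chain S n x))"
    by (rule has_sum_unique)
qed

end

section \<open>The characterization and the formulas\<close>

theorem lemma1p6:
  fixes M :: "'f measure"
    and g :: "'f \<Rightarrow> 'f \<Rightarrow> complex"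
    and S :: "'f \<Rightarrow> 'h \<Rightarrow> 'h::{chilbert_space, second_countable_topology}"
  assumes "sigma_finite_measure M"
    and "(\<lambda>(x, \<sigma>). g x \<sigma>) \<in> borel_measurable (M \<Otimes>\<^sub>M M)"
    and "\<And>x. x \<in> space M \<Longrightarrow> bounded_clinear (S x)"
    and "\<And>v. (\<lambda>x. S x v) \<in> borel_measurable M"
  shows
    "((\<exists>T. L2_hilbert_schmidt M T \<and> given_by_kernel M g S T) \<longleftrightarrow>
        (\<integral>\<^sup>+x. (\<integral>\<^sup>+\<sigma>. ennreal ((cmod (g x \<sigma>))\<^sup>2) \<partial>M) * hs_norm_sq_H (S x) \<partial>M) < \<infinity>) \<and>
     (\<forall>T. L2_hilbert_schmidt M T \<and> given_by_kernel M g S T \<longrightarrow>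
        hs_norm_sq (L2 M) (L2_inner M) T =
          (\<integral>\<^sup>+x. (\<integral>\<^sup>+\<sigma>. ennreal ((cmod (g x \<sigma>))\<^sup>2) \<partial>M) * hs_norm_sq_H (S x) \<partial>M) \<and>
        (\<forall>n\<ge>2.
          trace_class (L2 M) (L2_inner M) (T ^^ n) \<and>
          integrable (\<Pi>\<^sub>M i\<in>{1..n}. M)
            (\<lambda>x. (\<Prod>j=1..n-1. g (x j) (x (j + 1))) * g (x n) (x 1) * op_trace_H (chain S n x)) \<and>
          op_trace (L2 M) (L2_inner M) (T ^^ n) =
            (LINT x|(\<Pi>\<^sub>M i\<in>{1..n}. M).
              (\<Prod>j=1..n-1. g (x j) (x (j + 1))) * g (x n) (x 1) * op_trace_H (chain S n x))) \<and>
        (\<forall>n\<ge>2.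
          (AE \<sigma> in M. AE y in M. \<forall>v.
            integrable (\<Pi>\<^sub>M i\<in>{2..n}. M)
              (\<lambda>z. let x = z(1 := y) in
                ((\<Prod>j=1..n-1. g (x j) (x (j + 1))) * g (x n) \<sigma>) *\<^sub>C chain S n x v)) \<and>
          hs_norm_sq (L2 M) (L2_inner M) (T ^^ n) =
            (\<integral>\<^sup>+\<sigma>. (\<integral>\<^sup>+y.
              hs_norm_sq_H (\<lambda>v. LINT z|(\<Pi>\<^sub>M i\<in>{2..n}. M). (let x = z(1 := y) in
                ((\<Prod>j=1..n-1. g (x j) (x (j + 1))) * g (x n) \<sigma>) *\<^sub>C chain S n x v))
              \<partial>M) \<partial>M)))"
proof -
  interpret sigma_finite_measure M by (rule assms(1))
  interpret operator_kernel M g S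
    by unfold_locales (use assms in auto)
  have hs_eq: "hs_norm_sq (L2 M) (L2_inner M) T = total"
    if "L2_hilbert_schmidt M T" "given_by_kernel M g S T" for T
    using that hs_norm_sq_kernel_op[OF kernel_op_if_given_by_kernel[of T]]
    unfolding L2_hilbert_schmidt_def nn_integral_hs_norm_sq_kernel1 by blast
  show ?thesis
    unfolding total_eq[symmetric]
  proof (intro conjI iffI allI impI; (elim exE conjE)?)
    show "total < \<infinity>" if "L2_hilbert_schmidt M T" "given_by_kernel M g S T" for T
      using hs_eq[OF that] that unfolding L2_hilbert_schmidt_def by simp
    show "\<exists>T. L2_hilbert_schmidt M T \<and> given_by_kernel M g S T" if "total < \<infinity>"
      using integral_op_hilbert_schmidt[OF that] integral_op_given_by_kernel[OF that] by blast
  next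
    fix T :: "('f \<Rightarrow> 'h) \<Rightarrow> 'f \<Rightarrow> 'h"
    assume HS: "L2_hilbert_schmidt M T" and gT: "given_by_kernel M g S T"
    show "hs_norm_sq (L2 M) (L2_inner M) T = total" by (rule hs_eq[OF HS gT])
    have T: "L2_operator M T" and fin: "hs_norm_sq (L2 M) (L2_inner M) T < \<infinity>"
      using HS unfolding L2_hilbert_schmidt_def by auto
    have tot: "total < \<infinity>" using fin hs_eq[OF HS gT] by simp
    fix n :: nat assume n: "2 \<le> n"
    then have n1: "1 \<le> n" by simp
    show "trace_class (L2 M) (L2_inner M) (T ^^ n)" by (rule op_trace_funpow(1)[OF T gT tot fin n])
    show "integrable (paths n) (\<lambda>x. (\<Prod>j=1..n-1. g (x j) (x (j + 1))) * g (x n) (x 1) * op_trace_H (chain S n x))"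
      using cycle_trace_integrable[OF tot n] unfolding weight_def .
    show "op_trace (L2 M) (L2_inner M) (T ^^ n) =
        (LINT x|paths n. (\<Prod>j=1..n-1. g (x j) (x (j + 1))) * g (x n) (x 1) * op_trace_H (chain S n x))"
      using op_trace_funpow(2)[OF T gT tot fin n] unfolding weight_def .
    show "AE \<sigma> in M. AE y in M. \<forall>v. integrable (tails n) (\<lambda>z. let x = z(1 := y) in
        ((\<Prod>j=1..n-1. g (x j) (x (j + 1))) * g (x n) \<sigma>) *\<^sub>C chain S n x v)"
      using path_bound_finite_AE[OF tot n1] AE_space
    proof eventually_elim
      case (elim \<sigma>)
      from elim(1) AE_space show ?case
      proof eventually_elim
        case (elim y)
        then show ?case
          using tail_path_integrable[OF n1 elim(2) \<open>\<sigma> \<in> space M\<close> elim(1)] unfolding weight_def Let_def by blast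
      qed
    qed
    have "hs_norm_sq (L2 M) (L2_inner M) (T ^^ n) = (\<integral>\<^sup>+\<sigma>. \<integral>\<^sup>+y. hs_norm_sq_H (path_kernel n y \<sigma>) \<partial>M \<partial>M)"
      using hs_norm_sq_kernel_op[OF kernel_op_funpow[OF T gT tot n1]]
        L2.hs_norm_sq_funpow_finite[OF L2_operator_bounded_op[OF T] fin n1] by blast
    then show "hs_norm_sq (L2 M) (L2_inner M) (T ^^ n) =
        (\<integral>\<^sup>+\<sigma>. (\<integral>\<^sup>+y. hs_norm_sq_H (\<lambda>v. LINT z|tails n. (let x = z(1 := y) in
            ((\<Prod>j=1..n-1. g (x j) (x (j + 1))) * g (x n) \<sigma>) *\<^sub>C chain S n x v)) \<partial>M) \<partial>M)"
      unfolding path_kernel_def[abs_def] weight_def Let_def .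
  qed
qed

end
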